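(* Let $s\in(0,1)$, and let $L$ be the operator in $\mathbb{R}^2$ given by $-Lu=(-\partial_{x_1x_1})^su+(-\partial_{x_2x_2})^su$. Let $\alpha\in(0,s]$, and let $\epsilon>0$ be small. Then there exists a function $u$ on $\mathbb{R}^2$ satisfying: (i) $Lu=0$ in $B_1$; (ii) $u\in C^{\alpha-\epsilon}(\mathbb{R}^2)$; (iii) $u\equiv0$ in $B_2\setminus B_1$; (iv) $u\notin C^{\alpha+2s}(B_{1/2})$.
   Context: $B_r$ is the ball of radius $r$ centered at the origin in $\mathbb{R}^2$. Here $(-\partial_{x_ix_i})^s$ is the one-dimensional fractional Laplacian in the variable $x_i$; up to a positive multiplicative constant, $-Lw(a,b)=\int_{-\infty}^\infty\frac{w(a,b)-w(a,b+t)}{|t|^{1+2s}}dt+\int_{-\infty}^\infty\frac{w(a,b)-w(a+t,b)}{|t|^{1+2s}}dt$ (principal value). The equation $Lu=0$ in $B_1$ is understood in the weak (distributional) sense: $\int_{\mathbb{R}^2}u\,L\varphi\,dx=0$ for all $\varphi\in C_c^\infty(B_1)$. For $\gamma=k+\gamma'$ with $k\ge0$ an integer and $\gamma'\in(0,1]$, $C^\gamma$ denotes the Hölder space $C^{k,\gamma'}$. "$\epsilon>0$ small" means all sufficiently small $\epsilon>0$ (depending on $s$, $\alpha$), in particular $\epsilon<\alpha$. *)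

theory Defs
  imports "HOL-Analysis.Analysis"
begin

definition partial_deriv :: "'n::finite \<Rightarrow> (real^'n \<Rightarrow> real) \<Rightarrow> real^'n \<Rightarrow> real" where
  "partial_deriv i f x = frechet_derivative f (at x) (axis i 1)"

fun iter_partial :: "'n::finite list \<Rightarrow> (real^'n \<Rightarrow> real) \<Rightarrow> real^'n \<Rightarrow> real" where
  "iter_partial [] f = f"
| "iter_partial (i # is) f = partial_deriv i (iter_partial is f)"

text \<open>The next two definitions are meant for open sets \<open>S\<close>. Differentiability
  of the partial derivatives of order below \<open>k\<close> makes those of order up to \<open>k\<close> meaningful.\<close>

definition Ck_on :: "nat \<Rightarrow> (real^'n::finite) set \<Rightarrow> (real^'n \<Rightarrow> real) \<Rightarrow> bool" where
  "Ck_on k S f \<longleftrightarrow>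
     (\<forall>is. length is < k \<longrightarrow> (\<forall>x\<in>S. iter_partial is f differentiable (at x))) \<and>
     (\<forall>is. length is \<le> k \<longrightarrow> continuous_on S (iter_partial is f))"

text \<open>\<open>holder_space \<gamma> S\<close> is $C^{k,\gamma'}(S)$ with $\gamma = k + \gamma'$ and
  $\gamma' \in (0,1]$, so that integer \<open>\<gamma>\<close> gives $C^{\gamma-1,1}$. It consists of the
  functions of finite norm: all derivatives up to order \<open>k\<close> are bounded on \<open>S\<close>, and the
  Hoelder seminorm of those of order \<open>k\<close> is taken over all of \<open>S\<close>, not only locally.\<close>

definition holder_space :: "real \<Rightarrow> (real^'n::finite) set \<Rightarrow> (real^'n \<Rightarrow> real) set" where
  "holder_space \<gamma> S = {f. \<exists>k \<gamma>'. \<gamma> = real k + \<gamma>' \<and> 0 < \<gamma>' \<and> \<gamma>' \<le> 1 \<and>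
     Ck_on k S f \<and>
     (\<forall>is. length is \<le> k \<longrightarrow> bounded (iter_partial is f ` S)) \<and>
     (\<forall>is. length is = k \<longrightarrow> (\<exists>C. \<forall>x\<in>S. \<forall>y\<in>S.
        \<bar>iter_partial is f x - iter_partial is f y\<bar> \<le> C * dist x y powr \<gamma>'))}"

definition test_functions :: "(real^'n::finite) set \<Rightarrow> (real^'n \<Rightarrow> real) set" where
  "test_functions U = {\<phi>. (\<forall>k. Ck_on k UNIV \<phi>) \<and>
     compact (closure {x. \<phi> x \<noteq> 0}) \<and> closure {x. \<phi> x \<noteq> 0} \<subseteq> U}"

text \<open>The normalising constant $c_{1,s} = 4^s \Gamma(1/2+s) / (\sqrt\pi\, |\Gamma(-s)|)$, for
  which the one-dimensional fractional Laplacian has Fourier symbol $|\xi|^{2s}$.\<close>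

definition frac_const :: "real \<Rightarrow> real" where
  "frac_const s = 4 powr s * Gamma (1/2 + s) / (sqrt pi * \<bar>Gamma (- s)\<bar>)"

text \<open>$(-\partial_{x_i x_i})^s w(x)$, as a principal value at \<open>t = 0\<close>. The limit exists for
  bounded functions that are smooth near \<open>x\<close>, in particular for all test functions.\<close>

definition frac_laplacian_1d ::
    "real \<Rightarrow> 'n::finite \<Rightarrow> (real^'n \<Rightarrow> real) \<Rightarrow> real^'n \<Rightarrow> real" where
  "frac_laplacian_1d s i w x = frac_const s *
     Lim (at_right 0) (\<lambda>\<delta>. LINT t:{t. \<delta> < \<bar>t\<bar>}|lborel.
       (w x - w (x + t *\<^sub>R axis i 1)) / \<bar>t\<bar> powr (1 + 2 * s))"

definition L_op :: "real \<Rightarrow> (real^2 \<Rightarrow> real) \<Rightarrow> real^2 \<Rightarrow> real" where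
  "L_op s w x = - (frac_laplacian_1d s 1 w x + frac_laplacian_1d s 2 w x)"

text \<open>\<open>Lu = 0\<close> in \<open>U\<close> in the distributional sense, including the convergence of the
  integrals of \<open>u L\<phi>\<close> over the plane.\<close>

definition weak_solution :: "real \<Rightarrow> (real^2) set \<Rightarrow> (real^2 \<Rightarrow> real) \<Rightarrow> bool" where
  "weak_solution s U u \<longleftrightarrow>
     (\<forall>\<phi>\<in>test_functions U. has_bochner_integral lborel (\<lambda>x. u x * L_op s \<phi> x) 0)"

end

theory Submission
  imports Defs "HOL-Library.Function_Algebras"
begin

text \<open>
  Put \<open>\<beta> = \<alpha> - \<epsilon>\<close> and \<open>u = w + g\<close>, where \<open>g(x) = \<eta>(x_1) min(|x_2|, 1)^\<beta>\<close> with \<open>\<eta>\<close> a bump supported in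
  \<open>[3, 5]\<close>. In the unit disc \<open>Lg\<close> is \<open>F(x) = a(x_1) |x_2|^\<beta>\<close> with \<open>a\<close> positive and Lipschitz, so \<open>w\<close> has
  to solve \<open>-Lw = F\<close> in the disc and vanish outside it.

  On a chord of half-length \<open>r\<close> the one-dimensional operator maps \<open>(r^2 - t^2)^s t^m\<close> to a polynomial
  in \<open>t\<close> and \<open>r^2\<close>. Hence \<open>p \<mapsto> -L((1 - |x|^2)^s p)\<close> acts on polynomials of bounded degree; it is
  injective by the maximum principle, so onto, and \<open>w\<close> arises by approximating \<open>F\<close> uniformly by
  polynomials. The image of \<open>p = 1\<close> is a constant, which makes \<open>(1 - |x|^2)^s\<close> a barrier.

  For the Hoelder bound, \<open>w(x + h) - w(x)\<close> is \<open>O(|h|^s)\<close> unless both points lie in the disc, and there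
  it solves the equation with right-hand side \<open>F(x + h) - F(x)\<close>; the maximum principle concludes.
  For \<open>h\<close> parallel to the second axis, that right-hand side is at most a constant times
  \<open>|h|^(\<beta>+\<tau>) |x_2|^(-\<tau>)\<close>, and a barrier behaving like \<open>- |x_2|^(2s-\<tau>)\<close> yields increments of order
  \<open>|h|^\<sigma>\<close> with \<open>\<sigma> > \<beta>\<close>. If \<open>w\<close> were in \<open>C^(\<alpha>+2s)\<close> near the origin, then testing the equation for third
  differences of \<open>w\<close> of step \<open>l\<close> against a bump of width \<open>l\<close> at the line \<open>x_2 = 0\<close> would bound those of
  \<open>F\<close> by \<open>l^\<sigma> + l^\<alpha>\<close>, whereas they are of order \<open>l^\<beta>\<close>.
\<close>

section \<open>The fractional kernel in one dimension\<close>

text \<open>The kernel of \<open>L\<close> is carried by the two coordinate axes, so a point of the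
  disc sees the exterior only along its own horizontal and vertical line. Roughness in x_2 of a
  distant datum is therefore handed on to the right-hand side without any averaging, whereas a
  kernel with a density in the plane would smooth it. This is why the factor |x_2|^\<beta> survives
  in F. The polynomial calculus comes from two relations on the line: the commutator of the operator
  with multiplication by x is an odd operator of order 2s - 1, and differentiating that one returns
  2s times the original. The obstacle in the final contradiction is nonlocality. The assumed
  regularity of w holds only near the origin, while the image of a bump under L reaches across the
  plane. The far part can be controlled by increments of w alone, and increments of exponent \<beta>
  would merely tie with the third differences of F, of order l^\<beta>. Hence the strict gain
  \<sigma> > \<beta> in the x_2 direction has to be proved first, by a barrier that is singular on
  the line x_2 = 0.\<close>

lemma has_bochner_integral_lborel_nonneg:
  fixes f :: "'a::euclidean_space \<Rightarrow> real"
  assumes "f \<in> borel_measurable borel" "\<And>x. x \<in> A \<Longrightarrow> 0 \<le> f x" "A \<in> sets borel"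
    "(f has_integral I) A"
  shows "has_bochner_integral lborel (\<lambda>x. indicator A x * f x) I"
proof -
  have nonneg: "0 \<le> indicator A x * f x" for x
    using assms(2)[of x] by (auto simp: indicator_def)
  have meas: "(\<lambda>x. indicator A x * f x) \<in> borel_measurable borel"
    using assms(1,3) by measurable
  have "((\<lambda>x. if x \<in> A then f x else 0) has_integral I) UNIV"
    using assms(4) by (simp add: has_integral_restrict_UNIV)
  moreover have "(\<lambda>x. if x \<in> A then f x else 0) = (\<lambda>x. indicator A x * f x)"
    by (auto simp: indicator_def)
  ultimately have I: "((\<lambda>x. indicator A x * f x) has_integral I) UNIV" by simp
  have "I \<ge> 0" using has_integral_nonneg[OF I] nonneg by blast
  then show ?thesis
    using nn_integral_has_integral_lborel[OF meas nonneg I] nonneg meas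
    by (intro has_bochner_integral_nn_integral) auto
qed

lemma Fubini_lborel:
  fixes f :: "'a::euclidean_space \<Rightarrow> 'b::euclidean_space \<Rightarrow> real"
  assumes meas: "case_prod f \<in> borel_measurable (lborel \<Otimes>\<^sub>M lborel)"
    and inner: "\<And>x. integrable lborel (f x)"
    and outer: "integrable lborel (\<lambda>x. \<integral>y. \<bar>f x y\<bar> \<partial>lborel)"
  shows "integrable lborel (\<lambda>x. \<integral>y. f x y \<partial>lborel)"
    and "integrable lborel (\<lambda>y. \<integral>x. f x y \<partial>lborel)"
    and "(\<integral>y. (\<integral>x. f x y \<partial>lborel) \<partial>lborel) = (\<integral>x. (\<integral>y. f x y \<partial>lborel) \<partial>lborel)"
proof -
  have int: "integrable (lborel \<Otimes>\<^sub>M lborel) (case_prod f)"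
    using inner outer by (intro lborel_pair.Fubini_integrable[OF meas]) auto
  show "integrable lborel (\<lambda>x. \<integral>y. f x y \<partial>lborel)"
    using lborel_pair.integrable_fst'[OF int] by simp
  show "(\<integral>y. (\<integral>x. f x y \<partial>lborel) \<partial>lborel) = (\<integral>x. (\<integral>y. f x y \<partial>lborel) \<partial>lborel)"
    by (rule lborel_pair.Fubini_integral[OF int])
  have "integrable (lborel \<Otimes>\<^sub>M lborel) (\<lambda>(y, x). f x y)"
    using lborel_pair.integrable_product_swap[OF int] by (simp add: case_prod_unfold)
  from lborel_pair.integrable_fst'[OF this]
  show "integrable lborel (\<lambda>y. \<integral>x. f x y \<partial>lborel)" by simp
qed

lemma integrable_lborel_bound:
  fixes f :: "'a::euclidean_space \<Rightarrow> real"
  assumes "integrable lborel g" "f \<in> borel_measurable borel" "\<And>x. \<bar>f x\<bar> \<le> g x"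
  shows "integrable lborel f"
proof (rule Bochner_Integration.integrable_bound[OF assms(1)])
  show "AE x in lborel. norm (f x) \<le> norm (g x)"
    using assms(3) by (intro AE_I2) (metis abs_ge_self order_trans real_norm_def)
qed (use assms in auto)

lemma abs_integral_le:
  fixes f :: "'a::euclidean_space \<Rightarrow> real"
  assumes "integrable lborel g" "\<And>x. \<bar>f x\<bar> \<le> g x"
  shows "\<bar>\<integral>x. f x \<partial>lborel\<bar> \<le> (\<integral>x. g x \<partial>lborel)"
proof (cases "integrable lborel f")
  case True
  have "\<bar>\<integral>x. f x \<partial>lborel\<bar> \<le> (\<integral>x. \<bar>f x\<bar> \<partial>lborel)"
    by (rule integral_abs_bound)
  also have "\<dots> \<le> (\<integral>x. g x \<partial>lborel)"
    using True assms by (intro integral_mono) auto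
  finally show ?thesis .
next
  case False
  have "0 \<le> g x" for x using assms(2)[of x] by linarith
  then show ?thesis using False by (simp add: not_integrable_integral_eq)
qed

text \<open>Translation preserves measurability in both directions, and a function that is not
  integrable has Bochner integral 0 by convention; hence the equation of integrals carries no
  hypothesis.\<close>

lemma integrable_lborel_translate:
  fixes f :: "'a::euclidean_space \<Rightarrow> real"
  shows "integrable lborel f \<Longrightarrow> integrable lborel (\<lambda>x. f (x + c))"
    "(\<integral>x. f (x + c) \<partial>lborel) = (\<integral>x. f x \<partial>lborel)"
proof -
  have *: "distr lborel borel (\<lambda>x. x + c) = (lborel :: 'a measure)"
    using lborel_distr_plus[of c] by (simp add: add.commute[of c] cong: distr_cong)
  show "integrable lborel (\<lambda>x. f (x + c))" if "integrable lborel f"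
  proof -
    have "integrable (distr lborel borel (\<lambda>x. x + c)) f" using that by (simp add: *)
    then show ?thesis by (subst (asm) integrable_distr_eq) (use that in auto)
  qed
  show "(\<integral>x. f (x + c) \<partial>lborel) = (\<integral>x. f x \<partial>lborel)"
  proof (cases "f \<in> borel_measurable borel")
    case True
    then show ?thesis by (subst (2) *[symmetric], subst integral_distr) auto
  next
    case False
    have "(\<lambda>x. f (x + c)) \<notin> borel_measurable borel"
    proof
      assume "(\<lambda>x. f (x + c)) \<in> borel_measurable borel"
      then have "(\<lambda>x. f ((x - c) + c)) \<in> borel_measurable borel"
        by (rule measurable_compose_rev) measurable
      with False show False by simp
    qed
    with False have "\<not> integrable lborel f" "\<not> integrable lborel (\<lambda>x. f (x + c))"
      using borel_measurable_integrable by fastforce+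
    then show ?thesis by (simp add: not_integrable_integral_eq)
  qed
qed

lemma integrable_lborel_reflect:
  fixes f :: "real \<Rightarrow> real"
  shows "integrable lborel f \<Longrightarrow> integrable lborel (\<lambda>x. f (c - x))"
    "(\<integral>x. f (c - x) \<partial>lborel) = (\<integral>x. f x \<partial>lborel)"
  using lborel_integrable_real_affine[of f "-1" c] lborel_integral_real_affine[of "-1" f c] by auto

section \<open>Symmetric differences and the one-sided kernel\<close>

definition second_diff :: "(real \<Rightarrow> real) \<Rightarrow> real \<Rightarrow> real \<Rightarrow> real" where
  "second_diff f x t = 2 * f x - f (x + t) - f (x - t)"

lemma second_diff_measurable [measurable]:
  assumes [measurable]: "f \<in> borel_measurable borel" "g \<in> borel_measurable M" "h \<in> borel_measurable M"
  shows "(\<lambda>x. second_diff f (g x) (h x)) \<in> borel_measurable M"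
  unfolding second_diff_def by measurable

locale fractional_order =
  fixes s :: real
  assumes s_pos: "0 < s" and s_less_1: "s < 1"
begin

text \<open>Only the positive half-line is kept: the reflection t -> -t in the principal value is
  absorbed by the symmetric second difference.\<close>

definition kern :: "real \<Rightarrow> real" where
  "kern t = indicator {0<..} t * t powr (-1 - 2 * s)"

lemma kern_nonneg: "0 \<le> kern t" by (simp add: kern_def indicator_def)

lemma kern_zero: "t \<le> 0 \<Longrightarrow> kern t = 0" by (simp add: kern_def)

lemma kern_measurable [measurable]: "kern \<in> borel_measurable borel"
  unfolding kern_def by measurable

lemma integrable_powr_near_0:
  assumes "a > -1" "0 \<le> d"
  shows "integrable lborel (\<lambda>t::real. indicator {0<..<d} t * t powr a)"
proof -
  have "has_bochner_integral lborel (\<lambda>t::real. indicator {0..d} t * t powr a) (d powr (a+1) / (a+1))"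
    by (intro has_bochner_integral_lborel_nonneg has_integral_powr_from_0 assms) auto
  then have "integrable lborel (\<lambda>t::real. indicator {0..d} t * t powr a)"
    by (simp add: has_bochner_integral_iff)
  then show ?thesis
    by (rule integrable_lborel_bound) (auto simp: indicator_def)
qed

lemma kern_tail:
  assumes "0 < \<tau>"
  shows "has_bochner_integral lborel (\<lambda>t. indicator {\<tau>..} t * kern t) (\<tau> powr (-2 * s) / (2 * s))"
proof -
  have "has_bochner_integral lborel (\<lambda>t. indicator {\<tau>..} t * t powr (-1 - 2 * s))
      (-(\<tau> powr (-1 - 2 * s + 1)) / (-1 - 2 * s + 1))"
    using assms s_pos
    by (intro has_bochner_integral_lborel_nonneg has_integral_powr_to_inf) auto
  moreover have "(\<lambda>t. indicator {\<tau>..} t * t powr (-1 - 2 * s)) = (\<lambda>t. indicator {\<tau>..} t * kern t)"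
    using assms by (auto simp: kern_def indicator_def fun_eq_iff)
  ultimately show ?thesis by simp
qed

text \<open>Both bounds on s enter here: t^2 tames the kernel at 0 because s < 1, and the kernel is
  integrable at infinity because s > 0. The function min 1 (t^2) is the common majorant in most
  later integrability arguments.\<close>

lemma integrable_kern_min: "integrable lborel (\<lambda>t. kern t * min 1 (t\<^sup>2))"
proof -
  have "integrable lborel (\<lambda>t. indicator {0<..<1} t * t powr (1 - 2 * s) + indicator {1..} t * kern t)"
    using kern_tail[of 1] s_less_1
    by (intro Bochner_Integration.integrable_add integrable_powr_near_0) (auto simp: has_bochner_integral_iff)
  then show ?thesis
  proof (rule integrable_lborel_bound)
    fix t :: real
    have "t powr (-1 - 2 * s) * t\<^sup>2 = t powr (1 - 2 * s)" if "0 < t"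
      using that powr_add[of t "-1-2 * s" 2] by (simp add: powr_numeral)
    moreover have "t\<^sup>2 \<le> 1" if "0 < t" "t < 1" using that by (simp add: power_le_one)
    moreover have "1 \<le> t\<^sup>2" if "1 \<le> t" using that by simp
    ultimately show "\<bar>kern t * min 1 (t\<^sup>2)\<bar> \<le> indicator {0<..<1} t * t powr (1 - 2 * s) + indicator {1..} t * kern t"
      using kern_nonneg[of t] by (auto simp: kern_def indicator_def min_def abs_mult)
  qed measurable
qed

text \<open>Merges a quadratic bound for small t with a global bound. For t at least min 1 \<delta>
  the factor min 1 (t^2) is no smaller than the square of min 1 \<delta>, which explains the divisor
  of B.\<close>

lemma min_1_square_le:
  fixes t \<delta> x A B :: real
  assumes "0 < t" "0 < \<delta>" "t < \<delta> \<Longrightarrow> x \<le> A * t\<^sup>2" "x \<le> B" "0 \<le> A" "0 \<le> B"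
  shows "x \<le> (A + B / (min 1 \<delta>)\<^sup>2) * min 1 (t\<^sup>2)"
proof (cases "t < min 1 \<delta>")
  case True
  then have "t\<^sup>2 \<le> 1" using assms(1) by (intro power_le_one) auto
  moreover have "A * t\<^sup>2 \<le> (A + B / (min 1 \<delta>)\<^sup>2) * t\<^sup>2"
    using assms by (intro mult_right_mono) auto
  moreover have "x \<le> A * t\<^sup>2" using True assms by simp
  ultimately show ?thesis by (metis min.absorb2 order_trans)
next
  case False
  have "(min 1 \<delta>)\<^sup>2 \<le> min 1 (t\<^sup>2)" 
    using False assms by (auto simp: power_le_one intro!: power_mono)
  then have "B \<le> B / (min 1 \<delta>)\<^sup>2 * min 1 (t\<^sup>2)"
    using assms mult_left_mono[of "(min 1 \<delta>)\<^sup>2" "min 1 (t\<^sup>2)" B] by (simp add: field_simps)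
  also have "\<dots> \<le> (A + B / (min 1 \<delta>)\<^sup>2) * min 1 (t\<^sup>2)"
    using assms by (intro mult_right_mono) auto
  finally show ?thesis using assms by linarith
qed

lemma integrable_kern_times:
  assumes [measurable]: "f \<in> borel_measurable borel" and "\<And>t. 0 < t \<Longrightarrow> \<bar>f t\<bar> \<le> C * min 1 (t\<^sup>2)"
  shows "integrable lborel (\<lambda>t. kern t * f t)"
proof (rule integrable_lborel_bound)
  show "integrable lborel (\<lambda>t. C * (kern t * min 1 (t\<^sup>2)))"
    using integrable_kern_min by simp
  show "\<bar>kern t * f t\<bar> \<le> C * (kern t * min 1 (t\<^sup>2))" for t
    using assms(2)[of t] kern_nonneg[of t] mult_left_mono[of "\<bar>f t\<bar>" "C * min 1 (t\<^sup>2)" "kern t"]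
    by (cases "0 < t") (auto simp: kern_zero abs_mult algebra_simps)
qed measurable

text \<open>Hardy's averaging identity, obtained from \<open>\<integral>_\<tau>^\<infinity> t^(-1-2s) dt = \<tau>^(-2s) / (2s)\<close>.\<close>

lemma hardy_averaging:
  assumes [measurable]: "K \<in> borel_measurable borel"
    and K: "integrable lborel (\<lambda>\<tau>. indicator {0<..} \<tau> * \<tau> powr (-2 * s) * K \<tau>)"
  shows "(\<integral>t. kern t * (\<integral>\<tau>. indicator {0<..t} \<tau> * K \<tau> \<partial>lborel) \<partial>lborel)
    = (\<integral>\<tau>. indicator {0<..} \<tau> * \<tau> powr (-2 * s) * K \<tau> \<partial>lborel) / (2 * s)"
proof -
  define F where "F \<tau> t = indicator {0<..} \<tau> * K \<tau> * (indicator {\<tau>..} t * kern t)" for \<tau> t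
  have eq: "indicator {0<..t} \<tau> * K \<tau> * kern t = F \<tau> t" for \<tau> t
    by (auto simp: F_def indicator_def kern_def)
  have inner: "has_bochner_integral lborel (F \<tau>) (indicator {0<..} \<tau> * K \<tau> * (\<tau> powr (-2 * s) / (2 * s)))" for \<tau>
    unfolding F_def
    by (rule has_bochner_integral_mult_right, rule kern_tail) (auto simp: indicator_def split: if_splits)
  have abs_inner: "has_bochner_integral lborel (\<lambda>t. \<bar>F \<tau> t\<bar>) (indicator {0<..} \<tau> * \<bar>K \<tau>\<bar> * (\<tau> powr (-2 * s) / (2 * s)))" for \<tau>
  proof -
    have "has_bochner_integral lborel (\<lambda>t. indicator {0<..} \<tau> * \<bar>K \<tau>\<bar> * (indicator {\<tau>..} t * kern t))
       (indicator {0<..} \<tau> * \<bar>K \<tau>\<bar> * (\<tau> powr (-2 * s) / (2 * s)))"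
      by (rule has_bochner_integral_mult_right, rule kern_tail) (auto simp: indicator_def split: if_splits)
    then show ?thesis by (simp add: F_def abs_mult kern_nonneg)
  qed
  have meas: "case_prod F \<in> borel_measurable (lborel \<Otimes>\<^sub>M lborel)"
  proof -
    have "(\<lambda>(\<tau>, t). F \<tau> t) = (\<lambda>(\<tau>, t). (if 0 < \<tau> \<and> \<tau> \<le> t then K \<tau> * kern t else 0))"
      by (auto simp: F_def indicator_def)
    also have "\<dots> \<in> borel_measurable (lborel \<Otimes>\<^sub>M lborel)" by measurable
    finally show ?thesis .
  qed
  have outer: "integrable lborel (\<lambda>\<tau>. \<integral>t. \<bar>F \<tau> t\<bar> \<partial>lborel)"
  proof -
    have "integrable lborel (\<lambda>\<tau>. \<bar>indicator {0<..} \<tau> * \<tau> powr (-2 * s) * K \<tau>\<bar> / (2 * s))"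
      using K by auto
    moreover have "\<bar>indicator {0<..} \<tau> * \<tau> powr (-2 * s) * K \<tau>\<bar> / (2 * s) = (\<integral>t. \<bar>F \<tau> t\<bar> \<partial>lborel)" for \<tau>
      using abs_inner[of \<tau>] by (simp add: has_bochner_integral_iff abs_mult)
    ultimately show ?thesis by simp
  qed
  have "(\<integral>t. kern t * (\<integral>\<tau>. indicator {0<..t} \<tau> * K \<tau> \<partial>lborel) \<partial>lborel) = (\<integral>t. (\<integral>\<tau>. F \<tau> t \<partial>lborel) \<partial>lborel)"
    by (simp add: eq[symmetric] mult.commute flip: integral_mult_right_zero)
  also have "\<dots> = (\<integral>\<tau>. (\<integral>t. F \<tau> t \<partial>lborel) \<partial>lborel)"
    using inner by (intro Fubini_lborel(3) meas outer) (auto simp: has_bochner_integral_iff)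
  also have "\<dots> = (\<integral>\<tau>. indicator {0<..} \<tau> * \<tau> powr (-2 * s) * K \<tau> / (2 * s) \<partial>lborel)"
    using inner by (simp add: has_bochner_integral_iff mult_ac)
  finally show ?thesis by simp
qed

section \<open>The one-dimensional operator and its odd companion of order 2s - 1\<close>

definition frac_int :: "(real \<Rightarrow> real) \<Rightarrow> real \<Rightarrow> real" where
  "frac_int f x = (\<integral>t. kern t * second_diff f x t \<partial>lborel)"

text \<open>As a Fourier multiplier this is a positive constant times -i sign(xi) |xi|^(2s-1). It is
  the commutator of the operator with multiplication by x, and its derivative is 2s times the
  operator; all images of polynomials are computed from these two relations.\<close>

definition frac_grad :: "(real \<Rightarrow> real) \<Rightarrow> real \<Rightarrow> real" where
  "frac_grad f x = (\<integral>t. indicator {0<..} t * t powr (-2 * s) * (f (x - t) - f (x + t)) \<partial>lborel)"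

text \<open>Only symmetric differences centred in [a, b] are controlled, and only for small t;
  elsewhere integrability is all that is asked. This admits weights that blow up at the ends of a
  larger interval.\<close>

definition tame_on :: "real \<Rightarrow> real \<Rightarrow> (real \<Rightarrow> real) \<Rightarrow> bool" where
  "tame_on a b f \<longleftrightarrow> integrable lborel f \<and> (\<exists>C \<delta>. 0 < \<delta> \<and> (\<forall>z\<in>{a..b}. \<bar>f z\<bar> \<le> C \<and>
     (\<forall>t. 0 < t \<and> t < \<delta> \<longrightarrow> \<bar>second_diff f z t\<bar> \<le> C * t\<^sup>2 \<and> \<bar>f (z - t) - f (z + t)\<bar> \<le> C * t)))"

lemma tame_onE:
  assumes "tame_on a b f"
  obtains C \<delta> where "0 < \<delta>" "\<delta> \<le> 1" "0 \<le> C" "integrable lborel f" "f \<in> borel_measurable borel"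
    "\<And>z. z \<in> {a..b} \<Longrightarrow> \<bar>f z\<bar> \<le> C"
    "\<And>z t. z \<in> {a..b} \<Longrightarrow> 0 < t \<Longrightarrow> t < \<delta> \<Longrightarrow> \<bar>second_diff f z t\<bar> \<le> C * t\<^sup>2"
    "\<And>z t. z \<in> {a..b} \<Longrightarrow> 0 < t \<Longrightarrow> t < \<delta> \<Longrightarrow> \<bar>f (z - t) - f (z + t)\<bar> \<le> C * t"
proof -
  obtain C \<delta> where C: "integrable lborel f" "0 < \<delta>" "\<forall>z\<in>{a..b}. \<bar>f z\<bar> \<le> C \<and>
     (\<forall>t. 0 < t \<and> t < \<delta> \<longrightarrow> \<bar>second_diff f z t\<bar> \<le> C * t\<^sup>2 \<and> \<bar>f (z - t) - f (z + t)\<bar> \<le> C * t)"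
    using assms unfolding tame_on_def by blast
  have "C * t\<^sup>2 \<le> \<bar>C\<bar> * t\<^sup>2" "0 < t \<Longrightarrow> C * t \<le> \<bar>C\<bar> * t" for t
    by (auto intro!: mult_right_mono)
  then show ?thesis using C borel_measurable_integrable[OF C(1)]
    apply (intro that[of "min \<delta> 1" "\<bar>C\<bar>"])
    subgoal by simp
    subgoal by simp
    subgoal by simp
    subgoal by simp
    subgoal by simp
    subgoal by fastforce
    subgoal by (smt (verit))
    subgoal by (smt (verit))
    done
qed

lemma kern_le_on_tail: "0 < \<delta> \<Longrightarrow> \<delta> \<le> t \<Longrightarrow> kern t \<le> \<delta> powr (-1 - 2 * s)"
  using s_pos by (auto simp: kern_def intro: powr_mono2')

lemma kern_times_id: "kern t * t = indicator {0<..} t * t powr (-2 * s)"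
proof (cases "0 < t")
  case True
  then show ?thesis using powr_add[of t "-1 - 2 * s" 1] by (simp add: kern_def)
qed (simp add: kern_def)

lemma tame_on_integrable:
  assumes "tame_on a b f" "x \<in> {a..b}"
  shows "integrable lborel (\<lambda>t. kern t * second_diff f x t)"
    and "integrable lborel (\<lambda>t. indicator {0<..} t * t powr (-2 * s) * (f (x - t) - f (x + t)))"
proof -
  obtain C \<delta> where C: "0 < \<delta>" "\<delta> \<le> 1" "0 \<le> C" "integrable lborel f" and f_meas[measurable]: "f \<in> borel_measurable borel"
    and C1: "\<bar>f x\<bar> \<le> C"
    and C2: "\<And>t. 0 < t \<Longrightarrow> t < \<delta> \<Longrightarrow> \<bar>second_diff f x t\<bar> \<le> C * t\<^sup>2"
    and C3: "\<And>t. 0 < t \<Longrightarrow> t < \<delta> \<Longrightarrow> \<bar>f (x - t) - f (x + t)\<bar> \<le> C * t"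
    using assms(1) by (rule tame_onE) (use assms(2) in blast)
  have shifts: "integrable lborel (\<lambda>t. \<bar>f (x + t)\<bar> + \<bar>f (x - t)\<bar>)"
    using integrable_lborel_translate(1)[OF C(4), of x] integrable_lborel_reflect(1)[OF C(4), of x]
    by (auto simp: add.commute)
  define D where "D = \<delta> powr (-1 - 2 * s)"
  define A where "A = C + 2 * C / \<delta>\<^sup>2"
  show "integrable lborel (\<lambda>t. kern t * second_diff f x t)"
  proof (rule integrable_lborel_bound)
    show "integrable lborel (\<lambda>t. A * (kern t * min 1 (t\<^sup>2)) + D * (\<bar>f (x + t)\<bar> + \<bar>f (x - t)\<bar>))"
      using integrable_kern_min shifts by auto
    fix t :: real
    consider "t \<le> 0" | "0 < t" "t < \<delta>" | "0 < t" "\<delta> \<le> t" by linarith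
    then show "\<bar>kern t * second_diff f x t\<bar> \<le> A * (kern t * min 1 (t\<^sup>2)) + D * (\<bar>f (x + t)\<bar> + \<bar>f (x - t)\<bar>)"
    proof cases
      case 1
      then show ?thesis by (simp add: kern_zero D_def)
    next
      case 2
      have "t\<^sup>2 \<le> 1" using 2 C by (intro power_le_one) auto
      then have "\<bar>second_diff f x t\<bar> \<le> A * min 1 (t\<^sup>2)"
      proof -
        have "C * t\<^sup>2 \<le> A * t\<^sup>2" unfolding A_def using C by (intro mult_right_mono) auto
        then show ?thesis using C2[OF 2] \<open>t\<^sup>2 \<le> 1\<close> by simp
      qed
      then have "\<bar>kern t * second_diff f x t\<bar> \<le> A * (kern t * min 1 (t\<^sup>2))"
        using mult_left_mono[of "\<bar>second_diff f x t\<bar>" "A * min 1 (t\<^sup>2)" "kern t"]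
        by (simp add: abs_mult kern_nonneg mult.left_commute)
      moreover have "0 \<le> D * (\<bar>f (x + t)\<bar> + \<bar>f (x - t)\<bar>)" by (simp add: D_def)
      ultimately show ?thesis by linarith
    next
      case 3
      have "\<delta>\<^sup>2 \<le> min 1 (t\<^sup>2)" using 3 C by (auto simp: power_le_one intro!: power_mono)
      have "2 * C \<le> 2 * C / \<delta>\<^sup>2 * min 1 (t\<^sup>2)"
        using \<open>\<delta>\<^sup>2 \<le> min 1 (t\<^sup>2)\<close> C mult_left_mono[of "\<delta>\<^sup>2" "min 1 (t\<^sup>2)" "2 * C"] by (simp add: field_simps)
      also have "\<dots> \<le> A * min 1 (t\<^sup>2)" unfolding A_def using C by (intro mult_right_mono) auto
      finally have "2 * C \<le> A * min 1 (t\<^sup>2)" .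
      moreover have "\<bar>second_diff f x t\<bar> \<le> 2 * C + (\<bar>f (x + t)\<bar> + \<bar>f (x - t)\<bar>)"
        using C1 unfolding second_diff_def by linarith
      ultimately have "kern t * \<bar>second_diff f x t\<bar> \<le> kern t * (A * min 1 (t\<^sup>2) + (\<bar>f (x + t)\<bar> + \<bar>f (x - t)\<bar>))"
        by (intro mult_left_mono kern_nonneg) linarith
      also have "\<dots> = A * (kern t * min 1 (t\<^sup>2)) + kern t * (\<bar>f (x + t)\<bar> + \<bar>f (x - t)\<bar>)"
        by (simp add: algebra_simps)
      also have "kern t * (\<bar>f (x + t)\<bar> + \<bar>f (x - t)\<bar>) \<le> D * (\<bar>f (x + t)\<bar> + \<bar>f (x - t)\<bar>)"
        using kern_le_on_tail[of \<delta> t] 3 C by (intro mult_right_mono) (auto simp: D_def)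
      finally show ?thesis by (simp add: abs_mult kern_nonneg)
    qed
  qed measurable
  show "integrable lborel (\<lambda>t. indicator {0<..} t * t powr (-2 * s) * (f (x - t) - f (x + t)))"
  proof (rule integrable_lborel_bound)
    show "integrable lborel (\<lambda>t. C * (indicator {0<..<\<delta>} t * t powr (1 - 2 * s))
        + \<delta> powr (-2 * s) * (\<bar>f (x + t)\<bar> + \<bar>f (x - t)\<bar>))"
      using C s_less_1
      by (intro Bochner_Integration.integrable_add[OF _ integrable_mult_right[OF shifts]] integrable_mult_right integrable_powr_near_0) auto
    fix t :: real
    consider "t \<le> 0" | "0 < t" "t < \<delta>" | "0 < t" "\<delta> \<le> t" by linarith
    then show "\<bar>indicator {0<..} t * t powr (-2 * s) * (f (x - t) - f (x + t))\<bar>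
        \<le> C * (indicator {0<..<\<delta>} t * t powr (1 - 2 * s)) + \<delta> powr (-2 * s) * (\<bar>f (x + t)\<bar> + \<bar>f (x - t)\<bar>)"
    proof cases
      case 1 then show ?thesis by simp
    next
      case 2
      have "t powr (-2 * s) * \<bar>f (x - t) - f (x + t)\<bar> \<le> t powr (-2 * s) * (C * t)"
        using C3[OF 2] by (intro mult_left_mono) auto
      also have "\<dots> = C * t powr (1 - 2 * s)"
        using 2 powr_add[of t "-2 * s" 1] by simp
      finally show ?thesis using 2 by (simp add: abs_mult add_increasing2)
    next
      case 3
      have "t powr (-2 * s) * \<bar>f (x - t) - f (x + t)\<bar> \<le> \<delta> powr (-2 * s) * (\<bar>f (x + t)\<bar> + \<bar>f (x - t)\<bar>)"
        using 3 C s_pos by (intro mult_mono powr_mono2') auto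
      then show ?thesis using 3 by (simp add: abs_mult)
    qed
  qed measurable
qed

text \<open>Commuting with multiplication by x costs one factor t, which turns t^(-1-2s) into
  t^(-2s).\<close>

lemma kern_second_diff_times_id:
  "kern t * second_diff (\<lambda>z. z * f z) x t
    = x * (kern t * second_diff f x t) + indicator {0<..} t * t powr (-2 * s) * (f (x - t) - f (x + t))"
  unfolding second_diff_def kern_times_id[symmetric] by (simp add: algebra_simps)

lemma frac_int_times_id:
  assumes "tame_on a b f" "x \<in> {a..b}"
  shows "frac_int (\<lambda>z. z * f z) x = x * frac_int f x + frac_grad f x"
  using tame_on_integrable[OF assms]
  by (simp add: frac_int_def frac_grad_def kern_second_diff_times_id)

text \<open>Everything is expressed by the primitive \<Phi>, so that integrals of shifted and of
  reflected functions can be matched by comparing values of \<Phi>.\<close>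

lemma integral_interval_translate:
  fixes f :: "real \<Rightarrow> real"
  assumes f: "integrable lborel f" and "c \<le> d"
  defines "\<Phi> \<equiv> \<lambda>x. \<integral>y. indicator {..x} y * f y \<partial>lborel"
  shows "(\<integral>z. indicator {c<..d} z * f (z + t) \<partial>lborel) = \<Phi> (d + t) - \<Phi> (c + t)"
    and "(\<integral>z. indicator {c<..d} z * f (t - z) \<partial>lborel) = \<Phi> (t - c) - \<Phi> (t - d)"
    and "integrable lborel (\<lambda>z. indicator {c<..d} z * f (z + t))"
    and "integrable lborel (\<lambda>z. indicator {c<..d} z * f (t - z))"
proof -
  have [measurable]: "f \<in> borel_measurable borel" using f by auto
  have int: "integrable lborel (\<lambda>y. indicator A y * f y)" if "A \<in> sets borel" for A :: "real set"
    by (rule integrable_lborel_bound[OF integrable_abs[OF f]]) (use that in \<open>auto simp: indicator_def\<close>)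
  have key: "(\<integral>y. indicator {u<..v} y * f y \<partial>lborel) = \<Phi> v - \<Phi> u" if "u \<le> v" for u v
  proof -
    have "(\<integral>y. indicator {u<..v} y * f y \<partial>lborel) = (\<integral>y. indicator {..v} y * f y - indicator {..u} y * f y \<partial>lborel)"
      using that by (intro Bochner_Integration.integral_cong) (auto simp: indicator_def)
    then show ?thesis unfolding \<Phi>_def using int by simp
  qed
  have 1: "indicator {c<..d} z * f (z + t) = indicator {c+t<..d+t} (z + t) * f (z + t)" for z
    by (auto simp: indicator_def)
  show "(\<integral>z. indicator {c<..d} z * f (z + t) \<partial>lborel) = \<Phi> (d + t) - \<Phi> (c + t)"
    unfolding 1 using integrable_lborel_translate(2)[of "\<lambda>y. indicator {c+t<..d+t} y * f y" t] key[of "c+t" "d+t"] assms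
    by simp
  show "integrable lborel (\<lambda>z. indicator {c<..d} z * f (z + t))"
    unfolding 1 using integrable_lborel_translate(1)[OF int[of "{c+t<..d+t}"]] by simp
  have 2: "indicator {c<..d} z * f (t - z) = indicator {t-d..<t-c} (t - z) * f (t - z)" for z
    by (auto simp: indicator_def)
  have "(\<integral>z. indicator {c<..d} z * f (t - z) \<partial>lborel) = (\<integral>y. indicator {t-d..<t-c} y * f y \<partial>lborel)"
    unfolding 2 using integrable_lborel_reflect(2)[of "\<lambda>y. indicator {t-d..<t-c} y * f y" t] by simp
  also have "\<dots> = (\<integral>y. indicator {t-d<..t-c} y * f y \<partial>lborel)"
  proof (rule integral_cong_AE)
    show "AE y in lborel. indicator {t-d..<t-c} y * f y = indicator {t-d<..t-c} y * f y"
      using AE_lborel_singleton[of "t-d"] AE_lborel_singleton[of "t-c"]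
      by eventually_elim (auto simp: indicator_def)
  qed measurable
  also have "\<dots> = \<Phi> (t - c) - \<Phi> (t - d)" using key[of "t-d" "t-c"] assms by simp
  finally show "(\<integral>z. indicator {c<..d} z * f (t - z) \<partial>lborel) = \<Phi> (t - c) - \<Phi> (t - d)" .
  show "integrable lborel (\<lambda>z. indicator {c<..d} z * f (t - z))"
    unfolding 2 using integrable_lborel_reflect(1)[OF int[of "{t-d..<t-c}"], of t] by simp
qed

text \<open>Integrated form of the identity that the derivative of \<^term>\<open>frac_grad f\<close> is
  \<open>2s\<close> times \<^term>\<open>frac_int f\<close>.\<close>

lemma frac_grad_diff:
  assumes tame: "tame_on a b f" and "a \<le> b"
  shows "integrable lborel (\<lambda>z. indicator {a<..b} z * frac_int f z)"
    and "frac_grad f b - frac_grad f a = 2 * s * (\<integral>z. indicator {a<..b} z * frac_int f z \<partial>lborel)"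
proof -
  obtain C \<delta> where C: "0 < \<delta>" "\<delta> \<le> 1" "0 \<le> C" and f: "integrable lborel f" and f_meas[measurable]: "f \<in> borel_measurable borel"
    and C1: "\<And>z. z \<in> {a..b} \<Longrightarrow> \<bar>f z\<bar> \<le> C"
    and C2: "\<And>z t. z \<in> {a..b} \<Longrightarrow> 0 < t \<Longrightarrow> t < \<delta> \<Longrightarrow> \<bar>second_diff f z t\<bar> \<le> C * t\<^sup>2"
    using tame by (rule tame_onE) blast
  define G where "G t z = kern t * (indicator {a<..b} z * second_diff f z t)" for t z
  define \<Phi> where "\<Phi> = (\<lambda>x. \<integral>y. indicator {..x} y * f y \<partial>lborel)"
  note tr = integral_interval_translate[OF f]
  have int_sd: "integrable lborel (\<lambda>z. indicator {a<..b} z * second_diff f z t)" for t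
  proof -
    have "integrable lborel (\<lambda>z. 2 * (indicator {a<..b} z * f (z + 0)) - indicator {a<..b} z * f (z + t) - indicator {a<..b} z * f (z + (- t)))"
      using \<open>a \<le> b\<close> by (intro Bochner_Integration.integrable_diff integrable_mult_right tr(3))
    then show ?thesis by (simp add: second_diff_def algebra_simps)
  qed
  have int_G: "integrable lborel (G t)" for t
    unfolding G_def using int_sd by simp
  define N where "N = (\<integral>z. \<bar>f z\<bar> \<partial>lborel)"
  have N: "0 \<le> N" unfolding N_def by simp
  define B where "B = C * (b - a) + 4 * N / (min 1 \<delta>)\<^sup>2"
  have bound: "(\<integral>z. \<bar>indicator {a<..b} z * second_diff f z t\<bar> \<partial>lborel) \<le> B * min 1 (t\<^sup>2)" if t: "0 < t" for t
    unfolding B_def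
  proof (rule min_1_square_le[OF t C(1)])
    let ?I = "\<integral>z. \<bar>indicator {a<..b} z * second_diff f z t\<bar> \<partial>lborel"
    show "?I \<le> C * (b - a) * t\<^sup>2" if "t < \<delta>"
    proof -
      have "?I \<le> (\<integral>z. indicator {a<..b} z * (C * t\<^sup>2) \<partial>lborel)"
      proof (rule integral_mono)
        show "integrable lborel (\<lambda>z. indicator {a<..b} z * (C * t\<^sup>2))"
          by (intro integrable_mult_left integrable_real_indicator) (use \<open>a \<le> b\<close> in auto)
      qed (use int_sd C2 t that in \<open>auto simp: indicator_def\<close>)
      then show ?thesis using \<open>a \<le> b\<close> by (simp add: mult_ac)
    qed
    have i: "integrable lborel (\<lambda>z. \<bar>f (z + t)\<bar>)" "integrable lborel (\<lambda>z. \<bar>f (z - t)\<bar>)"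
      using integrable_lborel_translate(1)[OF integrable_abs[OF f], of t]
        integrable_lborel_translate(1)[OF integrable_abs[OF f], of "-t"] by simp_all
    have "?I \<le> (\<integral>z. 2 * \<bar>f z\<bar> + \<bar>f (z + t)\<bar> + \<bar>f (z - t)\<bar> \<partial>lborel)"
    proof (rule integral_mono)
      show "integrable lborel (\<lambda>z. 2 * \<bar>f z\<bar> + \<bar>f (z + t)\<bar> + \<bar>f (z - t)\<bar>)" using i f by simp
    qed (use int_sd in \<open>auto simp: indicator_def second_diff_def\<close>)
    also have "\<dots> = 4 * N"
      using f i integrable_lborel_translate(2)[of "\<lambda>z. \<bar>f z\<bar>" t] integrable_lborel_translate(2)[of "\<lambda>z. \<bar>f z\<bar>" "-t"]
      by (simp add: N_def)
    finally show "?I \<le> 4 * N" .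
    show "0 \<le> C * (b - a)" using C \<open>a \<le> b\<close> by simp
    show "0 \<le> 4 * N" using N by simp
  qed
  have G_meas: "case_prod G \<in> borel_measurable (lborel \<Otimes>\<^sub>M lborel)"
    unfolding G_def second_diff_def by measurable
  have outer: "integrable lborel (\<lambda>t. \<integral>z. \<bar>G t z\<bar> \<partial>lborel)"
  proof -
    have [measurable]: "(\<lambda>t. \<integral>z. \<bar>indicator {a<..b} z * second_diff f z t\<bar> \<partial>lborel) \<in> borel_measurable borel"
      unfolding second_diff_def by measurable
    have "integrable lborel (\<lambda>t. kern t * (\<integral>z. \<bar>indicator {a<..b} z * second_diff f z t\<bar> \<partial>lborel))"
      using bound by (intro integrable_kern_times[where C=B]) auto
    then show ?thesis by (simp add: G_def abs_mult[of "kern _"] kern_nonneg)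
  qed
  have swap: "(\<integral>t. G t z \<partial>lborel) = indicator {a<..b} z * frac_int f z" for z
    by (simp add: G_def frac_int_def mult.left_commute flip: integral_mult_right_zero)
  show "integrable lborel (\<lambda>z. indicator {a<..b} z * frac_int f z)"
    using Fubini_lborel(2)[OF G_meas int_G outer] by (simp add: swap)
  define K where "K \<tau> = (f (b - \<tau>) - f (b + \<tau>)) - (f (a - \<tau>) - f (a + \<tau>))" for \<tau>
  have [measurable]: "K \<in> borel_measurable borel" unfolding K_def by measurable
  \<comment> \<open>Both sides are the same combination of values of the primitive \<Phi> at a, b, a
    + t, a - t, b + t and b - t. The double integral is thus brought into the form of Hardy's
    identity without differentiating f.\<close>
  have inner: "(\<integral>z. indicator {a<..b} z * second_diff f z t \<partial>lborel) = (\<integral>\<tau>. indicator {0<..t} \<tau> * K \<tau> \<partial>lborel)" if "0 < t" for t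
  proof -
    have "(\<integral>z. indicator {a<..b} z * second_diff f z t \<partial>lborel)
      = (\<integral>z. 2 * (indicator {a<..b} z * f (z + 0)) - indicator {a<..b} z * f (z + t) - indicator {a<..b} z * f (z + (- t)) \<partial>lborel)"
      by (simp add: second_diff_def algebra_simps)
    also have "\<dots> = 2 * (\<Phi> b - \<Phi> a) - (\<Phi> (b + t) - \<Phi> (a + t)) - (\<Phi> (b - t) - \<Phi> (a - t))"
      using tr(3)[OF \<open>a \<le> b\<close>] tr(1)[OF \<open>a \<le> b\<close>] tr(3)[OF \<open>a \<le> b\<close>, of 0] tr(1)[OF \<open>a \<le> b\<close>, of 0]
        tr(3)[OF \<open>a \<le> b\<close>, of "-t"] tr(1)[OF \<open>a \<le> b\<close>, of "-t"] by (simp add: \<Phi>_def)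
    also have "\<dots> = (\<integral>\<tau>. indicator {0<..t} \<tau> * f (b - \<tau>) - indicator {0<..t} \<tau> * f (\<tau> + b)
        - (indicator {0<..t} \<tau> * f (a - \<tau>) - indicator {0<..t} \<tau> * f (\<tau> + a)) \<partial>lborel)"
      using tr[of 0 t] that by (simp add: \<Phi>_def add.commute[of t])
    also have "\<dots> = (\<integral>\<tau>. indicator {0<..t} \<tau> * K \<tau> \<partial>lborel)"
      by (simp add: K_def algebra_simps)
    finally show ?thesis .
  qed
  have K_int: "integrable lborel (\<lambda>\<tau>. indicator {0<..} \<tau> * \<tau> powr (-2 * s) * K \<tau>)"
    and K_val: "(\<integral>\<tau>. indicator {0<..} \<tau> * \<tau> powr (-2 * s) * K \<tau> \<partial>lborel) = frac_grad f b - frac_grad f a"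
    using tame_on_integrable(2)[OF tame, of a] tame_on_integrable(2)[OF tame, of b] \<open>a \<le> b\<close>
    by (auto simp: K_def frac_grad_def right_diff_distrib[of "indicator {0<..} _ * _ powr _" "_ - _" "_ - _"])
  have "(\<integral>z. indicator {a<..b} z * frac_int f z \<partial>lborel) = (\<integral>t. \<integral>z. G t z \<partial>lborel \<partial>lborel)"
    using Fubini_lborel(3)[OF G_meas int_G outer] by (simp add: swap)
  also have "\<dots> = (\<integral>t. kern t * (\<integral>\<tau>. indicator {0<..t} \<tau> * K \<tau> \<partial>lborel) \<partial>lborel)"
  proof (rule Bochner_Integration.integral_cong[OF refl])
    fix t
    show "(\<integral>z. G t z \<partial>lborel) = kern t * (\<integral>\<tau>. indicator {0<..t} \<tau> * K \<tau> \<partial>lborel)"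
      using inner[of t] by (cases "0 < t") (auto simp: G_def kern_zero)
  qed
  also have "\<dots> = (frac_grad f b - frac_grad f a) / (2 * s)"
    using hardy_averaging[OF _ K_int] K_val by simp
  finally show "frac_grad f b - frac_grad f a = 2 * s * (\<integral>z. indicator {a<..b} z * frac_int f z \<partial>lborel)"
    using s_pos by simp
qed

end

section \<open>Weighted powers on an interval\<close>

text \<open>The mean value theorem for f(z + \<tau>) + f(z - \<tau>) leaves one difference of f'. A
  Lipschitz derivative is assumed in place of a second one so that the estimate also covers a bump
  that is only C^{1,1}.\<close>

lemma second_diff_le_Lipschitz:
  fixes f f' :: "real \<Rightarrow> real"
  assumes t: "0 < t"
    and d: "\<And>y. y \<in> {z - t..z + t} \<Longrightarrow> (f has_real_derivative f' y) (at y)"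
    and lip: "\<And>x y. x \<in> {z - t..z + t} \<Longrightarrow> y \<in> {z - t..z + t} \<Longrightarrow> \<bar>f' x - f' y\<bar> \<le> M * \<bar>x - y\<bar>"
  shows "\<bar>second_diff f z t\<bar> \<le> 2 * M * t\<^sup>2"
proof -
  have "((\<lambda>\<tau>. f (z + \<tau>) + f (z - \<tau>)) has_real_derivative f' (z + \<tau>) - f' (z - \<tau>)) (at \<tau>)"
    if "0 \<le> \<tau>" "\<tau> \<le> t" for \<tau>
  proof -
    have "((\<lambda>\<tau>. f (z + \<tau>)) has_real_derivative f' (z + \<tau>) * 1) (at \<tau>)"
      by (rule DERIV_chain2[OF d]) (use that in \<open>auto intro!: derivative_eq_intros\<close>)
    moreover have "((\<lambda>\<tau>. f (z - \<tau>)) has_real_derivative f' (z - \<tau>) * (-1)) (at \<tau>)"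
      by (rule DERIV_chain2[OF d]) (use that in \<open>auto intro!: derivative_eq_intros\<close>)
    ultimately show ?thesis by (auto dest: DERIV_add)
  qed
  from MVT2[OF t, of "\<lambda>\<tau>. f (z + \<tau>) + f (z - \<tau>)" "\<lambda>\<tau>. f' (z + \<tau>) - f' (z - \<tau>)", OF this]
  obtain \<xi> where \<xi>: "0 < \<xi>" "\<xi> < t" "f (z + t) + f (z - t) - (f z + f z) = t * (f' (z + \<xi>) - f' (z - \<xi>))"
    by auto
  have "\<bar>second_diff f z t\<bar> = \<bar>t * (f' (z + \<xi>) - f' (z - \<xi>))\<bar>"
    using \<xi>(3) unfolding second_diff_def by linarith
  also have "\<dots> \<le> t * (M * (2 * \<xi>))"
    using lip[of "z + \<xi>" "z - \<xi>"] \<xi> t by (simp add: abs_mult)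
  also have "\<dots> \<le> t * (M * (2 * t))"
  proof -
    have "0 \<le> M * \<bar>(z + t) - (z - t)\<bar>" using lip[of "z + t" "z - t"] t by (intro order_trans[OF abs_ge_zero]) auto
    then have "0 \<le> M" using t by (simp add: zero_le_mult_iff)
    then show ?thesis using \<xi> t by (intro mult_left_mono) auto
  qed
  finally show ?thesis by (simp add: power2_eq_square mult_ac)
qed

lemma abs_diff_le_deriv_bound:
  fixes f f' :: "real \<Rightarrow> real"
  assumes "\<And>y. y \<in> {a..b} \<Longrightarrow> (f has_real_derivative f' y) (at y)"
    and "\<And>y. y \<in> {a..b} \<Longrightarrow> \<bar>f' y\<bar> \<le> M" "x \<in> {a..b}" "y \<in> {a..b}"
  shows "\<bar>f x - f y\<bar> \<le> M * \<bar>x - y\<bar>"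
  using field_differentiable_bound[of "{a..b}" f f' M x y] assms
  by (auto intro: DERIV_subset simp: has_field_derivative_at_within)

lemma second_diff_le_deriv2:
  fixes f f' f'' :: "real \<Rightarrow> real"
  assumes "0 < t"
    and "\<And>y. y \<in> {z - t..z + t} \<Longrightarrow> (f has_real_derivative f' y) (at y)"
    and "\<And>y. y \<in> {z - t..z + t} \<Longrightarrow> (f' has_real_derivative f'' y) (at y)"
    and "\<And>y. y \<in> {z - t..z + t} \<Longrightarrow> \<bar>f'' y\<bar> \<le> M"
  shows "\<bar>second_diff f z t\<bar> \<le> 2 * M * t\<^sup>2"
  using assms abs_diff_le_deriv_bound[of "z - t" "z + t" f' f'' M]
  by (intro second_diff_le_Lipschitz[where f'=f']) auto

text \<open>Outside the interval \<open>z\<^sup>2 < c\<close> this is zero even for \<open>q < 0\<close>, since \<open>0 powr q = 0\<close>.\<close>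

definition pow_weight :: "real \<Rightarrow> real \<Rightarrow> nat \<Rightarrow> real \<Rightarrow> real" where
  "pow_weight c q m z = (max 0 (c - z\<^sup>2)) powr q * z ^ m"

lemma pow_weight_measurable [measurable]: "pow_weight c q m \<in> borel_measurable borel"
  unfolding pow_weight_def by measurable

lemma pow_weight_Suc: "pow_weight c q (Suc m) = (\<lambda>z. z * pow_weight c q m z)"
  by (simp add: pow_weight_def fun_eq_iff)

lemma pow_weight_add_1:
  "pow_weight c (q + 1) m z = c * pow_weight c q m z - pow_weight c q (Suc (Suc m)) z"
proof (cases "z\<^sup>2 < c")
  case True
  then have "max 0 (c - z\<^sup>2) = c - z\<^sup>2" "(c - z\<^sup>2) powr (q + 1) = (c - z\<^sup>2) powr q * (c - z\<^sup>2)"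
    using powr_add[of "c - z\<^sup>2" q 1] by auto
  moreover have "P * (c - z\<^sup>2) * z ^ m = c * (P * z ^ m) - P * z ^ Suc (Suc m)" for P
    by (simp add: power2_eq_square algebra_simps)
  ultimately show ?thesis unfolding pow_weight_def by simp
qed (simp add: pow_weight_def max_def)

lemma pow_weight_deriv:
  assumes "z\<^sup>2 < c"
  shows "(pow_weight c q m has_real_derivative
    real m * pow_weight c q (m - 1) z - 2 * q * pow_weight c (q - 1) (m + 1) z) (at z)"
proof -
  have op: "open {z::real. z\<^sup>2 < c}" by (intro open_Collect_less continuous_intros)
  have "((\<lambda>z. (c - z\<^sup>2) powr q * z ^ m) has_real_derivative
     (c - z\<^sup>2) powr q * (real m * z ^ (m - 1)) + q * (c - z\<^sup>2) powr (q - 1) * (- (2 * z)) * z ^ m) (at z)"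
    using assms by (auto intro!: derivative_eq_intros simp: power2_eq_square)
  then have "((\<lambda>z. (c - z\<^sup>2) powr q * z ^ m) has_real_derivative
     real m * pow_weight c q (m - 1) z - 2 * q * pow_weight c (q - 1) (m + 1) z) (at z)"
    by (rule DERIV_cong) (use assms in \<open>simp add: pow_weight_def algebra_simps\<close>)
  then show ?thesis
    by (rule has_field_derivative_transform_within_open[OF _ op])
      (use assms in \<open>auto simp: pow_weight_def max_def\<close>)
qed

text \<open>The exponent -3 is the worst one met later: two derivatives of a weight with q \<ge> -1
  lead down to q - 2 \<ge> -3. As c \<le> 1, the base is at most 1 and the lowest exponent
  dominates.\<close>

lemma pow_weight_bound:
  assumes "0 < \<eta>" "\<eta> \<le> c - z\<^sup>2" "c \<le> 1" "-3 \<le> q"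
  shows "\<bar>pow_weight c q m z\<bar> \<le> \<eta> powr (-3)"
proof -
  have "\<eta> \<le> 1" "z\<^sup>2 \<le> 1" using assms zero_le_power2[of z] by linarith+
  then have "\<bar>z\<bar> ^ m \<le> 1" by (simp add: abs_square_le_1 power_le_one)
  have "(c - z\<^sup>2) powr q \<le> (c - z\<^sup>2) powr (-3)"
    using assms zero_le_power2[of z] by (intro powr_mono') linarith+
  also have "\<dots> \<le> \<eta> powr (-3)"
    using assms by (intro powr_mono2') auto
  finally have "(c - z\<^sup>2) powr q * \<bar>z\<bar> ^ m \<le> \<eta> powr (-3) * 1"
    using \<open>\<bar>z\<bar> ^ m \<le> 1\<close> by (intro mult_mono) auto
  then show ?thesis using assms by (simp add: pow_weight_def abs_mult power_abs)
qed

text \<open>A concave function is smallest at an end of the interval, so the gap to the boundary is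
  checked only at z - t and z + t.\<close>

lemma concave_gap_between:
  fixes c z t y :: real
  assumes "\<eta> \<le> c - (z - t)\<^sup>2" "\<eta> \<le> c - (z + t)\<^sup>2" "y \<in> {z - t..z + t}"
  shows "\<eta> \<le> c - y\<^sup>2"
proof -
  have "y\<^sup>2 \<le> (z - t)\<^sup>2 \<or> y\<^sup>2 \<le> (z + t)\<^sup>2"
    using assms(3) unfolding abs_le_square_iff[symmetric] by auto
  then show ?thesis using assms by linarith
qed

lemma abs_diff_le_add: "\<bar>a\<bar> \<le> A \<Longrightarrow> \<bar>b\<bar> \<le> B \<Longrightarrow> \<bar>a - b\<bar> \<le> A + B" for a b A B :: real
  by linarith

lemma pow_weight_second_diff_bound:
  assumes \<eta>: "0 < \<eta>" and t: "0 < t" and c: "c \<le> 1" and q: "-1 \<le> q" "q \<le> 1"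
    and gap: "\<eta> \<le> c - (z - t)\<^sup>2" "\<eta> \<le> c - (z + t)\<^sup>2"
  shows "\<bar>second_diff (pow_weight c q m) z t\<bar> \<le> 2 * ((real m + 6)\<^sup>2 * \<eta> powr (-3)) * t\<^sup>2" (is ?A)
    and "\<bar>pow_weight c q m (z - t) - pow_weight c q m (z + t)\<bar> \<le> 2 * ((real m + 6)\<^sup>2 * \<eta> powr (-3)) * t" (is ?B)
proof -
  let ?w = "pow_weight c"
  let ?E = "\<eta> powr (-3)"
  define f' where "f' y = real m * ?w q (m - 1) y - 2 * q * ?w (q - 1) (m + 1) y" for y
  define f'' where "f'' y = real m * (real (m - 1) * ?w q (m - 1 - 1) y - 2 * q * ?w (q - 1) (m - 1 + 1) y)
      - 2 * q * (real (m + 1) * ?w (q - 1) m y - 2 * (q - 1) * ?w (q - 1 - 1) (m + 1 + 1) y)" for y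
  have in_gap: "\<eta> \<le> c - y\<^sup>2" if "y \<in> {z - t..z + t}" for y
    using concave_gap_between[OF gap that] .
  have d1: "(?w q m has_real_derivative f' y) (at y)" if "y \<in> {z - t..z + t}" for y
    unfolding f'_def using in_gap[OF that] \<eta> by (intro pow_weight_deriv) linarith
  have d2: "(f' has_real_derivative f'' y) (at y)" if "y \<in> {z - t..z + t}" for y
  proof -
    have "y\<^sup>2 < c" using in_gap[OF that] \<eta> by linarith
    moreover from this have "(?w (q - 1) (m + 1) has_real_derivative
        real (m + 1) * ?w (q - 1) m y - 2 * (q - 1) * ?w (q - 1 - 1) (m + 1 + 1) y) (at y)"
      using pow_weight_deriv[of y c "q - 1" "m + 1"] by simp
    ultimately show ?thesis unfolding f'_def f''_def
      by (intro DERIV_diff DERIV_cmult pow_weight_deriv)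
  qed
  have w: "\<bar>?w p k y\<bar> \<le> ?E" if "y \<in> {z - t..z + t}" "-3 \<le> p" for p k y
    using in_gap[OF that(1)] \<eta> c that(2) by (intro pow_weight_bound) auto
  have E: "0 \<le> ?E" by simp
  have prod: "\<bar>a * b\<bar> \<le> A * B" if "\<bar>a\<bar> \<le> A" "\<bar>b\<bar> \<le> B" for a b A B :: real
    using that unfolding abs_mult by (intro mult_mono) auto
  have q2: "\<bar>2 * q\<bar> \<le> 2" "\<bar>2 * (q - 1)\<bar> \<le> 4" using q by auto
  have b1: "\<bar>f' y\<bar> \<le> (real m + 6)\<^sup>2 * ?E" if y: "y \<in> {z - t..z + t}" for y
  proof -
    have "\<bar>f' y\<bar> \<le> real m * ?E + 2 * ?E"
      unfolding f'_def by (intro abs_diff_le_add prod w y q2) (use q in simp_all)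
    also have "\<dots> = (real m + 2) * ?E" by (simp only: distrib_right)
    also have "\<dots> \<le> (real m + 6)\<^sup>2 * ?E"
      by (intro mult_right_mono) (auto simp: power2_eq_square algebra_simps)
    finally show ?thesis .
  qed
  have b2: "\<bar>f'' y\<bar> \<le> (real m + 6)\<^sup>2 * ?E" if y: "y \<in> {z - t..z + t}" for y
  proof -
    have "\<bar>f'' y\<bar> \<le> real m * (real m * ?E + 2 * ?E) + 2 * ((real m + 1) * ?E + 4 * ?E)"
      unfolding f''_def by (intro abs_diff_le_add prod w y q2) (use q in simp_all)
    also have "\<dots> = (real m * (real m + 2) + 2 * (real m + 5)) * ?E" by (simp add: algebra_simps)
    also have "\<dots> \<le> (real m + 6)\<^sup>2 * ?E"
      by (intro mult_right_mono) (auto simp: power2_eq_square algebra_simps)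
    finally show ?thesis .
  qed
  show ?A by (rule second_diff_le_deriv2[OF t d1 d2 b2])
  have "\<bar>(z - t) - (z + t)\<bar> = 2 * t" using t by simp
  moreover have "\<bar>?w q m (z - t) - ?w q m (z + t)\<bar> \<le> (real m + 6)\<^sup>2 * ?E * \<bar>(z - t) - (z + t)\<bar>"
    using t by (intro abs_diff_le_deriv_bound[OF d1 b1]) auto
  ultimately show ?B by (simp only: mult_ac)
qed

context fractional_order
begin

lemma integrable_pow_weight:
  assumes c: "0 < c" "c \<le> 1" and q: "-1 < q" "q \<le> 1"
  shows "integrable lborel (pow_weight c q m)"
proof -
  define r where "r = sqrt c"
  have r: "0 < r" "r\<^sup>2 = c" "r \<le> 1" using c by (auto simp: r_def)
  define h where "h t = indicator {0<..<2 * r} t * t powr q" for t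
  have h: "integrable lborel h" unfolding h_def using q r by (intro integrable_powr_near_0) auto
  show ?thesis
  proof (rule integrable_lborel_bound)
    show "integrable lborel (\<lambda>z. indicator {-1..1} z * 1 + r powr q * (h (r - z) + h (z + r)))"
      using integrable_lborel_reflect(1)[OF h] integrable_lborel_translate(1)[OF h]
      by (intro Bochner_Integration.integrable_add integrable_mult_right integrable_mult_left integrable_real_indicator) auto
    fix z
    show "\<bar>pow_weight c q m z\<bar> \<le> indicator {-1..1} z * 1 + r powr q * (h (r - z) + h (z + r))"
    proof (cases "z\<^sup>2 < c")
      case False
      then show ?thesis by (simp add: pow_weight_def max_def h_def)
    next
      case True
      then have zr: "-r < z" "z < r" using r abs_le_square_iff[of r z] by (auto simp: not_le[symmetric])
      then have z1: "\<bar>z\<bar> \<le> 1" using r by auto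
      then have "\<bar>z\<bar> ^ m \<le> 1" by (simp add: power_le_one)
      then have "\<bar>pow_weight c q m z\<bar> \<le> (c - z\<^sup>2) powr q"
        using True mult_left_mono[of "\<bar>z\<bar> ^ m" 1 "(c - z\<^sup>2) powr q"] by (simp add: pow_weight_def abs_mult power_abs)
      \<comment> \<open>After factoring, one of the two factors is always at least r, so for q < 0
        the weight is singular at one end at a time, like a power above -1 of the distance to that
        end.\<close>
      also have "c - z\<^sup>2 = (r - z) * (z + r)" using r(2) by (simp add: power2_eq_square algebra_simps)
      also have "((r - z) * (z + r)) powr q \<le> 1 + r powr q * (h (r - z) + h (z + r))"
      proof (cases "0 \<le> q")
        case True
        have "(r - z) * (z + r) \<le> 1" "0 \<le> (r - z) * (z + r)"
          using \<open>c - z\<^sup>2 = _\<close> c zr by (smt (verit) zero_le_power2, simp)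
        then have "((r - z) * (z + r)) powr q \<le> 1" using True by (intro powr_le1) auto
        moreover have "0 \<le> r powr q * (h (r - z) + h (z + r))" by (simp add: h_def)
        ultimately show ?thesis by linarith
      next
        case False
        have hh: "h (r - z) = (r - z) powr q" "h (z + r) = (z + r) powr q" using zr by (auto simp: h_def)
        have eq: "((r - z) * (z + r)) powr q = (r - z) powr q * (z + r) powr q"
          using zr by (intro powr_mult)
        show ?thesis
        proof (cases "0 \<le> z")
          case True
          then have "(z + r) powr q \<le> r powr q" using False r by (intro powr_mono2') auto
          then have "(r - z) powr q * (z + r) powr q \<le> r powr q * (r - z) powr q"
            using mult_right_mono[of "(z + r) powr q" "r powr q" "(r - z) powr q"] by (simp add: mult.commute)
          moreover have "0 \<le> r powr q * (z + r) powr q" by simp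
          ultimately show ?thesis unfolding eq hh unfolding distrib_left by linarith
        next
          case z: False
          then have "(r - z) powr q \<le> r powr q" using False r by (intro powr_mono2') auto
          then have "(r - z) powr q * (z + r) powr q \<le> r powr q * (z + r) powr q"
            using mult_right_mono[of "(r - z) powr q" "r powr q" "(z + r) powr q"] by simp
          moreover have "0 \<le> r powr q * (r - z) powr q" by simp
          ultimately show ?thesis unfolding eq hh unfolding distrib_left by linarith
        qed
      qed
      finally show ?thesis using z1 by (simp add: indicator_def abs_le_iff)
    qed
  qed measurable
qed

lemma tame_on_pow_weight:
  assumes c: "c \<le> 1" and a: "0 \<le> a" "a\<^sup>2 < c" and q: "-1 < q" "q \<le> 1"
  shows "tame_on (-a) a (pow_weight c q m)"
proof -
  define \<delta> where "\<delta> = (sqrt c - a) / 2"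
  have ac: "a < sqrt c" using a real_less_rsqrt by blast
  have \<delta>: "0 < \<delta>" "a + \<delta> < sqrt c" using ac unfolding \<delta>_def by (simp_all add: field_simps)
  define \<eta> where "\<eta> = c - (a + \<delta>)\<^sup>2"
  have "c \<ge> 0" using a by (smt (verit) zero_le_power2)
  have "(a + \<delta>)\<^sup>2 < (sqrt c)\<^sup>2" using \<delta> a by (intro power_strict_mono) auto
  then have \<eta>: "0 < \<eta>" using \<open>c \<ge> 0\<close> by (simp add: \<eta>_def)
  define C where "C = 2 * ((real m + 6)\<^sup>2 * \<eta> powr (-3))"
  have gap: "\<eta> \<le> c - y\<^sup>2" if "\<bar>y\<bar> \<le> a + \<delta>" for y
    using that power_mono[of "\<bar>y\<bar>" "a + \<delta>" 2] by (simp add: \<eta>_def)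
  have "\<bar>pow_weight c q m z\<bar> \<le> C" if "z \<in> {-a..a}" for z
  proof -
    have "\<bar>pow_weight c q m z\<bar> \<le> \<eta> powr (-3)"
      using that \<delta> \<eta> c q by (intro pow_weight_bound gap) auto
    also have "\<dots> \<le> C" unfolding C_def
      using mult_right_mono[of 1 "2 * (real m + 6)\<^sup>2" "\<eta> powr (-3)"] by (simp add: power2_eq_square algebra_simps)
    finally show ?thesis .
  qed
  moreover have "\<bar>second_diff (pow_weight c q m) z t\<bar> \<le> C * t\<^sup>2"
    "\<bar>pow_weight c q m (z - t) - pow_weight c q m (z + t)\<bar> \<le> C * t" if "z \<in> {-a..a}" "0 < t" "t < \<delta>" for z t
    unfolding C_def using that \<eta> c q by (intro pow_weight_second_diff_bound gap; auto)+
  moreover have "integrable lborel (pow_weight c q m)"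
    using a c q by (intro integrable_pow_weight) (auto intro: le_less_trans[OF zero_le_power2])
  ultimately show ?thesis unfolding tame_on_def using \<delta> by blast
qed

text \<open>Integration by parts: the derivative of (c - z^2)^s is -2s z (c - z^2)^(s-1), so each
  second difference is an integral of that derivative, and Hardy's identity converts the kernel
  t^(-1-2s) into t^(-2s) / (2s). The factors 2s cancel.\<close>

lemma frac_int_pow_weight_eq_grad:
  assumes c: "0 < c" "c \<le> 1" and x: "\<bar>x\<bar> \<le> a" "a\<^sup>2 < c"
  shows "frac_int (pow_weight c s 0) x = - frac_grad (pow_weight c (s - 1) 1) x"
proof -
  define f where "f = pow_weight c s 0"
  define e where "e = pow_weight c (s - 1) 1"
  have e_int: "integrable lborel e" unfolding e_def using s_pos s_less_1 c by (intro integrable_pow_weight) auto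
  have e_meas[measurable]: "e \<in> borel_measurable borel" unfolding e_def by measurable
  define \<Phi> where "\<Phi> = (\<lambda>x. \<integral>y. indicator {..x} y * e y \<partial>lborel)"
  note tr = integral_interval_translate[OF e_int]
  define r where "r = sqrt c"
  have r: "0 < r" "r\<^sup>2 = c" using c by (auto simp: r_def)
  \<comment> \<open>The derivative is unbounded at the two end points but integrable. The
    fundamental theorem tolerates this finite set, since f is continuous; outside the interval both
    f and e vanish.\<close>
  have FTC: "f v - f u = - 2 * s * (\<Phi> v - \<Phi> u)" if "u \<le> v" for u v
  proof -
    have cont: "continuous_on {u..v} f"
      unfolding f_def pow_weight_def using s_pos by (intro continuous_intros continuous_on_powr') auto
    have deriv: "(f has_vector_derivative (- 2 * s * e y)) (at y)" if "y \<notin> {-r, r}" for y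
    proof (cases "y\<^sup>2 < c")
      case True
      then show ?thesis using pow_weight_deriv[of y c s 0]
        by (simp add: has_real_derivative_iff_has_vector_derivative f_def e_def)
    next
      case False
      have "y\<^sup>2 \<noteq> c" using that r(2) by (metis insertCI power2_eq_iff)
      then have "c < y\<^sup>2" using False by simp
      have op: "open {y::real. c < y\<^sup>2}" by (intro open_Collect_less continuous_intros)
      have "((\<lambda>_. 0) has_vector_derivative (- 2 * s * e y)) (at y)"
        using \<open>c < y\<^sup>2\<close> by (simp add: e_def pow_weight_def)
      then show ?thesis
        by (rule has_vector_derivative_transform_within_open[OF _ op])
          (use \<open>c < y\<^sup>2\<close> in \<open>auto simp: f_def pow_weight_def\<close>)
    qed
    have I1: "((\<lambda>y. - 2 * s * e y) has_integral (f v - f u)) {u..v}"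
      using deriv by (intro fundamental_theorem_of_calculus_interior_strong[of "{-r, r}"] that cont) auto
    have I2: "set_integrable lborel {u..v} (\<lambda>y. - 2 * s * e y)"
      unfolding set_integrable_def using e_int
      by (intro integrable_mult_indicator) auto
    have "f v - f u = integral {u..v} (\<lambda>y. - 2 * s * e y)"
      using I1 by (rule integral_unique[symmetric])
    also have "\<dots> = (LINT y:{u..v}|lborel. - 2 * s * e y)"
      using I2 by (rule set_borel_integral_eq_integral(2)[symmetric])
    also have "\<dots> = - 2 * s * (\<integral>y. indicator {u..v} y * e y \<partial>lborel)"
    proof -
      have "(LINT y:{u..v}|lborel. - 2 * s * e y) = (\<integral>y. (- 2 * s) * (indicator {u..v} y * e y) \<partial>lborel)"
        unfolding set_lebesgue_integral_def by (intro Bochner_Integration.integral_cong) auto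
      then show ?thesis unfolding integral_mult_right_zero .
    qed
    also have "(\<integral>y. indicator {u..v} y * e y \<partial>lborel) = (\<integral>y. indicator {u<..v} y * e (y + 0) \<partial>lborel)"
    proof (rule integral_cong_AE)
      show "AE y in lborel. indicator {u..v} y * e y = indicator {u<..v} y * e (y + 0)"
        using AE_lborel_singleton[of u] by eventually_elim (auto simp: indicator_def)
    qed measurable
    also have "\<dots> = \<Phi> v - \<Phi> u" using tr(1)[OF that, of 0] by (simp add: \<Phi>_def)
    finally show ?thesis .
  qed
  define K where "K \<tau> = - 2 * s * (e (x - \<tau>) - e (x + \<tau>))" for \<tau>
  have [measurable]: "K \<in> borel_measurable borel" unfolding K_def by measurable
  have a: "0 \<le> a" using x by linarith
  have tame: "tame_on (-a) a e"
    unfolding e_def using s_pos s_less_1 c x a by (intro tame_on_pow_weight) auto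
  have xa: "x \<in> {-a..a}" using x by auto
  have K_int: "integrable lborel (\<lambda>\<tau>. indicator {0<..} \<tau> * \<tau> powr (-2 * s) * K \<tau>)"
    and K_val: "(\<integral>\<tau>. indicator {0<..} \<tau> * \<tau> powr (-2 * s) * K \<tau> \<partial>lborel) = - 2 * s * frac_grad e x"
  proof -
    have eq: "indicator {0<..} \<tau> * \<tau> powr (-2 * s) * K \<tau>
        = (- 2 * s) * (indicator {0<..} \<tau> * \<tau> powr (-2 * s) * (e (x - \<tau>) - e (x + \<tau>)))" for \<tau>
      by (simp add: K_def)
    show "integrable lborel (\<lambda>\<tau>. indicator {0<..} \<tau> * \<tau> powr (-2 * s) * K \<tau>)"
      unfolding eq using tame_on_integrable(2)[OF tame xa] by (rule integrable_mult_right)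
    show "(\<integral>\<tau>. indicator {0<..} \<tau> * \<tau> powr (-2 * s) * K \<tau> \<partial>lborel) = - 2 * s * frac_grad e x"
      unfolding eq integral_mult_right_zero frac_grad_def ..
  qed
  have inner: "second_diff f x t = (\<integral>\<tau>. indicator {0<..t} \<tau> * K \<tau> \<partial>lborel)" if "0 < t" for t
  proof -
    have "second_diff f x t = (f x - f (x - t)) - (f (x + t) - f x)" by (simp add: second_diff_def)
    also have "\<dots> = - 2 * s * ((\<Phi> x - \<Phi> (x - t)) - (\<Phi> (x + t) - \<Phi> x))"
      using FTC[of "x - t" x] FTC[of x "x + t"] that by (simp add: algebra_simps)
    also have "\<dots> = (\<integral>\<tau>. - 2 * s * (indicator {0<..t} \<tau> * e (x - \<tau>) - indicator {0<..t} \<tau> * e (\<tau> + x)) \<partial>lborel)"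
      unfolding integral_mult_right_zero using tr[of 0 t] that by (simp add: \<Phi>_def add.commute[of t])
    also have "\<dots> = (\<integral>\<tau>. indicator {0<..t} \<tau> * K \<tau> \<partial>lborel)"
      by (intro Bochner_Integration.integral_cong) (simp_all add: K_def algebra_simps)
    finally show ?thesis .
  qed
  have "frac_int f x = (\<integral>t. kern t * (\<integral>\<tau>. indicator {0<..t} \<tau> * K \<tau> \<partial>lborel) \<partial>lborel)"
    unfolding frac_int_def
  proof (rule Bochner_Integration.integral_cong[OF refl])
    fix t show "kern t * second_diff f x t = kern t * (\<integral>\<tau>. indicator {0<..t} \<tau> * K \<tau> \<partial>lborel)"
      using inner[of t] by (cases "0 < t") (auto simp: kern_zero)
  qed
  also have "\<dots> = - frac_grad e x"
    using hardy_averaging[OF _ K_int] K_val s_pos by simp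
  finally show ?thesis by (simp add: f_def e_def)
qed

text \<open>Pointwise form of \<open>frac_grad_diff\<close>. Continuity of \<open>frac_int f\<close>
  must be supplied separately, as the integrated identity determines that function only up to null
  sets.\<close>

lemma frac_grad_has_derivative:
  assumes tame: "tame_on (-a) a f" and cont: "continuous_on {-a..a} (frac_int f)" and x: "-a < x" "x < a"
  shows "(frac_grad f has_real_derivative 2 * s * frac_int f x) (at x)"
proof -
  have tame': "tame_on (-a) y f" if "y \<le> a" for y
    using tame that unfolding tame_on_def by fastforce
  have eq: "frac_grad f y = frac_grad f (-a) + 2 * s * integral {-a..y} (frac_int f)" if "y \<in> {-a..a}" for y
  proof -
    have "set_integrable lborel {-a..y} (frac_int f)"
      by (rule borel_integrable_atLeastAtMost') (use that cont in \<open>auto intro: continuous_on_subset\<close>)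
    then have "integral {-a..y} (frac_int f) = (\<integral>z. indicator {-a..y} z * frac_int f z \<partial>lborel)"
      by (simp add: set_borel_integral_eq_integral(2)[symmetric] set_lebesgue_integral_def)
    also have "\<dots> = (\<integral>z. indicator {-a<..y} z * frac_int f z \<partial>lborel)"
    proof (rule integral_cong_AE)
      show "AE z in lborel. indicator {-a..y} z * frac_int f z = indicator {-a<..y} z * frac_int f z"
        using AE_lborel_singleton[of "-a"] by eventually_elim (auto simp: indicator_def)
      show "(\<lambda>z. indicator {-a<..y} z * frac_int f z) \<in> borel_measurable lborel"
        using frac_grad_diff(1)[OF tame'[of y]] that by auto
      show "(\<lambda>z. indicator {-a..y} z * frac_int f z) \<in> borel_measurable lborel"
        using \<open>set_integrable lborel {-a..y} (frac_int f)\<close> unfolding set_integrable_def by auto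
    qed
    finally show ?thesis using frac_grad_diff(2)[OF tame'[of y]] that by simp
  qed
  have "((\<lambda>y. frac_grad f (-a) + 2 * s * integral {-a..y} (frac_int f)) has_real_derivative 2 * s * frac_int f x)
     (at x within {-a..a})"
    using x by (auto intro!: derivative_eq_intros integral_has_real_derivative[OF cont])
  then have "(frac_grad f has_real_derivative 2 * s * frac_int f x) (at x within {-a..a})"
    by (rule has_field_derivative_transform_within[where d=1]) (use x in \<open>auto intro: eq[symmetric]\<close>)
  then show ?thesis using x by (simp add: at_within_Icc_at)
qed

text \<open>The two relations between the operator and its companion close up into a linear
  first-order differential equation for j = \<open>frac_grad\<close> of (c - z^2)^(s-1). Since j
  vanishes at 0 by symmetry, it vanishes throughout, and the operator's value with it.\<close>

lemma frac_pow_weight_harmonic: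
  assumes c: "0 < c" "c \<le> 1" and x: "x\<^sup>2 < c"
  shows "frac_int (pow_weight c (s - 1) 0) x = 0" "frac_grad (pow_weight c (s - 1) 0) x = 0"
proof -
  define e where "e = pow_weight c (s - 1)"
  define E where "E = frac_int (e 0)"
  define j where "j = frac_grad (e 0)"
  have tame: "tame_on (-a) a (e m)" if "0 \<le> a" "a\<^sup>2 < c" for a m
    unfolding e_def using that c s_pos s_less_1 by (intro tame_on_pow_weight) auto
  have e_Suc: "e (Suc m) = (\<lambda>z. z * e m z)" for m by (simp add: e_def pow_weight_Suc)
  \<comment> \<open>The image of (c - z^2)^s is computed twice. Written as c e_0 - e_2 and commuted
    once, it is c E - z I(e_1) - J(e_1), with I for \<open>frac_int\<close> and J for
    \<open>frac_grad\<close>; by parts it is -J(e_1). Hence c E = z I(e_1), and I(e_1) = z E +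
    j.\<close>
  have rel: "(c - z\<^sup>2) * E z = z * j z" if z: "z\<^sup>2 < c" for z
  proof -
    have a: "0 \<le> \<bar>z\<bar>" "\<bar>z\<bar>\<^sup>2 < c" "z \<in> {-\<bar>z\<bar>..\<bar>z\<bar>}" using z by auto
    note t = tame[OF a(1,2)]
    have e1: "frac_int (e 1) z = z * E z + j z"
      using frac_int_times_id[OF t a(3), of 0] by (simp add: e_Suc E_def j_def)
    have e2: "frac_int (e 2) z = z * frac_int (e 1) z + frac_grad (e 1) z"
      using frac_int_times_id[OF t a(3), of 1] by (simp add: e_Suc numeral_2_eq_2)
    have "frac_int (pow_weight c s 0) z = (\<integral>t. c * (kern t * second_diff (e 0) z t) - kern t * second_diff (e 2) z t \<partial>lborel)"
    proof -
      have "pow_weight c s 0 = (\<lambda>y. c * e 0 y - e 2 y)"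
        using pow_weight_add_1[of c "s - 1" 0] by (simp add: e_def numeral_2_eq_2 fun_eq_iff)
      then show ?thesis
        unfolding frac_int_def second_diff_def by (intro Bochner_Integration.integral_cong) (simp_all add: algebra_simps)
    qed
    also have "\<dots> = c * E z - frac_int (e 2) z"
      using tame_on_integrable(1)[OF t a(3)] by (simp add: E_def frac_int_def)
    finally have "c * E z - frac_int (e 2) z = - frac_grad (e 1) z"
      using frac_int_pow_weight_eq_grad[OF c, of z "\<bar>z\<bar>"] z by (simp add: e_def)
    then show ?thesis using e1 e2 by (simp add: algebra_simps power2_eq_square)
  qed
  have j0: "j 0 = 0" unfolding j_def frac_grad_def e_def by (simp add: pow_weight_def)
  define a where "a = (\<bar>x\<bar> + sqrt c) / 2"
  have "\<bar>x\<bar> < sqrt c" using x real_less_rsqrt[of "\<bar>x\<bar>" c] by simp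
  then have a: "\<bar>x\<bar> < a" "a < sqrt c" "0 < a" unfolding a_def by (simp_all add: field_simps)
  then have "a\<^sup>2 < (sqrt c)\<^sup>2" by (intro power_strict_mono) auto
  then have ac: "a\<^sup>2 < c" using c by simp
  have in_c: "z\<^sup>2 < c" if "z \<in> {-a..a}" for z
    using that ac abs_le_square_iff[of z a] by (auto simp: abs_le_iff)
  have t: "tame_on (-a) a (e 0)" using tame a ac by simp
  have E_eq: "E z = z * j z / (c - z\<^sup>2)" if "z \<in> {-a..a}" for z
    using rel[OF in_c[OF that]] in_c[OF that] by (simp add: field_simps)
  \<comment> \<open>Bootstrap: j is continuous as an indefinite integral of E, then
    \<open>rel\<close> makes E continuous, and only then is j known to be differentiable with
    derivative 2s E.\<close>
  have "continuous_on {-a..a} j"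
  proof -
    have tame': "tame_on (-a) y (e 0)" if "y \<le> a" for y
      using t that unfolding tame_on_def by fastforce
    have int: "set_integrable lborel {-a<..y} E" if "y \<in> {-a..a}" for y
      unfolding set_integrable_def E_def using frac_grad_diff(1)[OF tame'[of y]] that by auto
    have eq: "j y = j (-a) + 2 * s * integral {-a..y} E" if "y \<in> {-a..a}" for y
    proof -
      have "(\<integral>z. indicator {-a<..y} z * E z \<partial>lborel) = integral {-a<..y} E"
        using set_borel_integral_eq_integral(2)[OF int[OF that]] by (simp add: set_lebesgue_integral_def)
      also have "\<dots> = integral {-a..y} E"
        by (rule integral_spike_set) (auto intro: negligible_subset[of "{-a}"])
      finally show ?thesis using frac_grad_diff(2)[OF tame'[of y]] that by (simp add: j_def E_def)
    qed
    have "E integrable_on {-a<..a}" using set_borel_integral_eq_integral(1)[OF int[of a]] a by simp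
    then have "E integrable_on {-a..a}"
      by (rule integrable_spike_set) (auto intro: negligible_subset[of "{-a}"])
    then have "continuous_on {-a..a} (\<lambda>y. j (-a) + 2 * s * integral {-a..y} E)"
      by (intro continuous_intros indefinite_integral_continuous_1)
    then show ?thesis by (rule continuous_on_eq) (rule eq[symmetric])
  qed
  then have "continuous_on {-a..a} (\<lambda>z. z * j z / (c - z\<^sup>2))"
    using in_c by (intro continuous_intros) force+
  then have contE: "continuous_on {-a..a} E" by (rule continuous_on_eq) (rule E_eq[symmetric])
  \<comment> \<open>By \<open>rel\<close> the equation is j' = 2s z j / (c - z^2), with integrating
    factor (c - z^2)^s.\<close>
  have "((\<lambda>z. j z * (c - z\<^sup>2) powr s) has_real_derivative 0) (at z)" if "-a < z" "z < a" for z
  proof -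
    have z: "0 < c - z\<^sup>2" using in_c[of z] that by simp
    have dj: "(j has_real_derivative 2 * s * E z) (at z)"
      using frac_grad_has_derivative[OF t contE[unfolded E_def] that] by (simp add: j_def E_def)
    have pw: "(c - z\<^sup>2) powr s = (c - z\<^sup>2) powr (s - 1) * (c - z\<^sup>2)"
      using powr_add[of "c - z\<^sup>2" "s - 1" 1] z by simp
    have "((\<lambda>z. j z * (c - z\<^sup>2) powr s) has_real_derivative
       2 * s * E z * (c - z\<^sup>2) powr s + j z * (s * (c - z\<^sup>2) powr (s - 1) * (- (2 * z)))) (at z)"
      using z by (auto intro!: derivative_eq_intros dj)
    also have "2 * s * E z * (c - z\<^sup>2) powr s + j z * (s * (c - z\<^sup>2) powr (s - 1) * (- (2 * z)))
      = 2 * s * (c - z\<^sup>2) powr (s - 1) * ((c - z\<^sup>2) * E z - z * j z)"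
      by (simp only: pw) (simp add: algebra_simps)
    also have "\<dots> = 0" using rel[of z] z by simp
    finally show ?thesis .
  qed
  then have "j x * (c - x\<^sup>2) powr s = j 0 * (c - 0\<^sup>2) powr s"
    using a by (intro DERIV_isconst3[of "-a" a x 0]) auto
  then show j: "frac_grad (pow_weight c (s - 1) 0) x = 0" using x j0 by (simp add: j_def e_def)
  show "frac_int (pow_weight c (s - 1) 0) x = 0"
    using rel[OF x] x j by (simp add: j_def E_def e_def)
qed

end

section \<open>Polynomial solutions on the disc\<close>

text \<open>Polynomials are kept as functions generated by monomials, and n is an upper bound for
  the total degree, so closure properties become inductions over two rules.\<close>

inductive poly_deg :: "nat \<Rightarrow> (real \<Rightarrow> real \<Rightarrow> real) \<Rightarrow> bool" where
  monom: "i + j \<le> n \<Longrightarrow> poly_deg n (\<lambda>a b. c * a ^ i * b ^ j)"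
| add: "poly_deg n f \<Longrightarrow> poly_deg n g \<Longrightarrow> poly_deg n (\<lambda>a b. f a b + g a b)"

lemma poly_deg_mono: "poly_deg n f \<Longrightarrow> n \<le> m \<Longrightarrow> poly_deg m f"
  by (induction rule: poly_deg.induct) (auto intro: poly_deg.intros)

lemma poly_deg_const: "poly_deg n (\<lambda>a b. c)"
  using poly_deg.monom[of 0 0 n c] by simp

lemma poly_deg_cmult: "poly_deg n f \<Longrightarrow> poly_deg n (\<lambda>a b. k * f a b)"
proof (induction rule: poly_deg.induct)
  case (monom i j n c)
  then show ?case using poly_deg.monom[of i j n "k * c"] by (simp add: mult.assoc)
next
  case (add n f g)
  then show ?case using poly_deg.add[OF add.IH] by (simp add: distrib_left)
qed

lemma poly_deg_diff: "poly_deg n f \<Longrightarrow> poly_deg n g \<Longrightarrow> poly_deg n (\<lambda>a b. f a b - g a b)"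
  using poly_deg.add[of n f "\<lambda>a b. (-1) * g a b"] poly_deg_cmult[of n g "-1"] by simp

lemma poly_deg_mult_monom:
  assumes "poly_deg n f"
  shows "poly_deg (n + (k + l)) (\<lambda>a b. f a b * (c * a ^ k * b ^ l))"
  using assms
proof (induction rule: poly_deg.induct)
  case (monom i j n d)
  then have "poly_deg (n + (k + l)) (\<lambda>a b. (d * c) * a ^ (i + k) * b ^ (j + l))"
    by (intro poly_deg.monom) simp
  then show ?case by (simp add: power_add mult_ac)
next
  case (add n f g)
  then show ?case using poly_deg.add[OF add.IH] by (simp add: distrib_right)
qed

lemma poly_deg_mult:
  assumes f: "poly_deg n f" and "poly_deg m g"
  shows "poly_deg (n + m) (\<lambda>a b. f a b * g a b)"
  using assms(2)
proof (induction rule: poly_deg.induct)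
  case (monom i j m c)
  then show ?case using poly_deg_mono[OF poly_deg_mult_monom[OF f, of i j c]] by simp
next
  case (add m g h)
  then show ?case using poly_deg.add[OF add.IH] by (simp add: distrib_left)
qed

lemma poly_deg_swap: "poly_deg n f \<Longrightarrow> poly_deg n (\<lambda>a b. f b a)"
proof (induction rule: poly_deg.induct)
  case (monom i j n c)
  then show ?case using poly_deg.monom[of j i n c] by (simp add: mult_ac)
qed (rule poly_deg.add)

lemma poly_deg_circle_power: "poly_deg (2 * l) (\<lambda>a b. (1 - b\<^sup>2) ^ l)"
proof (induction l)
  case 0
  then show ?case using poly_deg_const[of 0 1] by simp
next
  case (Suc l)
  have "poly_deg 2 (\<lambda>a b. 1 - b\<^sup>2)"
    using poly_deg_diff[OF poly_deg_const[of 2 1] poly_deg.monom[of 0 2 2 1]] by simp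
  from poly_deg_mult[OF this Suc] show ?case by simp
qed

lemma poly_deg_antiderivative:
  "poly_deg n f \<Longrightarrow> \<exists>F. poly_deg (Suc n) F \<and> (\<forall>a b. ((\<lambda>a. F a b) has_real_derivative f a b) (at a))"
proof (induction rule: poly_deg.induct)
  case (monom i j n c)
  then have "poly_deg (Suc n) (\<lambda>a b. (c / real (Suc i)) * a ^ Suc i * b ^ j)"
    by (intro poly_deg.monom) simp
  moreover have "((\<lambda>a. (c / real (Suc i)) * a ^ Suc i * b ^ j) has_real_derivative c * a ^ i * b ^ j) (at a)" for a b
    by (rule derivative_eq_intros refl | simp del: power_Suc)+
  ultimately show ?case by (intro exI conjI allI) assumption
next
  case (add n f g)
  then obtain F G where "poly_deg (Suc n) F" "poly_deg (Suc n) G"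
    "\<forall>a b. ((\<lambda>a. F a b) has_real_derivative f a b) (at a)" "\<forall>a b. ((\<lambda>a. G a b) has_real_derivative g a b) (at a)"
    by blast
  then show ?case by (intro exI[of _ "\<lambda>a b. F a b + G a b"]) (auto intro: poly_deg.add DERIV_add)
qed

lemma poly_deg_continuous:
  assumes "poly_deg n f" "continuous_on S g" "continuous_on S h"
  shows "continuous_on S (\<lambda>x. f (g x) (h x))"
  using assms(1) by (induction rule: poly_deg.induct) (intro continuous_intros assms; assumption)+

lemma poly_deg_0: "poly_deg n f \<Longrightarrow> n = 0 \<Longrightarrow> \<exists>c. f = (\<lambda>a b. c)"
proof (induction rule: poly_deg.induct)
  case (monom i j n c)
  then show ?case by auto
qed blast

context fractional_order
begin

text \<open>The derivative 2s p determines the companion up to its value at the centre of the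
  interval.\<close>

lemma frac_grad_pow_weight:
  assumes c: "0 < c" "c \<le> 1" and p: "\<And>z. z\<^sup>2 < c \<Longrightarrow> frac_int (pow_weight c (s - 1) k) z = p z"
    and cont: "continuous_on UNIV p" and P: "\<And>z. (P has_real_derivative p z) (at z)" and x: "x\<^sup>2 < c"
  shows "frac_grad (pow_weight c (s - 1) k) x = frac_grad (pow_weight c (s - 1) k) 0 + 2 * s * (P x - P 0)"
proof -
  define e where "e = pow_weight c (s - 1) k"
  define a where "a = (\<bar>x\<bar> + sqrt c) / 2"
  have "\<bar>x\<bar> < sqrt c" using x real_less_rsqrt[of "\<bar>x\<bar>" c] by simp
  then have a: "\<bar>x\<bar> < a" "a < sqrt c" "0 < a" unfolding a_def by (simp_all add: field_simps)
  then have "a\<^sup>2 < (sqrt c)\<^sup>2" by (intro power_strict_mono) auto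
  then have ac: "a\<^sup>2 < c" using c by simp
  have in_c: "z\<^sup>2 < c" if "z \<in> {-a..a}" for z
    using that ac abs_le_square_iff[of z a] by (auto simp: abs_le_iff)
  have t: "tame_on (-a) a e"
    unfolding e_def using s_pos s_less_1 c a ac by (intro tame_on_pow_weight) auto
  have "continuous_on {-a..a} p" using cont by (rule continuous_on_subset) simp
  then have contE: "continuous_on {-a..a} (frac_int e)"
    by (rule continuous_on_eq) (use p in_c in \<open>auto simp: e_def\<close>)
  have "((\<lambda>z. frac_grad e z - 2 * s * P z) has_real_derivative 0) (at z)" if "-a < z" "z < a" for z
  proof -
    have "frac_int e z = p z" using p in_c[of z] that by (simp add: e_def)
    then show ?thesis
      using DERIV_diff[OF frac_grad_has_derivative[OF t contE that] DERIV_cmult[OF P, of "2 * s"]] by simp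
  qed
  then have "frac_grad e x - 2 * s * P x = frac_grad e 0 - 2 * s * P 0"
    using a by (intro DERIV_isconst3[of "-a" a x 0]) auto
  then show ?thesis by (simp add: e_def algebra_simps)
qed

text \<open>For even k the weight is even and the symmetric difference at 0 vanishes. For odd k the
  substitution t -> r t with r = sqrt c yields r to the power 1 - 2s + 2(s - 1) + k = k - 1, an even
  number. The value is thus a polynomial in c, and in b when c = 1 - b^2.\<close>

lemma frac_grad_pow_weight_0:
  assumes "0 < c"
  shows "frac_grad (pow_weight c (s - 1) k) 0
    = (if odd k then frac_grad (pow_weight 1 (s - 1) k) 0 * c ^ (k div 2) else 0)"
proof (cases "odd k")
  case False
  then show ?thesis by (simp add: frac_grad_def pow_weight_def)
next
  case True
  then obtain l where k: "k = 2 * l + 1" by (auto elim: oddE)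
  define r where "r = sqrt c"
  have r: "0 < r" "r\<^sup>2 = c" using assms by (auto simp: r_def)
  have w: "pow_weight c (s - 1) k (r * t) = c powr (s - 1) * r ^ k * pow_weight 1 (s - 1) k t" for t
  proof -
    have "max 0 (c - (r * t)\<^sup>2) = c * max 0 (1 - t\<^sup>2)"
      using assms r by (simp add: max_def power_mult_distrib algebra_simps mult_le_cancel_left)
    then show ?thesis using assms by (simp add: pow_weight_def powr_mult power_mult_distrib)
  qed
  have const: "r * (r powr (-2 * s) * (c powr (s - 1) * r ^ k)) = c ^ l"
  proof -
    have "c powr (s - 1) = r powr (2 * (s - 1))"
      using r(1) unfolding r(2)[symmetric] by (simp add: powr_powr flip: powr_numeral)
    moreover have "r = r powr 1" "r ^ k = r powr real k" using r(1) by (simp_all add: powr_realpow)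
    ultimately have "r * (r powr (-2 * s) * (c powr (s - 1) * r ^ k)) = r powr (1 + (-2 * s + (2 * (s - 1) + real k)))"
      by (metis powr_add)
    also have "1 + (-2 * s + (2 * (s - 1) + real k)) = real (2 * l)" by (simp add: k)
    also have "r powr real (2 * l) = r ^ (2 * l)" using r(1) by (rule powr_realpow)
    also have "\<dots> = c ^ l" by (simp only: power_mult r(2))
    finally show ?thesis .
  qed
  have "frac_grad (pow_weight c (s - 1) k) 0
    = \<bar>r\<bar> *\<^sub>R (\<integral>t. indicator {0<..} (0 + r * t) * (0 + r * t) powr (-2 * s) *
       (pow_weight c (s - 1) k (0 - (0 + r * t)) - pow_weight c (s - 1) k (0 + (0 + r * t))) \<partial>lborel)"
    unfolding frac_grad_def using r(1) by (intro lborel_integral_real_affine) simp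
  also have "\<dots> = r * (\<integral>t. (r powr (-2 * s) * (c powr (s - 1) * r ^ k)) *
      (indicator {0<..} t * t powr (-2 * s) * (pow_weight 1 (s - 1) k (0 - t) - pow_weight 1 (s - 1) k (0 + t))) \<partial>lborel)"
    using r(1) w[of t for t] w[of "- t" for t]
    by (simp add: powr_mult indicator_def zero_less_mult_iff right_diff_distrib mult_ac cong: if_cong)
  also have "\<dots> = c ^ l * frac_grad (pow_weight 1 (s - 1) k) 0"
    unfolding integral_mult_right_zero mult.assoc[symmetric, of r] frac_grad_def using const by (simp add: mult.assoc)
  finally show ?thesis using True k by (simp add: mult.commute)
qed

text \<open>Raising k by one multiplies the image by a and adds the companion, itself an
  antiderivative plus a value at 0. Natural subtraction makes k - 2 equal to 0 for k \<le> 1, where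
  the image actually vanishes; the extra clause records this, since integrating a nonzero constant
  at k = 1 would spoil the degree bound at k = 2.\<close>

lemma frac_int_pow_weight_polynomial:
  "\<exists>p. poly_deg (k - 2) p \<and> (k \<le> 1 \<longrightarrow> p = (\<lambda>a b. 0)) \<and>
    (\<forall>a b. a\<^sup>2 + b\<^sup>2 < 1 \<longrightarrow> frac_int (pow_weight (1 - b\<^sup>2) (s - 1) k) a = p a b)"
proof (induction k)
  case 0
  have "frac_int (pow_weight (1 - b\<^sup>2) (s - 1) 0) a = 0" if "a\<^sup>2 + b\<^sup>2 < 1" for a b
    using that zero_le_power2[of a] zero_le_power2[of b] by (intro frac_pow_weight_harmonic) linarith+
  then show ?case using poly_deg_const[of 0 0] by auto
next
  case (Suc k)
  then obtain p where p: "poly_deg (k - 2) p" "k \<le> 1 \<Longrightarrow> p = (\<lambda>a b. 0)"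
    "\<And>a b. a\<^sup>2 + b\<^sup>2 < 1 \<Longrightarrow> frac_int (pow_weight (1 - b\<^sup>2) (s - 1) k) a = p a b" by blast
  have step: "frac_int (pow_weight (1 - b\<^sup>2) (s - 1) (Suc k)) a
    = a * frac_int (pow_weight (1 - b\<^sup>2) (s - 1) k) a + frac_grad (pow_weight (1 - b\<^sup>2) (s - 1) k) a"
    if "a\<^sup>2 + b\<^sup>2 < 1" for a b
    unfolding pow_weight_Suc
  proof (rule frac_int_times_id)
    show "tame_on (-\<bar>a\<bar>) \<bar>a\<bar> (pow_weight (1 - b\<^sup>2) (s - 1) k)"
      using that s_pos s_less_1 by (intro tame_on_pow_weight) auto
  qed auto
  show ?case
  proof (cases "k = 0")
    case True
    have "frac_int (pow_weight (1 - b\<^sup>2) (s - 1) 1) a = 0" if "a\<^sup>2 + b\<^sup>2 < 1" for a b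
    proof -
      have "0 < 1 - b\<^sup>2" "1 - b\<^sup>2 \<le> 1" "a\<^sup>2 < 1 - b\<^sup>2"
        using that zero_le_power2[of a] zero_le_power2[of b] by linarith+
      then show ?thesis using step[OF that] frac_pow_weight_harmonic[of "1 - b\<^sup>2" a] True by simp
    qed
    then show ?thesis using poly_deg_const[of 0 0] True by auto
  next
    case False
    define K where "K = frac_grad (pow_weight 1 (s - 1) k) 0"
    define h where "h = (\<lambda>(a::real) (b::real). if odd k then K * (1 - b\<^sup>2) ^ (k div 2) else 0)"
    have h: "poly_deg (k - 1) (\<lambda>a b. h a b)"
    proof (cases "odd k")
      case True
      then have "2 * (k div 2) = k - 1" by presburger
      then show ?thesis
        unfolding h_def using poly_deg_cmult[OF poly_deg_circle_power[of "k div 2"], of K] True by simp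
    qed (simp add: h_def poly_deg_const)
    obtain P where P: "k \<le> 1 \<Longrightarrow> P = (\<lambda>a b. 0)" "poly_deg (k - 1) P"
      "\<And>a b. ((\<lambda>a. P a b) has_real_derivative p a b) (at a)"
    proof (cases "k \<le> 1")
      case True
      then show thesis using p(2) poly_deg_const[of _ 0] by (intro that[of "\<lambda>a b. 0"]) auto
    next
      case False
      then have "Suc (k - 2) = k - 1" by simp
      then show thesis using poly_deg_antiderivative[OF p(1)] that False by auto
    qed
    have ap: "poly_deg (k - 1) (\<lambda>a b. a * p a b)"
    proof (cases "k \<le> 1")
      case True
      then show ?thesis using p(2) poly_deg_const[of _ 0] by simp
    next
      case False
      then have "k - 2 + (1 + 0) = k - 1" by simp
      then show ?thesis using poly_deg_mult_monom[OF p(1), of 1 0 1] by (simp add: mult.commute)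
    qed
    have P0: "poly_deg (k - 1) (\<lambda>a b. P 0 b)" if "poly_deg (k - 1) P" for P
      using that
    proof (induction rule: poly_deg.induct)
      case (monom i j n c)
      then show ?case using poly_deg.monom[of 0 j n "c * 0 ^ i"] by simp
    qed (rule poly_deg.add)
    \<comment> \<open>The term h is the companion at the centre; the bracket with P restores its
      dependence on a.\<close>
    define q where "q = (\<lambda>a b. a * p a b + (h a b + 2 * s * (P a b - P 0 b)))"
    have "poly_deg (k - 1) q"
      unfolding q_def by (intro poly_deg.add ap h poly_deg_cmult poly_deg_diff P P0)
    moreover have "frac_int (pow_weight (1 - b\<^sup>2) (s - 1) (Suc k)) a = q a b" if ab: "a\<^sup>2 + b\<^sup>2 < 1" for a b
    proof -
      have c: "0 < 1 - b\<^sup>2" "1 - b\<^sup>2 \<le> 1" "a\<^sup>2 < 1 - b\<^sup>2"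
        using that zero_le_power2[of a] zero_le_power2[of b] by linarith+
      have "frac_grad (pow_weight (1 - b\<^sup>2) (s - 1) k) a
        = frac_grad (pow_weight (1 - b\<^sup>2) (s - 1) k) 0 + 2 * s * (P a b - P 0 b)"
      proof (rule frac_grad_pow_weight[OF c(1,2) _ _ P(3) c(3)])
        show "frac_int (pow_weight (1 - b\<^sup>2) (s - 1) k) z = p z b" if "z\<^sup>2 < 1 - b\<^sup>2" for z
          using that by (intro p(3)) simp
        show "continuous_on UNIV (\<lambda>z. p z b)"
          by (intro poly_deg_continuous[OF p(1)] continuous_intros)
      qed
      moreover have "frac_grad (pow_weight (1 - b\<^sup>2) (s - 1) k) 0 = h a b"
        using frac_grad_pow_weight_0[OF c(1), of k] by (simp add: h_def K_def)
      ultimately show ?thesis using step[OF ab] p(3)[OF ab] by (simp add: q_def)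
    qed
    ultimately show ?thesis using False by auto
  qed
qed

text \<open>Since (c - z^2)^s equals c - z^2 times the singular weight, two images of the latter
  suffice. The factor c = 1 - b^2 gives back the two degrees that were lost, so the degree bound m
  is preserved; the finite-dimensional argument rests on this.\<close>

lemma frac_int_slice_polynomial:
  "\<exists>p. poly_deg m p \<and> (\<forall>a b. a\<^sup>2 + b\<^sup>2 < 1 \<longrightarrow>
    has_bochner_integral lborel (\<lambda>t. kern t * second_diff (pow_weight (1 - b\<^sup>2) s m) a t) (p a b))"
proof -
  obtain p where p: "poly_deg (m - 2) p" "m \<le> 1 \<longrightarrow> p = (\<lambda>a b. 0)"
    "\<And>a b. a\<^sup>2 + b\<^sup>2 < 1 \<Longrightarrow> frac_int (pow_weight (1 - b\<^sup>2) (s - 1) m) a = p a b"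
    using frac_int_pow_weight_polynomial[of m] by blast
  obtain q where q: "poly_deg m q"
    "\<And>a b. a\<^sup>2 + b\<^sup>2 < 1 \<Longrightarrow> frac_int (pow_weight (1 - b\<^sup>2) (s - 1) (Suc (Suc m))) a = q a b"
    using frac_int_pow_weight_polynomial[of "Suc (Suc m)"] by auto
  have bp: "poly_deg m (\<lambda>a b. (1 - b\<^sup>2) * p a b)"
  proof (cases "m \<le> 1")
    case True
    then show ?thesis using p(2) poly_deg_const[of _ 0] by simp
  next
    case False
    then have "2 * 1 + (m - 2) = m" by simp
    then show ?thesis using poly_deg_mult[OF poly_deg_circle_power[of 1] p(1)] by simp
  qed
  show ?thesis
  proof (intro exI conjI allI impI)
    show "poly_deg m (\<lambda>a b. (1 - b\<^sup>2) * p a b - q a b)" by (intro poly_deg_diff bp q)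
    fix a b :: real assume ab: "a\<^sup>2 + b\<^sup>2 < 1"
    have t: "tame_on (-\<bar>a\<bar>) \<bar>a\<bar> (pow_weight (1 - b\<^sup>2) (s - 1) k)" for k
      using ab s_pos s_less_1 by (intro tame_on_pow_weight) auto
    have a: "a \<in> {-\<bar>a\<bar>..\<bar>a\<bar>}" by auto
    note i = tame_on_integrable(1)[OF t a]
    have "has_bochner_integral lborel (\<lambda>t. (1 - b\<^sup>2) * (kern t * second_diff (pow_weight (1 - b\<^sup>2) (s - 1) m) a t)
       - kern t * second_diff (pow_weight (1 - b\<^sup>2) (s - 1) (Suc (Suc m))) a t) ((1 - b\<^sup>2) * p a b - q a b)"
      using i p(3)[OF ab] q(2)[OF ab]
      by (intro has_bochner_integral_diff has_bochner_integral_mult_right) (auto simp: has_bochner_integral_iff frac_int_def)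
    moreover have "(1 - b\<^sup>2) * (kern t * second_diff (pow_weight (1 - b\<^sup>2) (s - 1) m) a t)
       - kern t * second_diff (pow_weight (1 - b\<^sup>2) (s - 1) (Suc (Suc m))) a t
       = kern t * second_diff (pow_weight (1 - b\<^sup>2) s m) a t" for t
    proof -
      have w: "pow_weight (1 - b\<^sup>2) s m y = (1 - b\<^sup>2) * pow_weight (1 - b\<^sup>2) (s - 1) m y
          - pow_weight (1 - b\<^sup>2) (s - 1) (Suc (Suc m)) y" for y
        using pow_weight_add_1[of "1 - b\<^sup>2" "s - 1" m y] by simp
      show ?thesis unfolding second_diff_def w by (simp add: algebra_simps)
    qed
    ultimately show "has_bochner_integral lborel (\<lambda>t. kern t * second_diff (pow_weight (1 - b\<^sup>2) s m) a t) ((1 - b\<^sup>2) * p a b - q a b)"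
      by simp
  qed
qed

end

section \<open>Second differences in the plane and the comparison principle\<close>

definition second_diff2 :: "(real^2 \<Rightarrow> real) \<Rightarrow> real^2 \<Rightarrow> real \<Rightarrow> real" where
  "second_diff2 u x t = 4 * u x - u (x + t *\<^sub>R axis 1 1) - u (x - t *\<^sub>R axis 1 1)
    - u (x + t *\<^sub>R axis 2 1) - u (x - t *\<^sub>R axis 2 1)"

lemma axis_nth_2 [simp]:
  "(axis 1 c :: real^2) $ 1 = c" "(axis 1 c :: real^2) $ 2 = 0"
  "(axis 2 c :: real^2) $ 1 = 0" "(axis 2 c :: real^2) $ 2 = c"
  by (simp_all add: axis_def)

lemma norm_sq_2: "(norm (x :: real^2))\<^sup>2 = (x $ 1)\<^sup>2 + (x $ 2)\<^sup>2"
  unfolding power2_norm_eq_inner by (simp add: inner_vec_def sum_2 power2_eq_square)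

lemma in_unit_ball_2: "x \<in> ball 0 1 \<longleftrightarrow> (x $ 1)\<^sup>2 + (x $ 2)\<^sup>2 < 1" for x :: "real^2"
proof -
  have "norm x < 1 \<longleftrightarrow> (norm x)\<^sup>2 < 1" by (simp add: abs_square_less_1)
  then show ?thesis by (simp add: norm_sq_2)
qed

lemma second_diff2_add: "second_diff2 (\<lambda>x. u x + v x) x t = second_diff2 u x t + second_diff2 v x t"
  and second_diff2_diff: "second_diff2 (\<lambda>x. u x - v x) x t = second_diff2 u x t - second_diff2 v x t"
  and second_diff2_cmult: "second_diff2 (\<lambda>x. c * u x) x t = c * second_diff2 u x t"
  and second_diff2_const: "second_diff2 (\<lambda>x. c) x t = 0"
  by (simp_all add: second_diff2_def algebra_simps)

lemma second_diff2_translate: "second_diff2 (\<lambda>x. u (x + h)) x t = second_diff2 u (x + h) t"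
  by (simp add: second_diff2_def algebra_simps)

lemma continuous_attains_global_min_negative:
  fixes z :: "'a::euclidean_space \<Rightarrow> real"
  assumes "continuous_on UNIV z" "bounded D" "\<And>x. x \<notin> D \<Longrightarrow> 0 \<le> z x" "z x0 < 0"
  obtains m where "m \<in> D" "z m < 0" "\<And>y. z m \<le> z y"
proof -
  have "x0 \<in> D" using assms(3)[of x0] assms(4) by force
  then have "x0 \<in> closure D" using closure_subset by blast
  obtain m where m: "m \<in> closure D" "\<And>y. y \<in> closure D \<Longrightarrow> z m \<le> z y"
    using continuous_attains_inf[of "closure D" z] assms(1,2) \<open>x0 \<in> closure D\<close>
    by (metis compact_closure continuous_on_subset empty_iff subset_UNIV)
  have neg: "z m < 0" using m(2)[OF \<open>x0 \<in> closure D\<close>] assms(4) by linarith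
  have "z m \<le> z y" for y
    using m(2)[of y] assms(3)[of y] neg closure_subset[of D] by force
  moreover have "m \<in> D" using assms(3)[of m] neg by force
  ultimately show thesis using that neg by blast
qed

text \<open>At a negative global minimum no second difference is positive, so one step t contradicts
  it. Asking for a single t, and not for a positive integral, lets the same lemma treat solutions
  and barriers with a corner.\<close>

lemma comparison_principle:
  assumes "continuous_on UNIV z" "bounded D" "\<And>x. x \<notin> D \<Longrightarrow> 0 \<le> z x"
    and "\<And>x. x \<in> D \<Longrightarrow> \<exists>t>0. 0 < second_diff2 z x t"
  shows "0 \<le> z x"
proof (rule ccontr)
  assume "\<not> 0 \<le> z x"
  then obtain m where m: "m \<in> D" "\<And>y. z m \<le> z y"
    using continuous_attains_global_min_negative[OF assms(1-3), of x] by (metis not_le)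
  obtain t where "0 < second_diff2 z m t" using assms(4)[OF m(1)] by blast
  then show False
    using m(2)[of "m + t *\<^sub>R axis 1 1"] m(2)[of "m - t *\<^sub>R axis 1 1"]
      m(2)[of "m + t *\<^sub>R axis 2 1"] m(2)[of "m - t *\<^sub>R axis 2 1"]
    unfolding second_diff2_def by linarith
qed

definition disc_weight :: "real \<Rightarrow> (real \<Rightarrow> real \<Rightarrow> real) \<Rightarrow> real^2 \<Rightarrow> real" where
  "disc_weight q p x = (max 0 (1 - (x $ 1)\<^sup>2 - (x $ 2)\<^sup>2)) powr q * p (x $ 1) (x $ 2)"

lemma disc_weight_outside: "x \<notin> ball 0 1 \<Longrightarrow> disc_weight q p x = 0"
  unfolding in_unit_ball_2 by (simp add: disc_weight_def max_def)

lemma continuous_on_disc_weight: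
  assumes "poly_deg n p" "0 < q"
  shows "continuous_on S (disc_weight q p)"
  unfolding disc_weight_def using assms(2)
  by (intro continuous_intros continuous_on_powr' poly_deg_continuous[OF assms(1)]) auto

lemma disc_weight_slice1:
  "disc_weight q (\<lambda>a b. c * a ^ i * b ^ j) x = c * (x $ 2) ^ j * pow_weight (1 - (x $ 2)\<^sup>2) q i (x $ 1)"
  and disc_weight_slice2:
  "disc_weight q (\<lambda>a b. c * a ^ i * b ^ j) x = c * (x $ 1) ^ i * pow_weight (1 - (x $ 1)\<^sup>2) q j (x $ 2)"
  by (simp_all add: disc_weight_def pow_weight_def algebra_simps)

lemma second_diff2_disc_weight_monom:
  "second_diff2 (disc_weight q (\<lambda>a b. c * a ^ i * b ^ j)) x t =
    c * (x $ 2) ^ j * second_diff (pow_weight (1 - (x $ 2)\<^sup>2) q i) (x $ 1) t +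
    c * (x $ 1) ^ i * second_diff (pow_weight (1 - (x $ 1)\<^sup>2) q j) (x $ 2) t"
proof -
  let ?w = "disc_weight q (\<lambda>a b. c * a ^ i * b ^ j)"
  have "second_diff2 ?w x t = (2 * ?w x - ?w (x + t *\<^sub>R axis 1 1) - ?w (x - t *\<^sub>R axis 1 1))
      + (2 * ?w x - ?w (x + t *\<^sub>R axis 2 1) - ?w (x - t *\<^sub>R axis 2 1))"
    by (simp add: second_diff2_def)
  also have "2 * ?w x - ?w (x + t *\<^sub>R axis 1 1) - ?w (x - t *\<^sub>R axis 1 1)
      = c * (x $ 2) ^ j * second_diff (pow_weight (1 - (x $ 2)\<^sup>2) q i) (x $ 1) t"
    unfolding disc_weight_slice1 by (simp add: second_diff_def algebra_simps)
  also have "2 * ?w x - ?w (x + t *\<^sub>R axis 2 1) - ?w (x - t *\<^sub>R axis 2 1)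
      = c * (x $ 1) ^ i * second_diff (pow_weight (1 - (x $ 1)\<^sup>2) q j) (x $ 2) t"
    unfolding disc_weight_slice2 by (simp add: second_diff_def algebra_simps)
  finally show ?thesis .
qed

lemma disc_weight_add: "disc_weight q (\<lambda>a b. f a b + g a b) x = disc_weight q f x + disc_weight q g x"
  by (simp add: disc_weight_def distrib_left)

context fractional_order
begin

text \<open>\<open>solves_at u y x\<close> says that \<open>-Lu(x) = y\<close> up to the factor \<^term>\<open>frac_const s\<close>.\<close>

definition solves_at :: "(real^2 \<Rightarrow> real) \<Rightarrow> real \<Rightarrow> real^2 \<Rightarrow> bool" where
  "solves_at u y x \<longleftrightarrow> has_bochner_integral lborel (\<lambda>t. kern t * second_diff2 u x t) y"

lemma solves_at_add: "solves_at u a x \<Longrightarrow> solves_at v b x \<Longrightarrow> solves_at (\<lambda>x. u x + v x) (a + b) x"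
  unfolding solves_at_def second_diff2_add distrib_left by (rule has_bochner_integral_add)

lemma solves_at_diff: "solves_at u a x \<Longrightarrow> solves_at v b x \<Longrightarrow> solves_at (\<lambda>x. u x - v x) (a - b) x"
  unfolding solves_at_def second_diff2_diff right_diff_distrib by (rule has_bochner_integral_diff)

lemma solves_at_cmult: "solves_at u a x \<Longrightarrow> solves_at (\<lambda>x. c * u x) (c * a) x"
  unfolding solves_at_def second_diff2_cmult
  using has_bochner_integral_mult_right[of c lborel "\<lambda>t. kern t * second_diff2 u x t" a]
  by (simp add: mult.left_commute)

lemma solves_at_const: "solves_at (\<lambda>x. c) 0 x"
  unfolding solves_at_def second_diff2_const by (simp add: has_bochner_integral_zero)

lemma solves_at_translate: "solves_at u a (x + h) \<Longrightarrow> solves_at (\<lambda>x. u (x + h)) a x"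
  unfolding solves_at_def second_diff2_translate .

text \<open>Links the integral equation to the comparison principle: an integral against a
  nonnegative kernel is positive only if its integrand is positive somewhere.\<close>

lemma solves_at_pos:
  assumes "solves_at z a x" "0 < a"
  shows "\<exists>t>0. 0 < second_diff2 z x t"
proof (rule ccontr)
  assume "\<not> ?thesis"
  then have "second_diff2 z x t \<le> 0" if "0 < t" for t using that by (meson not_le)
  then have "kern t * second_diff2 z x t \<le> 0" for t
    using kern_nonneg[of t] by (cases "0 < t") (simp_all add: kern_zero mult_nonneg_nonpos)
  then have "0 \<le> (\<integral>t. - (kern t * second_diff2 z x t) \<partial>lborel)"
    by (intro Bochner_Integration.integral_nonneg) simp
  then have "a \<le> 0" using assms(1) unfolding solves_at_def has_bochner_integral_iff by simp
  with assms(2) show False by simp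
qed

lemma disc_weight_polynomial:
  "poly_deg n p \<Longrightarrow> \<exists>q. poly_deg n q \<and> (\<forall>x\<in>ball 0 1. solves_at (disc_weight s p) (q (x $ 1) (x $ 2)) x)"
proof (induction rule: poly_deg.induct)
  case (monom i j n c)
  obtain p1 where p1: "poly_deg i p1" "\<And>a b. a\<^sup>2 + b\<^sup>2 < 1 \<Longrightarrow>
    has_bochner_integral lborel (\<lambda>t. kern t * second_diff (pow_weight (1 - b\<^sup>2) s i) a t) (p1 a b)"
    using frac_int_slice_polynomial by blast
  obtain p2 where p2: "poly_deg j p2" "\<And>a b. a\<^sup>2 + b\<^sup>2 < 1 \<Longrightarrow>
    has_bochner_integral lborel (\<lambda>t. kern t * second_diff (pow_weight (1 - b\<^sup>2) s j) a t) (p2 a b)"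
    using frac_int_slice_polynomial by blast
  define q where "q = (\<lambda>a b. p1 a b * (c * a ^ 0 * b ^ j) + p2 b a * (c * a ^ i * b ^ 0))"
  have "poly_deg n q" unfolding q_def
    using poly_deg_mult_monom[OF p1(1), of 0 j c] poly_deg_mult_monom[OF poly_deg_swap[OF p2(1)], of i 0 c] monom
    by (intro poly_deg.add; elim poly_deg_mono) auto
  moreover have "solves_at (disc_weight s (\<lambda>a b. c * a ^ i * b ^ j)) (q (x $ 1) (x $ 2)) x" if "x \<in> ball 0 1" for x
  proof -
    have x: "(x $ 1)\<^sup>2 + (x $ 2)\<^sup>2 < 1" "(x $ 2)\<^sup>2 + (x $ 1)\<^sup>2 < 1" using that unfolding in_unit_ball_2 by linarith+
    have "has_bochner_integral lborel (\<lambda>t. (c * (x $ 2) ^ j) * (kern t * second_diff (pow_weight (1 - (x $ 2)\<^sup>2) s i) (x $ 1) t)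
      + (c * (x $ 1) ^ i) * (kern t * second_diff (pow_weight (1 - (x $ 1)\<^sup>2) s j) (x $ 2) t))
      ((c * (x $ 2) ^ j) * p1 (x $ 1) (x $ 2) + (c * (x $ 1) ^ i) * p2 (x $ 2) (x $ 1))"
      by (intro has_bochner_integral_add has_bochner_integral_mult_right p1(2) p2(2) x)
    then show ?thesis unfolding solves_at_def second_diff2_disc_weight_monom q_def by (simp add: algebra_simps)
  qed
  ultimately show ?case by blast
next
  case (add n f g)
  then obtain qf qg where q: "poly_deg n qf" "poly_deg n qg"
    "\<forall>x\<in>ball 0 1. solves_at (disc_weight s f) (qf (x $ 1) (x $ 2)) x"
    "\<forall>x\<in>ball 0 1. solves_at (disc_weight s g) (qg (x $ 1) (x $ 2)) x" by blast
  have "disc_weight s (\<lambda>a b. f a b + g a b) = (\<lambda>x. disc_weight s f x + disc_weight s g x)"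
    by (simp add: disc_weight_add fun_eq_iff)
  then show ?case using q by (intro exI[of _ "\<lambda>a b. qf a b + qg a b"]) (auto intro: poly_deg.add solves_at_add)
qed

text \<open>The torsion function of the disc, up to a constant factor.\<close>

abbreviation torsion :: "real^2 \<Rightarrow> real" where
  "torsion \<equiv> disc_weight s (\<lambda>a b. 1)"

lemma torsion_nonneg: "0 \<le> torsion x" by (simp add: disc_weight_def)

lemma torsion_le_1: "torsion x \<le> 1"
  unfolding disc_weight_def using s_pos by (auto intro!: powr_le1)

text \<open>The sign of the constant can be read off at the origin, where the second differences are
  4 - 4 (1 - t^2)_+^s \<ge> 0 and equal 4 as soon as t \<ge> 1. A lower bound of the kernel on
  [1, 2] then gives strict positivity.\<close>

lemma torsion_constant: "\<exists>\<kappa>>0. \<forall>x\<in>ball 0 1. solves_at torsion \<kappa> x"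
proof -
  obtain q where q: "poly_deg 0 q" "\<forall>x\<in>ball 0 1. solves_at torsion (q (x $ 1) (x $ 2)) x"
    using disc_weight_polynomial[OF poly_deg_const[of 0 1]] by blast
  obtain \<kappa> where \<kappa>: "q = (\<lambda>a b. \<kappa>)" using poly_deg_0[OF q(1)] by blast
  have sol: "\<forall>x\<in>ball 0 1. solves_at torsion \<kappa> x" using q(2) by (simp add: \<kappa>)
  then have "solves_at torsion \<kappa> 0" by simp
  then have int: "integrable lborel (\<lambda>t. kern t * second_diff2 torsion 0 t)"
    and \<kappa>_eq: "\<kappa> = (\<integral>t. kern t * second_diff2 torsion 0 t \<partial>lborel)"
    by (auto simp: solves_at_def has_bochner_integral_iff)
  have sd: "second_diff2 torsion 0 t = 4 - 4 * (max 0 (1 - t\<^sup>2)) powr s" for t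
    by (simp add: second_diff2_def disc_weight_def)
  have "0 < 2 powr (-1 - 2 * s) * 4" by simp
  also have "2 powr (-1 - 2 * s) * 4 = (\<integral>t. indicator {1..2::real} t * (2 powr (-1 - 2 * s) * 4) \<partial>lborel)"
    by simp
  also have "\<dots> \<le> \<kappa>" unfolding \<kappa>_eq
  proof (rule integral_mono[OF _ int])
    show "integrable lborel (\<lambda>t. indicator {1..2::real} t * (2 powr (-1 - 2 * s) * 4) :: real)"
      by (intro integrable_mult_left integrable_real_indicator) auto
    fix t :: real
    have nonneg: "0 \<le> second_diff2 torsion 0 t"
      unfolding sd using s_pos powr_le1[of s "max 0 (1 - t\<^sup>2)"] by simp
    show "indicator {1..2} t * (2 powr (-1 - 2 * s) * 4) \<le> kern t * second_diff2 torsion 0 t"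
    proof (cases "t \<in> {1..2}")
      case True
      then have "2 powr (-1 - 2 * s) \<le> kern t" using s_pos by (auto simp: kern_def intro: powr_mono2')
      moreover have "second_diff2 torsion 0 t = 4" unfolding sd using True one_le_power[of t 2] by simp
      ultimately show ?thesis using True by simp
    next
      case False
      then show ?thesis using nonneg kern_nonneg by simp
    qed
  qed
  finally show ?thesis using sol by blast
qed

definition torsion_const :: real where
  "torsion_const = (SOME \<kappa>. 0 < \<kappa> \<and> (\<forall>x\<in>ball 0 1. solves_at torsion \<kappa> x))"

lemma torsion_const: "0 < torsion_const" "x \<in> ball 0 1 \<Longrightarrow> solves_at torsion torsion_const x"
  using someI_ex[OF torsion_constant[unfolded Bex_def]] unfolding torsion_const_def by auto

text \<open>The comparison principle asks for strict positivity, so M is first enlarged by \<delta>,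
  which is then sent to 0. The sign \<sigma> treats the upper and the lower bound together.\<close>

lemma disc_weight_sup_bound:
  assumes p: "poly_deg n p" and sol: "\<And>x. x \<in> ball 0 1 \<Longrightarrow> solves_at (disc_weight s p) (F x) x"
    and F: "\<And>x. x \<in> ball 0 1 \<Longrightarrow> \<bar>F x\<bar> \<le> M"
  shows "\<bar>disc_weight s p x\<bar> \<le> M / torsion_const * torsion x"
proof -
  have main: "\<sigma> * disc_weight s p x \<le> (M + \<delta>) / torsion_const * torsion x" if "0 < \<delta>" and \<sigma>: "\<bar>\<sigma>\<bar> = 1" for \<delta> \<sigma>
  proof -
    define z where "z x = (M + \<delta>) / torsion_const * torsion x - \<sigma> * disc_weight s p x" for x
    have "0 \<le> z x"
    proof (rule comparison_principle[of z "ball 0 1"])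
      show "continuous_on UNIV z" unfolding z_def
        using p s_pos poly_deg_const[of 0 1] by (intro continuous_intros continuous_on_disc_weight) auto
      show "0 \<le> z x" if "x \<notin> ball 0 1" for x using that by (simp add: z_def disc_weight_outside)
      fix x :: "real^2" assume x: "x \<in> ball 0 1"
      have "solves_at z ((M + \<delta>) / torsion_const * torsion_const - \<sigma> * F x) x"
        unfolding z_def using torsion_const sol x by (intro solves_at_diff solves_at_cmult)
      moreover have "\<sigma> * F x \<le> M" using F[OF x] \<sigma> by (auto simp: abs_if split: if_splits)
      ultimately show "\<exists>t>0. 0 < second_diff2 z x t"
        by (intro solves_at_pos[of z "(M + \<delta>) / torsion_const * torsion_const - \<sigma> * F x"])
          (use torsion_const(1) \<open>0 < \<delta>\<close> in auto)
    qed auto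
    then show ?thesis by (simp add: z_def)
  qed
  have "\<sigma> * disc_weight s p x \<le> M / torsion_const * torsion x" if "\<bar>\<sigma>\<bar> = 1" for \<sigma>
  proof (rule field_le_epsilon)
    fix e :: real assume "0 < e"
    have "\<sigma> * disc_weight s p x \<le> (M + e * torsion_const) / torsion_const * torsion x"
      using torsion_const(1) \<open>0 < e\<close> that by (intro main) auto
    also have "\<dots> = M / torsion_const * torsion x + e * torsion x"
      using torsion_const(1) by (simp add: field_simps)
    also have "\<dots> \<le> M / torsion_const * torsion x + e"
      using torsion_le_1[of x] torsion_nonneg[of x] \<open>0 < e\<close> by (simp add: mult_left_le)
    finally show "\<sigma> * disc_weight s p x \<le> M / torsion_const * torsion x + e" .
  qed
  from this[of 1] this[of "-1"] show ?thesis by simp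
qed

end

section \<open>Polynomials on the disc as a finite-dimensional space\<close>

interpretation plane_fun: vector_space "\<lambda>(c::real) (f :: real \<Rightarrow> real \<Rightarrow> real) a b. c * f a b"
  by unfold_locales (auto simp: fun_eq_iff algebra_simps)

lemma sum_fun2_apply: "(\<Sum>i\<in>I. f i) a b = (\<Sum>i\<in>I. f i a b)" for f :: "'i \<Rightarrow> real \<Rightarrow> real \<Rightarrow> real"
  by (induction I rule: infinite_finite_induct) auto

text \<open>Setting the values off the disc to 0 turns functions that agree on the disc into the
  same vector. The equation sees only the disc, so injectivity can be argued there, without
  uniqueness of polynomial extensions.\<close>

definition disc_cutoff :: "(real \<Rightarrow> real \<Rightarrow> real) \<Rightarrow> real \<Rightarrow> real \<Rightarrow> real" where
  "disc_cutoff p a b = (if a\<^sup>2 + b\<^sup>2 < 1 then p a b else 0)"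

lemma disc_weight_cutoff: "disc_weight q (disc_cutoff p) = disc_weight q p"
  by (auto simp: disc_weight_def disc_cutoff_def fun_eq_iff max_def)

lemma poly_deg_sum:
  "(\<And>i. i \<in> I \<Longrightarrow> poly_deg n (f i)) \<Longrightarrow> poly_deg n (\<lambda>a b. \<Sum>i\<in>I. f i a b)"
  by (induction I rule: infinite_finite_induct) (auto intro: poly_deg.add poly_deg_const)

definition disc_polys :: "nat \<Rightarrow> (real \<Rightarrow> real \<Rightarrow> real) set" where
  "disc_polys n = {disc_cutoff p | p. poly_deg n p}"

lemma disc_polys_linear_combination:
  assumes "\<And>i. i \<in> I \<Longrightarrow> f i \<in> disc_polys n"
  shows "(\<lambda>a b. \<Sum>i\<in>I. c i * f i a b) \<in> disc_polys n"
proof -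
  have "\<forall>i\<in>I. \<exists>p. poly_deg n p \<and> f i = disc_cutoff p" using assms by (auto simp: disc_polys_def)
  from bchoice[OF this] obtain p where p: "\<And>i. i \<in> I \<Longrightarrow> poly_deg n (p i)" "\<And>i. i \<in> I \<Longrightarrow> f i = disc_cutoff (p i)"
    by blast
  have "(\<lambda>a b. \<Sum>i\<in>I. c i * f i a b) = disc_cutoff (\<lambda>a b. \<Sum>i\<in>I. c i * p i a b)"
    by (auto simp: p(2) disc_cutoff_def fun_eq_iff)
  then show ?thesis unfolding disc_polys_def using p(1)
    by (auto intro!: exI[of _ "\<lambda>a b. \<Sum>i\<in>I. c i * p i a b"] poly_deg_sum poly_deg_cmult)
qed

lemma disc_polys_finite_basis:
  obtains B where "finite B" "B \<subseteq> disc_polys n" "plane_fun.independent B" "disc_polys n \<subseteq> plane_fun.span B"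
proof -
  define M where "M = (\<lambda>(i, j). disc_cutoff (\<lambda>a b. a ^ i * b ^ j)) ` ({..n} \<times> {..n})"
  have "disc_cutoff p \<in> plane_fun.span M" if "poly_deg m p" "m \<le> n" for p m
    using that
  proof (induction rule: poly_deg.induct)
    case (monom i j m c)
    then have "disc_cutoff (\<lambda>a b. a ^ i * b ^ j) \<in> M" by (auto simp: M_def)
    then have "(\<lambda>a b. c * disc_cutoff (\<lambda>a b. a ^ i * b ^ j) a b) \<in> plane_fun.span M"
      by (intro plane_fun.span_scale plane_fun.span_base)
    moreover have "(\<lambda>a b. c * disc_cutoff (\<lambda>a b. a ^ i * b ^ j) a b) = disc_cutoff (\<lambda>a b. c * a ^ i * b ^ j)"
      by (auto simp: disc_cutoff_def fun_eq_iff)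
    ultimately show ?case by simp
  next
    case (add m f g)
    then have "disc_cutoff f + disc_cutoff g \<in> plane_fun.span M" by (intro plane_fun.span_add) auto
    moreover have "disc_cutoff f + disc_cutoff g = disc_cutoff (\<lambda>a b. f a b + g a b)"
      by (auto simp: disc_cutoff_def fun_eq_iff)
    ultimately show ?case by simp
  qed
  then have sub: "disc_polys n \<subseteq> plane_fun.span M" by (auto simp: disc_polys_def)
  obtain B where B: "B \<subseteq> disc_polys n" "plane_fun.independent B" "disc_polys n \<subseteq> plane_fun.span B"
    using plane_fun.maximal_independent_subset[of "disc_polys n"] by blast
  have "finite M" by (simp add: M_def)
  then have "finite B" using plane_fun.independent_span_bound[of M B] B sub by blast
  then show thesis using that B by blast
qed

context fractional_order
begin

text \<open>The map taking a polynomial \<open>p\<close> to the image of \<open>(1 - |x|^2)^s p\<close> preserves the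
  finite-dimensional space of polynomials of degree at most \<open>n\<close> on the disc, and it is injective by
  the maximum principle, hence onto.\<close>

lemma disc_weight_solve_polynomial:
  assumes q: "poly_deg n q"
  shows "\<exists>p. poly_deg n p \<and> (\<forall>x\<in>ball 0 1. solves_at (disc_weight s p) (q (x $ 1) (x $ 2)) x)"
proof -
  obtain B where B: "finite B" "B \<subseteq> disc_polys n" "plane_fun.independent B" "disc_polys n \<subseteq> plane_fun.span B"
    using disc_polys_finite_basis by blast
  have "\<exists>g\<in>disc_polys n. \<forall>x\<in>ball 0 1. solves_at (disc_weight s f) (g (x $ 1) (x $ 2)) x" if f: "f \<in> disc_polys n" for f
  proof -
    obtain p where p: "poly_deg n p" "f = disc_cutoff p" using f by (auto simp: disc_polys_def)
    obtain r where r: "poly_deg n r" "\<forall>x\<in>ball 0 1. solves_at (disc_weight s p) (r (x $ 1) (x $ 2)) x"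
      using disc_weight_polynomial[OF p(1)] by blast
    show ?thesis
    proof (intro bexI ballI)
      show "disc_cutoff r \<in> disc_polys n" using r(1) by (auto simp: disc_polys_def)
      fix x :: "real^2" assume x: "x \<in> ball 0 1"
      then have "disc_cutoff r (x $ 1) (x $ 2) = r (x $ 1) (x $ 2)"
        unfolding in_unit_ball_2 by (simp add: disc_cutoff_def)
      then show "solves_at (disc_weight s f) (disc_cutoff r (x $ 1) (x $ 2)) x"
        using r(2) x by (simp add: p(2) disc_weight_cutoff)
    qed
  qed
  \<comment> \<open>\<open>T\<close> merely selects an image for each element; linearity enters
    through \<open>comb\<close>, which adds up the solutions themselves.\<close>
  then obtain T where T: "\<And>f. f \<in> disc_polys n \<Longrightarrow> T f \<in> disc_polys n"
    "\<And>f x. f \<in> disc_polys n \<Longrightarrow> x \<in> ball 0 1 \<Longrightarrow> solves_at (disc_weight s f) (T f (x $ 1) (x $ 2)) x"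
    by metis
  have comb: "solves_at (disc_weight s (\<lambda>a b. \<Sum>f\<in>B. c f * f a b)) (\<Sum>f\<in>B. c f * T f (x $ 1) (x $ 2)) x"
    if x: "x \<in> ball 0 1" for c x
  proof -
    have "solves_at (disc_weight s (\<lambda>a b. \<Sum>f\<in>A. c f * f a b)) (\<Sum>f\<in>A. c f * T f (x $ 1) (x $ 2)) x"
      if "finite A" "A \<subseteq> B" for A
      using that
    proof (induction rule: finite_induct)
      case empty
      show ?case using solves_at_const[of 0 x] by (simp add: disc_weight_def)
    next
      case (insert f A)
      have "solves_at (\<lambda>x. c f * disc_weight s f x + disc_weight s (\<lambda>a b. \<Sum>f\<in>A. c f * f a b) x)
         (c f * T f (x $ 1) (x $ 2) + (\<Sum>f\<in>A. c f * T f (x $ 1) (x $ 2))) x"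
        using insert B(2) x by (intro solves_at_add solves_at_cmult T) auto
      moreover have "(\<lambda>x. c f * disc_weight s f x + disc_weight s (\<lambda>a b. \<Sum>f\<in>A. c f * f a b) x)
          = disc_weight s (\<lambda>a b. \<Sum>f\<in>insert f A. c f * f a b)"
        using insert by (simp add: disc_weight_def fun_eq_iff distrib_left)
      ultimately show ?case using insert by simp
    qed
    then show ?thesis using B(1) by blast
  qed
  \<comment> \<open>A combination whose images cancel solves the homogeneous equation, so the sup
    bound with M = 0 annihilates its weighted form. The weight is positive inside the disc, hence
    the combination itself is zero.\<close>
  have inj: "\<forall>f\<in>B. c f = 0" if zero: "\<And>a b. a\<^sup>2 + b\<^sup>2 < 1 \<Longrightarrow> (\<Sum>f\<in>B. c f * T f a b) = 0" for c
  proof -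
    define g where "g = (\<lambda>a b. \<Sum>f\<in>B. c f * f a b)"
    have "g \<in> disc_polys n" unfolding g_def using B(2) by (intro disc_polys_linear_combination) auto
    then obtain p where p: "poly_deg n p" "g = disc_cutoff p" by (auto simp: disc_polys_def)
    have w: "\<bar>disc_weight s p x\<bar> \<le> 0 / torsion_const * torsion x" for x
    proof (rule disc_weight_sup_bound[OF p(1), where F="\<lambda>x. 0"])
      fix x :: "real^2" assume x: "x \<in> ball 0 1"
      then have "(\<Sum>f\<in>B. c f * T f (x $ 1) (x $ 2)) = 0"
        unfolding in_unit_ball_2 by (rule zero)
      then show "solves_at (disc_weight s p) 0 x"
        using comb[OF x, of c] by (simp add: g_def[symmetric] p(2) disc_weight_cutoff)
    qed simp
    have "g a b = 0" for a b
    proof (cases "a\<^sup>2 + b\<^sup>2 < 1")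
      case True
      have "disc_weight s p (vector [a, b]) = 0" using w[of "vector [a, b]"] by simp
      then show ?thesis using True by (simp add: disc_weight_def vector_2 p(2) disc_cutoff_def max_def)
    qed (simp add: p(2) disc_cutoff_def)
    then have "(\<Sum>f\<in>B. (\<lambda>a b. c f * f a b)) = 0"
      by (simp add: fun_eq_iff sum_fun2_apply g_def)
    then show ?thesis
      using plane_fun.independentD[OF B(3) B(1) subset_refl] by blast
  qed
  have injT: "inj_on T B"
  proof (rule inj_onI, rule ccontr)
    fix f g assume fg: "f \<in> B" "g \<in> B" "T f = T g" "f \<noteq> g"
    have "\<forall>h\<in>B. (if h = f then 1 else if h = g then -1 else (0::real)) = 0"
    proof (rule inj)
      fix a b :: real
      have "(\<Sum>h\<in>B. (if h = f then 1 else if h = g then -1 else 0) * T h a b)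
        = (\<Sum>h\<in>B. (if h = f then T h a b else 0) - (if h = g then T h a b else 0))"
        using fg by (intro sum.cong) auto
      also have "\<dots> = 0" using fg B(1) by (simp add: sum_subtractf)
      finally show "(\<Sum>h\<in>B. (if h = f then 1 else if h = g then -1 else 0) * T h a b) = 0" .
    qed
    with fg show False by auto
  qed
  have indep: "plane_fun.independent (T ` B)"
  proof
    assume "plane_fun.dependent (T ` B)"
    then obtain u h where h: "h \<in> T ` B" "u h \<noteq> 0" and u: "(\<Sum>x\<in>T ` B. (\<lambda>a b. u x * x a b)) = 0"
      using plane_fun.dependent_finite[of "T ` B"] B(1) by auto
    have "\<forall>f\<in>B. u (T f) = 0"
    proof (rule inj)
      fix a b :: real
      have "(\<Sum>f\<in>B. u (T f) * T f a b) = (\<Sum>x\<in>T ` B. (\<lambda>a b. u x * x a b)) a b"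
        unfolding sum_fun2_apply by (simp add: sum.reindex[OF injT])
      then show "(\<Sum>f\<in>B. u (T f) * T f a b) = 0" using u by simp
    qed
    with h show False by auto
  qed
  define v where "v = disc_cutoff q"
  have v: "v \<in> disc_polys n" unfolding v_def disc_polys_def using q by auto
  \<comment> \<open>Dimension count: otherwise \<open>v\<close> and the images of \<open>B\<close>
    would be card B + 1 independent vectors in the span of \<open>B\<close>.\<close>
  have "v \<in> plane_fun.span (T ` B)"
  proof (rule ccontr)
    assume not: "v \<notin> plane_fun.span (T ` B)"
    then have ind: "plane_fun.independent (insert v (T ` B))"
      using indep by (auto simp: plane_fun.independent_insert)
    have "insert v (T ` B) \<subseteq> plane_fun.span B" using v T(1) B by blast
    then have "card (insert v (T ` B)) \<le> card B"
      using plane_fun.independent_span_bound[OF B(1) ind] by blast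
    moreover have "v \<notin> T ` B" using not plane_fun.span_base by blast
    then have "card (insert v (T ` B)) = Suc (card B)"
      using B(1) by (simp add: card_image[OF injT])
    ultimately show False by simp
  qed
  then obtain u where u: "v = (\<Sum>x\<in>T ` B. (\<lambda>a b. u x * x a b))"
    using plane_fun.span_finite[of "T ` B"] B(1) by auto
  define g where "g = (\<lambda>a b. \<Sum>f\<in>B. u (T f) * f a b)"
  have "g \<in> disc_polys n" unfolding g_def using B(2) by (intro disc_polys_linear_combination) auto
  then obtain p where p: "poly_deg n p" "g = disc_cutoff p" by (auto simp: disc_polys_def)
  have "solves_at (disc_weight s p) (q (x $ 1) (x $ 2)) x" if x: "x \<in> ball 0 1" for x
  proof -
    have "(\<Sum>f\<in>B. u (T f) * T f (x $ 1) (x $ 2)) = v (x $ 1) (x $ 2)"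
      unfolding u sum_fun2_apply by (simp add: sum.reindex[OF injT])
    also have "\<dots> = q (x $ 1) (x $ 2)" using x unfolding in_unit_ball_2 by (simp add: v_def disc_cutoff_def)
    finally show ?thesis using comb[OF x, of "\<lambda>f. u (T f)"]
      by (simp add: g_def[symmetric] p(2) disc_weight_cutoff)
  qed
  then show ?thesis using p(1) by blast
qed

end

section \<open>The weak formulation\<close>

lemma second_diff2_measurable [measurable]:
  assumes [measurable]: "u \<in> borel_measurable borel" "g \<in> borel_measurable M" "h \<in> borel_measurable M"
  shows "(\<lambda>y. second_diff2 u (g y) (h y)) \<in> borel_measurable M"
  unfolding second_diff2_def by measurable

lemma second_diff2_le_sup:
  assumes "\<And>x. \<bar>u x\<bar> \<le> K"
  shows "\<bar>second_diff2 u x t\<bar> \<le> 8 * K"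
  using assms[of x] assms[of "x + t *\<^sub>R axis 1 1"] assms[of "x - t *\<^sub>R axis 1 1"]
    assms[of "x + t *\<^sub>R axis 2 1"] assms[of "x - t *\<^sub>R axis 2 1"]
  unfolding second_diff2_def by linarith

text \<open>The test class for the weak equation. It contains the smooth test functions of the disc,
  and also the explicit piecewise polynomial bumps of the final argument, which are only C^{1,1}.
  The quadratic bound compensates the singularity of the kernel.\<close>

definition C11_bump :: "real \<Rightarrow> (real^2 \<Rightarrow> real) \<Rightarrow> bool" where
  "C11_bump r \<phi> \<longleftrightarrow> continuous_on UNIV \<phi> \<and> (\<forall>x. r < norm x \<longrightarrow> \<phi> x = 0)
     \<and> (\<exists>C. \<forall>x t. 0 < t \<longrightarrow> \<bar>second_diff2 \<phi> x t\<bar> \<le> C * t\<^sup>2)"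

lemma integrable_compact_support:
  fixes \<phi> :: "'a::euclidean_space \<Rightarrow> real"
  assumes cont: "continuous_on UNIV \<phi>" and supp: "\<And>x. r < norm x \<Longrightarrow> \<phi> x = 0"
  shows "integrable lborel \<phi>"
proof -
  have "set_integrable lborel (cball 0 r) \<phi>"
    unfolding set_integrable_def
    by (rule borel_integrable_compact) (use cont in \<open>auto intro: continuous_on_subset\<close>)
  moreover have "(\<lambda>x. indicator (cball 0 r) x *\<^sub>R \<phi> x) = \<phi>"
    using supp by (auto simp: indicator_def fun_eq_iff not_le)
  ultimately show ?thesis by (simp add: set_integrable_def)
qed

lemma bounded_compact_support:
  fixes \<phi> :: "'a::euclidean_space \<Rightarrow> real"
  assumes cont: "continuous_on UNIV \<phi>" and supp: "\<And>x. r < norm x \<Longrightarrow> \<phi> x = 0"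
  obtains K where "0 \<le> K" "\<And>x. \<bar>\<phi> x\<bar> \<le> K"
proof -
  have "compact (\<phi> ` cball 0 r)"
    by (intro compact_continuous_image continuous_on_subset[OF cont]) auto
  then obtain K where K: "\<And>y. y \<in> \<phi> ` cball 0 r \<Longrightarrow> \<bar>y\<bar> \<le> K"
    by (metis bounded_real compact_imp_bounded)
  have "\<bar>\<phi> x\<bar> \<le> max 0 K" for x
    using K[of "\<phi> x"] supp[of x] by (cases "norm x \<le> r") auto
  then show thesis using that[of "max 0 K"] by simp
qed

lemma integrable_bounded_mult:
  fixes u \<phi> :: "'a::euclidean_space \<Rightarrow> real"
  assumes "integrable lborel \<phi>" "u \<in> borel_measurable borel" "\<And>x. \<bar>u x\<bar> \<le> U"
  shows "integrable lborel (\<lambda>x. u x * \<phi> x)"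
proof (rule integrable_lborel_bound)
  show "integrable lborel (\<lambda>x. U * \<bar>\<phi> x\<bar>)" using assms(1) by simp
  show "\<bar>u x * \<phi> x\<bar> \<le> U * \<bar>\<phi> x\<bar>" for x
    using assms(3)[of x] by (simp add: abs_mult mult_right_mono)
  show "(\<lambda>x. u x * \<phi> x) \<in> borel_measurable borel"
    using assms(1,2) borel_measurable_integrable[OF assms(1)] by simp
qed

context fractional_order
begin

definition frac_lap :: "(real^2 \<Rightarrow> real) \<Rightarrow> real^2 \<Rightarrow> real" where
  "frac_lap u x = (\<integral>t. kern t * second_diff2 u x t \<partial>lborel)"

lemma kern_Fubini:
  fixes G :: "real \<Rightarrow> real^2 \<Rightarrow> real"
  assumes meas[measurable]: "case_prod G \<in> borel_measurable (lborel \<Otimes>\<^sub>M lborel)"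
    and int: "\<And>t. integrable lborel (G t)"
    and bound: "\<And>t. 0 < t \<Longrightarrow> (\<integral>x. \<bar>G t x\<bar> \<partial>lborel) \<le> B * min 1 (t\<^sup>2)"
  shows "integrable lborel (\<lambda>x. \<integral>t. kern t * G t x \<partial>lborel)"
    and "(\<integral>x. (\<integral>t. kern t * G t x \<partial>lborel) \<partial>lborel) = (\<integral>t. kern t * (\<integral>x. G t x \<partial>lborel) \<partial>lborel)"
proof -
  have m: "(\<lambda>(t, x). kern t * G t x) \<in> borel_measurable (lborel \<Otimes>\<^sub>M lborel)" by measurable
  have i: "integrable lborel (\<lambda>x. kern t * G t x)" for t using int by simp
  have [measurable]: "(\<lambda>t. \<integral>x. \<bar>G t x\<bar> \<partial>lborel) \<in> borel_measurable borel" by measurable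
  have "integrable lborel (\<lambda>t. kern t * (\<integral>x. \<bar>G t x\<bar> \<partial>lborel))"
    using bound by (intro integrable_kern_times[where C=B]) auto
  then have o: "integrable lborel (\<lambda>t. \<integral>x. \<bar>kern t * G t x\<bar> \<partial>lborel)"
    by (simp add: abs_mult kern_nonneg)
  show "integrable lborel (\<lambda>x. \<integral>t. kern t * G t x \<partial>lborel)"
    using Fubini_lborel(2)[OF m i o] .
  show "(\<integral>x. (\<integral>t. kern t * G t x \<partial>lborel) \<partial>lborel) = (\<integral>t. kern t * (\<integral>x. G t x \<partial>lborel) \<partial>lborel)"
    using Fubini_lborel(3)[OF m i o] by simp
qed

lemma weak_form_Fubini:
  assumes u: "u \<in> borel_measurable borel" "\<And>x. \<bar>u x\<bar> \<le> U" and \<phi>: "C11_bump r \<phi>"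
  shows "integrable lborel (\<lambda>x. u x * frac_lap \<phi> x)"
    and "(\<integral>x. u x * frac_lap \<phi> x \<partial>lborel) = (\<integral>t. kern t * (\<integral>x. u x * second_diff2 \<phi> x t \<partial>lborel) \<partial>lborel)"
    and "integrable lborel (\<lambda>x. u x * second_diff2 \<phi> x t)"
proof -
  note u(1)[measurable]
  have U: "0 \<le> U" using u(2)[of 0] by linarith
  obtain C where cont: "continuous_on UNIV \<phi>" and supp: "\<And>x. r < norm x \<Longrightarrow> \<phi> x = 0"
    and C: "\<And>x t. 0 < t \<Longrightarrow> \<bar>second_diff2 \<phi> x t\<bar> \<le> C * t\<^sup>2"
    using \<phi> unfolding C11_bump_def by blast
  have C0: "0 \<le> C" using C[of 1 0] by simp
  have \<phi>_int: "integrable lborel \<phi>" using cont supp by (rule integrable_compact_support)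
  have [measurable]: "\<phi> \<in> borel_measurable borel" using cont by (rule borel_measurable_continuous_onI)
  obtain K where K: "0 \<le> K" "\<And>x. \<bar>\<phi> x\<bar> \<le> K" using bounded_compact_support[OF cont supp] by blast
  have sd_int: "integrable lborel (\<lambda>x. second_diff2 \<phi> x t)" for t
    unfolding second_diff2_def diff_conv_add_uminus
    using \<phi>_int by (intro Bochner_Integration.integrable_add integrable_mult_right integrable_minus integrable_lborel_translate) 
  show int: "integrable lborel (\<lambda>x. u x * second_diff2 \<phi> x t)" for t
    using sd_int u by (rule integrable_bounded_mult)
  define V where "V = measure lborel (cball (0::real^2) (r + 1))"
  define B where "B = U * (C * V) + U * (8 * (\<integral>x. \<bar>\<phi> x\<bar> \<partial>lborel)) / (min 1 1)\<^sup>2"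
  have bound: "(\<integral>x. \<bar>u x * second_diff2 \<phi> x t\<bar> \<partial>lborel) \<le> B * min 1 (t\<^sup>2)" if t: "0 < t" for t
    unfolding B_def
  proof (rule min_1_square_le[OF t zero_less_one])
    let ?I = "\<integral>x. \<bar>u x * second_diff2 \<phi> x t\<bar> \<partial>lborel"
    show "?I \<le> U * (C * V) * t\<^sup>2" if "t < 1"
    proof -
      have "?I \<le> (\<integral>x. indicator (cball (0::real^2) (r + 1)) x * (U * (C * t\<^sup>2)) \<partial>lborel)"
      proof (rule integral_mono)
        show "integrable lborel (\<lambda>x. indicator (cball (0::real^2) (r + 1)) x * (U * (C * t\<^sup>2)))"
          by (intro integrable_mult_left integrable_real_indicator) (use emeasure_bounded_finite[OF bounded_cball, of "0::real^2" "r + 1"] in auto)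
        fix x :: "real^2"
        show "\<bar>u x * second_diff2 \<phi> x t\<bar> \<le> indicator (cball 0 (r + 1)) x * (U * (C * t\<^sup>2))"
        proof (cases "norm x \<le> r + 1")
          case True
          then show ?thesis using u(2)[of x] C[OF t, of x] U by (simp add: abs_mult mult_mono)
        next
          case False
          have n: "r < norm (x + y)" if "norm y \<le> t" for y
            using norm_triangle_ineq4[of "x + y" y] False that \<open>t < 1\<close> by auto
          have "\<phi> x = 0" "\<phi> (x + t *\<^sub>R axis 1 1) = 0" "\<phi> (x + - (t *\<^sub>R axis 1 1)) = 0"
            "\<phi> (x + t *\<^sub>R axis 2 1) = 0" "\<phi> (x + - (t *\<^sub>R axis 2 1)) = 0"
            using False t n[of "- (t *\<^sub>R axis 1 1)"] n[of "- (t *\<^sub>R axis 2 1)"] by (auto intro!: supp n)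
          then show ?thesis using False by (simp add: second_diff2_def)
        qed
      qed (use int in auto)
      then show ?thesis by (simp add: V_def mult_ac)
    qed
    show "?I \<le> U * (8 * (\<integral>x. \<bar>\<phi> x\<bar> \<partial>lborel))"
    proof -
      let ?a = "\<lambda>h x. \<bar>\<phi> (x + h)\<bar>"
      have i: "integrable lborel (?a h)" and v: "(\<integral>x. ?a h x \<partial>lborel) = (\<integral>x. \<bar>\<phi> x\<bar> \<partial>lborel)" for h
        using integrable_lborel_translate[of "\<lambda>x. \<bar>\<phi> x\<bar>" h] \<phi>_int by auto
      have "?I \<le> (\<integral>x. U * (4 * ?a 0 x + ?a (t *\<^sub>R axis 1 1) x + ?a (- (t *\<^sub>R axis 1 1)) x
          + ?a (t *\<^sub>R axis 2 1) x + ?a (- (t *\<^sub>R axis 2 1)) x) \<partial>lborel)"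
      proof (rule integral_mono)
        fix x
        have "\<bar>second_diff2 \<phi> x t\<bar> \<le> 4 * ?a 0 x + ?a (t *\<^sub>R axis 1 1) x + ?a (- (t *\<^sub>R axis 1 1)) x
          + ?a (t *\<^sub>R axis 2 1) x + ?a (- (t *\<^sub>R axis 2 1)) x"
          unfolding second_diff2_def by simp
        then show "\<bar>u x * second_diff2 \<phi> x t\<bar> \<le> U * (4 * ?a 0 x + ?a (t *\<^sub>R axis 1 1) x + ?a (- (t *\<^sub>R axis 1 1)) x
          + ?a (t *\<^sub>R axis 2 1) x + ?a (- (t *\<^sub>R axis 2 1)) x)"
          unfolding abs_mult using u(2)[of x] U by (intro mult_mono) auto
      qed (rule integrable_abs[OF int], intro integrable_mult_right Bochner_Integration.integrable_add i)
      also have "\<dots> = U * (8 * (\<integral>x. \<bar>\<phi> x\<bar> \<partial>lborel))"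
        using i v by (simp del: add_uminus_conv_diff add_0_right)
      finally show ?thesis .
    qed
  qed (use U C0 in \<open>auto simp: V_def\<close>)
  have "case_prod (\<lambda>t x. u x * second_diff2 \<phi> x t) \<in> borel_measurable (lborel \<Otimes>\<^sub>M lborel)" by measurable
  note F = kern_Fubini[OF this int bound]
  have eq: "(\<integral>t. kern t * (u x * second_diff2 \<phi> x t) \<partial>lborel) = u x * frac_lap \<phi> x" for x
    by (simp add: frac_lap_def mult.left_commute[of "kern _"])
  show "integrable lborel (\<lambda>x. u x * frac_lap \<phi> x)" using F(1) by (simp only: eq)
  show "(\<integral>x. u x * frac_lap \<phi> x \<partial>lborel) = (\<integral>t. kern t * (\<integral>x. u x * second_diff2 \<phi> x t \<partial>lborel) \<partial>lborel)"
    using F(2) by (simp only: eq)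
qed

lemma second_diff2_symmetric:
  assumes u: "u \<in> borel_measurable borel" "\<And>x. \<bar>u x\<bar> \<le> U" and \<phi>: "integrable lborel \<phi>"
  shows "(\<integral>x. u x * second_diff2 \<phi> x t \<partial>lborel) = (\<integral>x. \<phi> x * second_diff2 u x t \<partial>lborel)"
    and "integrable lborel (\<lambda>x. \<phi> x * second_diff2 u x t)"
proof -
  note u(1)[measurable]
  have i1: "integrable lborel (\<lambda>x. u x * \<phi> (x + h))" for h
    using integrable_lborel_translate(1)[OF \<phi>] u by (rule integrable_bounded_mult)
  have i2: "integrable lborel (\<lambda>x. \<phi> x * u (x + h))" for h
  proof -
    have "(\<lambda>x. u (x + h)) \<in> borel_measurable borel" by measurable
    from integrable_bounded_mult[OF \<phi> this u(2)] show ?thesis by (simp add: mult.commute)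
  qed
  have e: "(\<integral>x. u x * \<phi> (x + h) \<partial>lborel) = (\<integral>x. \<phi> x * u (x + - h) \<partial>lborel)" for h
    using integrable_lborel_translate(2)[of "\<lambda>x. \<phi> x * u (x + - h)" h] by (simp add: mult.commute)
  let ?e1 = "t *\<^sub>R axis 1 1 :: real^2" and ?e2 = "t *\<^sub>R axis 2 1 :: real^2"
  have L: "u x * second_diff2 \<phi> x t = 4 * (u x * \<phi> (x + 0)) - u x * \<phi> (x + ?e1) - u x * \<phi> (x + - ?e1)
      - u x * \<phi> (x + ?e2) - u x * \<phi> (x + - ?e2)" for x
    by (simp add: second_diff2_def algebra_simps)
  have R: "\<phi> x * second_diff2 u x t = 4 * (\<phi> x * u (x + 0)) - \<phi> x * u (x + ?e1) - \<phi> x * u (x + - ?e1)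
      - \<phi> x * u (x + ?e2) - \<phi> x * u (x + - ?e2)" for x
    by (simp add: second_diff2_def algebra_simps)
  show "integrable lborel (\<lambda>x. \<phi> x * second_diff2 u x t)"
    unfolding R by (intro Bochner_Integration.integrable_diff integrable_mult_right i2)
  have "(\<integral>x. u x * second_diff2 \<phi> x t \<partial>lborel) = 4 * (\<integral>x. u x * \<phi> (x + 0) \<partial>lborel) - (\<integral>x. u x * \<phi> (x + ?e1) \<partial>lborel)
     - (\<integral>x. u x * \<phi> (x + - ?e1) \<partial>lborel) - (\<integral>x. u x * \<phi> (x + ?e2) \<partial>lborel) - (\<integral>x. u x * \<phi> (x + - ?e2) \<partial>lborel)"
    unfolding L using i1[of 0] i1[of ?e1] i1[of "- ?e1"] i1[of ?e2] i1[of "- ?e2"]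
    by (simp del: add_uminus_conv_diff add_0_right)
  also have "\<dots> = 4 * (\<integral>x. \<phi> x * u (x + 0) \<partial>lborel) - (\<integral>x. \<phi> x * u (x + ?e1) \<partial>lborel)
     - (\<integral>x. \<phi> x * u (x + - ?e1) \<partial>lborel) - (\<integral>x. \<phi> x * u (x + ?e2) \<partial>lborel) - (\<integral>x. \<phi> x * u (x + - ?e2) \<partial>lborel)"
    unfolding e by simp
  also have "\<dots> = (\<integral>x. \<phi> x * second_diff2 u x t \<partial>lborel)"
    unfolding R using i2[of 0] i2[of ?e1] i2[of "- ?e1"] i2[of ?e2] i2[of "- ?e2"]
    by (simp del: add_uminus_conv_diff add_0_right)
  finally show "(\<integral>x. u x * second_diff2 \<phi> x t \<partial>lborel) = (\<integral>x. \<phi> x * second_diff2 u x t \<partial>lborel)" .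
qed

text \<open>For each fixed t the differences are moved from \<phi> to u by translation invariance.
  The uniform bound on the support of \<phi> then permits Fubini on the side of u, which restores
  the pointwise equation under the integral.\<close>

lemma weak_form_classical:
  assumes u: "u \<in> borel_measurable borel" "\<And>x. \<bar>u x\<bar> \<le> U" and \<phi>: "C11_bump r \<phi>"
    and loc: "\<And>x t. norm x \<le> r \<Longrightarrow> 0 < t \<Longrightarrow> \<bar>second_diff2 u x t\<bar> \<le> K * min 1 (t\<^sup>2)"
    and sol: "\<And>x. norm x \<le> r \<Longrightarrow> solves_at u (F x) x"
  shows "(\<integral>x. u x * frac_lap \<phi> x \<partial>lborel) = (\<integral>x. \<phi> x * F x \<partial>lborel)"
    and "integrable lborel (\<lambda>x. \<phi> x * F x)"
proof -
  note u(1)[measurable]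
  have cont: "continuous_on UNIV \<phi>" and supp: "\<And>x. r < norm x \<Longrightarrow> \<phi> x = 0"
    using \<phi> unfolding C11_bump_def by blast+
  have \<phi>_int: "integrable lborel \<phi>" using cont supp by (rule integrable_compact_support)
  have [measurable]: "\<phi> \<in> borel_measurable borel" using cont by (rule borel_measurable_continuous_onI)
  note sym = second_diff2_symmetric[OF u \<phi>_int]
  have bound: "(\<integral>x. \<bar>\<phi> x * second_diff2 u x t\<bar> \<partial>lborel) \<le> K * (\<integral>x. \<bar>\<phi> x\<bar> \<partial>lborel) * min 1 (t\<^sup>2)" if t: "0 < t" for t
  proof -
    have "(\<integral>x. \<bar>\<phi> x * second_diff2 u x t\<bar> \<partial>lborel) \<le> (\<integral>x. \<bar>\<phi> x\<bar> * (K * min 1 (t\<^sup>2)) \<partial>lborel)"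
    proof (rule integral_mono)
      fix x
      show "\<bar>\<phi> x * second_diff2 u x t\<bar> \<le> \<bar>\<phi> x\<bar> * (K * min 1 (t\<^sup>2))"
        using loc[OF _ t, of x] supp[of x] by (cases "norm x \<le> r") (auto simp: abs_mult intro: mult_left_mono)
    qed (use sym(2) \<phi>_int in auto)
    then show ?thesis by (simp add: mult_ac)
  qed
  have "case_prod (\<lambda>t x. \<phi> x * second_diff2 u x t) \<in> borel_measurable (lborel \<Otimes>\<^sub>M lborel)" by measurable
  note F = kern_Fubini[OF this sym(2) bound]
  have eq: "(\<integral>t. kern t * (\<phi> x * second_diff2 u x t) \<partial>lborel) = \<phi> x * F x" for x
  proof (cases "norm x \<le> r")
    case True
    then show ?thesis using sol[OF True]
      by (simp add: mult.left_commute[of "kern _"] solves_at_def has_bochner_integral_iff)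
  qed (simp add: supp)
  show "integrable lborel (\<lambda>x. \<phi> x * F x)" using F(1) by (simp only: eq)
  have "(\<integral>x. u x * frac_lap \<phi> x \<partial>lborel) = (\<integral>t. kern t * (\<integral>x. u x * second_diff2 \<phi> x t \<partial>lborel) \<partial>lborel)"
    by (rule weak_form_Fubini(2)[OF u \<phi>])
  also have "\<dots> = (\<integral>t. kern t * (\<integral>x. \<phi> x * second_diff2 u x t \<partial>lborel) \<partial>lborel)"
    by (simp only: sym(1))
  also have "\<dots> = (\<integral>x. \<phi> x * F x \<partial>lborel)" using F(2) by (simp only: eq)
  finally show "(\<integral>x. u x * frac_lap \<phi> x \<partial>lborel) = (\<integral>x. \<phi> x * F x \<partial>lborel)" .
qed

lemma disc_weight_bounded:
  assumes "poly_deg n p"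
  obtains K where "0 \<le> K" "\<And>x. \<bar>disc_weight s p x\<bar> \<le> K"
proof (rule bounded_compact_support[of "disc_weight s p" 1])
  show "continuous_on UNIV (disc_weight s p)" using assms s_pos by (rule continuous_on_disc_weight)
  show "disc_weight s p x = 0" if "1 < norm x" for x using that by (intro disc_weight_outside) simp
qed (use that in blast)

text \<open>For |x| \<le> r and t < \<delta> the points involved stay in the ball of radius r +
  \<delta> < 1, away from the singularity at the circle; larger steps are covered by the sup
  bound.\<close>

lemma disc_weight_interior_C11:
  assumes p: "poly_deg n p" and r: "0 \<le> r" "r < 1"
  shows "\<exists>K. \<forall>x t. norm x \<le> r \<longrightarrow> 0 < t \<longrightarrow> \<bar>second_diff2 (disc_weight s p) x t\<bar> \<le> K * min 1 (t\<^sup>2)"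
  using p
proof (induction rule: poly_deg.induct)
  case (add n f g)
  then obtain K1 K2 where
    "\<forall>x t. norm x \<le> r \<longrightarrow> 0 < t \<longrightarrow> \<bar>second_diff2 (disc_weight s f) x t\<bar> \<le> K1 * min 1 (t\<^sup>2)"
    "\<forall>x t. norm x \<le> r \<longrightarrow> 0 < t \<longrightarrow> \<bar>second_diff2 (disc_weight s g) x t\<bar> \<le> K2 * min 1 (t\<^sup>2)" by blast
  moreover have "disc_weight s (\<lambda>a b. f a b + g a b) = (\<lambda>x. disc_weight s f x + disc_weight s g x)"
    by (simp add: disc_weight_add fun_eq_iff)
  ultimately show ?case
    by (intro exI[of _ "K1 + K2"]) (auto simp: second_diff2_add distrib_right intro!: order_trans[OF abs_triangle_ineq] add_mono)
next
  case (monom i j n c)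
  let ?w = "disc_weight s (\<lambda>a b. c * a ^ i * b ^ j)"
  define \<delta> where "\<delta> = (1 - r) / 2"
  define \<eta> where "\<eta> = 1 - (r + \<delta>)\<^sup>2"
  have \<delta>: "0 < \<delta>" "r + \<delta> < 1" using r by (auto simp: \<delta>_def field_simps)
  have "(r + \<delta>)\<^sup>2 < 1" using r \<delta> by (intro power_strict_mono[of _ 1 2, simplified]) auto
  then have \<eta>: "0 < \<eta>" by (simp add: \<eta>_def)
  define A where "A k = 2 * ((real k + 6)\<^sup>2 * \<eta> powr (-3))" for k
  have A: "0 \<le> A k" for k by (simp add: A_def)
  obtain K where K: "0 \<le> K" "\<And>x. \<bar>?w x\<bar> \<le> K"
    using disc_weight_bounded[OF poly_deg.monom[OF monom]] by blast
  have "\<bar>second_diff2 ?w x t\<bar> \<le> (\<bar>c\<bar> * (A i + A j) + 8 * K / (min 1 \<delta>)\<^sup>2) * min 1 (t\<^sup>2)"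
    if x: "norm x \<le> r" and t: "0 < t" for x t
  proof (rule min_1_square_le[OF t \<delta>(1)])
    show "\<bar>second_diff2 ?w x t\<bar> \<le> 8 * K" by (rule second_diff2_le_sup) (rule K)
    show "\<bar>second_diff2 ?w x t\<bar> \<le> \<bar>c\<bar> * (A i + A j) * t\<^sup>2" if "t < \<delta>"
    proof -
      have gap: "\<eta> \<le> 1 - (norm (x + y))\<^sup>2" if "norm y \<le> t" for y
      proof -
        have "norm (x + y) \<le> r + \<delta>" using norm_triangle_ineq[of x y] x that \<open>t < \<delta>\<close> by linarith
        then show ?thesis by (simp add: \<eta>_def power_mono)
      qed
      have g1: "\<eta> \<le> 1 - (x $ 2)\<^sup>2 - (x $ 1 - t)\<^sup>2" "\<eta> \<le> 1 - (x $ 2)\<^sup>2 - (x $ 1 + t)\<^sup>2"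
        using gap[of "- (t *\<^sub>R axis 1 1)"] gap[of "t *\<^sub>R axis 1 1"] t by (auto simp: norm_sq_2)
      have g2: "\<eta> \<le> 1 - (x $ 1)\<^sup>2 - (x $ 2 - t)\<^sup>2" "\<eta> \<le> 1 - (x $ 1)\<^sup>2 - (x $ 2 + t)\<^sup>2"
        using gap[of "- (t *\<^sub>R axis 2 1)"] gap[of "t *\<^sub>R axis 2 1"] t by (auto simp: norm_sq_2)
      have "\<eta> \<le> 1 - ((x $ 1)\<^sup>2 + (x $ 2)\<^sup>2)" using gap[of 0] t by (simp add: norm_sq_2)
      then have x1: "(x $ 1)\<^sup>2 \<le> 1" "(x $ 2)\<^sup>2 \<le> 1"
        using \<eta> zero_le_power2[of "x $ 1"] zero_le_power2[of "x $ 2"] by linarith+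
      then have x1': "\<bar>x $ 1\<bar> \<le> 1" "\<bar>x $ 2\<bar> \<le> 1" by (auto simp: abs_square_le_1)
      have pw: "\<bar>c * (x $ k) ^ l\<bar> \<le> \<bar>c\<bar>" for k l
      proof -
        have "\<bar>x $ k\<bar> \<le> 1" using x1' exhaust_2[of k] by auto
        then show ?thesis by (simp add: abs_mult power_abs power_le_one mult_left_le)
      qed
      have "\<bar>second_diff (pow_weight (1 - (x $ 2)\<^sup>2) s i) (x $ 1) t\<bar> \<le> A i * t\<^sup>2"
        unfolding A_def using s_pos s_less_1 by (intro pow_weight_second_diff_bound(1) \<eta> t g1) auto
      moreover have "\<bar>second_diff (pow_weight (1 - (x $ 1)\<^sup>2) s j) (x $ 2) t\<bar> \<le> A j * t\<^sup>2"
        unfolding A_def using s_pos s_less_1 by (intro pow_weight_second_diff_bound(1) \<eta> t g2) auto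
      ultimately have "\<bar>second_diff2 ?w x t\<bar> \<le> \<bar>c\<bar> * (A i * t\<^sup>2) + \<bar>c\<bar> * (A j * t\<^sup>2)"
        unfolding second_diff2_disc_weight_monom
        by (intro order_trans[OF abs_triangle_ineq] add_mono)
          (simp only: abs_mult[of "c * _ ^ _"], intro mult_mono pw; simp)+
      then show ?thesis by (simp add: algebra_simps)
    qed
  qed (use K A in auto)
  then show ?case by blast
qed

end

section \<open>Smooth test functions and the principal value\<close>

lemma differentiable_partial_deriv:
  assumes "f differentiable (at (x + t *\<^sub>R axis i 1))"
  shows "((\<lambda>t. f (x + t *\<^sub>R axis i 1)) has_real_derivative partial_deriv i f (x + t *\<^sub>R axis i 1)) (at t)"
proof -
  let ?y = "x + t *\<^sub>R axis i 1" and ?D = "frechet_derivative f (at (x + t *\<^sub>R axis i 1))"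
  have D: "(f has_derivative ?D) (at ?y)" using assms by (simp add: frechet_derivative_works)
  have "((\<lambda>t. x + t *\<^sub>R axis i 1) has_derivative (\<lambda>h. h *\<^sub>R axis i 1)) (at t)"
    by (auto intro!: derivative_eq_intros)
  from has_derivative_compose[OF this D]
  have "((\<lambda>t. f (x + t *\<^sub>R axis i 1)) has_derivative (\<lambda>h. ?D (h *\<^sub>R axis i 1))) (at t)" .
  moreover have "?D (h *\<^sub>R axis i 1) = partial_deriv i f ?y * h" for h
    using linear_scale[OF has_derivative_linear[OF D], of h "axis i 1"] by (simp add: partial_deriv_def mult.commute)
  ultimately show ?thesis by (simp add: has_field_derivative_def)
qed

lemma partial_deriv_zero_on_open:
  fixes f :: "real^'n::finite \<Rightarrow> real"
  assumes "open S" "\<And>x. x \<in> S \<Longrightarrow> f x = 0" "x \<in> S"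
  shows "partial_deriv i f x = 0"
proof -
  have "((\<lambda>_. 0) has_derivative (\<lambda>_. 0)) (at x)" by simp
  then have "(f has_derivative (\<lambda>_. 0)) (at x)"
    by (rule has_derivative_transform_within_open[OF _ assms(1,3)]) (use assms(2) in simp)
  then have "frechet_derivative f (at x) = (\<lambda>_. 0)" by (rule frechet_derivative_at[symmetric])
  then show ?thesis by (simp add: partial_deriv_def)
qed

text \<open>A compact subset of the open disc has a largest norm, which gives r < 1. The bound along
  each single axis is recorded as well, because the fractional Laplacian is defined one axis at a
  time while \<open>C11_bump\<close> sees only the sum.\<close>

lemma test_function_C11_bump:
  fixes \<phi> :: "real^2 \<Rightarrow> real"
  assumes "\<phi> \<in> test_functions (ball 0 1)"
  obtains r where "0 \<le> r" "r < 1" "C11_bump r \<phi>"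
    "\<And>i. \<exists>C. \<forall>x t. 0 < t \<longrightarrow> \<bar>second_diff (\<lambda>t. \<phi> (x + t *\<^sub>R axis i 1)) 0 t\<bar> \<le> C * t\<^sup>2"
proof -
  define K where "K = closure {x. \<phi> x \<noteq> 0}"
  have Ck: "\<And>k. Ck_on k UNIV \<phi>" and K: "compact K" "K \<subseteq> ball 0 1"
    using assms by (auto simp: test_functions_def K_def)
  have off: "\<phi> x = 0" if "x \<in> - K" for x
    using that closure_subset[of "{x. \<phi> x \<noteq> 0}"] by (auto simp: K_def)
  have op: "open (- K)" using K(1) by (simp add: compact_imp_closed open_Compl)
  obtain r where r: "0 \<le> r" "r < 1" "\<And>x. x \<in> K \<Longrightarrow> norm x \<le> r"
  proof (cases "K = {}")
    case True
    then show thesis using that[of 0] by simp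
  next
    case False
    obtain m where "m \<in> K" "\<And>x. x \<in> K \<Longrightarrow> norm x \<le> norm m"
      using continuous_attains_sup[OF K(1) False, of norm] by (auto intro: continuous_intros)
    then show thesis using that[of "norm m"] K(2) by auto
  qed
  have supp: "\<phi> x = 0" if "r < norm x" for x
    using off[of x] r(3)[of x] that by force
  have cont: "continuous_on UNIV \<phi>" using Ck[of 0] by (auto simp: Ck_on_def)
  have d0: "\<phi> differentiable (at x)" for x using Ck[of 1] unfolding Ck_on_def by (metis UNIV_I iter_partial.simps(1) less_one list.size(3))
  have d1: "partial_deriv i \<phi> differentiable (at x)" for i x
  proof -
    have "length [i] < 2 \<longrightarrow> (\<forall>x\<in>UNIV. iter_partial [i] \<phi> differentiable (at x))"
      using Ck[of 2] unfolding Ck_on_def by blast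
    then show ?thesis by simp
  qed
  have c2: "continuous_on UNIV (partial_deriv i (partial_deriv i \<phi>))" for i
  proof -
    have "length [i, i] \<le> 2 \<longrightarrow> continuous_on UNIV (iter_partial [i, i] \<phi>)"
      using Ck[of 2] unfolding Ck_on_def by blast
    then show ?thesis by simp
  qed
  have z2: "partial_deriv i (partial_deriv i \<phi>) x = 0" if "r < norm x" for i x
  proof -
    have "x \<in> - K" using that r(3)[of x] by force
    then show ?thesis by (intro partial_deriv_zero_on_open[OF op] off)
  qed
  have dir: "\<exists>C. \<forall>x t. 0 < t \<longrightarrow> \<bar>second_diff (\<lambda>t. \<phi> (x + t *\<^sub>R axis i 1)) 0 t\<bar> \<le> C * t\<^sup>2" for i
  proof -
    obtain M where M: "0 \<le> M" "\<And>x. \<bar>partial_deriv i (partial_deriv i \<phi>) x\<bar> \<le> M"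
      using bounded_compact_support[OF c2 z2] by blast
    have "\<bar>second_diff (\<lambda>t. \<phi> (x + t *\<^sub>R axis i 1)) 0 t\<bar> \<le> 2 * M * t\<^sup>2" if "0 < t" for x t
      by (rule second_diff_le_deriv2[OF that differentiable_partial_deriv[OF d0] differentiable_partial_deriv[OF d1] M(2)])
    then show ?thesis by blast
  qed
  obtain C1 where C1: "\<And>x t. 0 < t \<Longrightarrow> \<bar>second_diff (\<lambda>t. \<phi> (x + t *\<^sub>R axis 1 1)) 0 t\<bar> \<le> C1 * t\<^sup>2" using dir[of 1] by blast
  obtain C2 where C2: "\<And>x t. 0 < t \<Longrightarrow> \<bar>second_diff (\<lambda>t. \<phi> (x + t *\<^sub>R axis 2 1)) 0 t\<bar> \<le> C2 * t\<^sup>2" using dir[of 2] by blast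
  have "\<bar>second_diff2 \<phi> x t\<bar> \<le> (C1 + C2) * t\<^sup>2" if "0 < t" for x t
    using C1[OF that, of x] C2[OF that, of x] unfolding second_diff2_def second_diff_def distrib_right
    by (simp add: abs_le_iff)
  then have "C11_bump r \<phi>" unfolding C11_bump_def using cont supp by blast
  then show thesis using that r(1,2) dir by blast
qed

context fractional_order
begin

text \<open>Reflecting the negative half of the truncated integral folds it into a second difference
  on t > \<delta>. That integrand is absolutely integrable on the half-line, so dominated
  convergence gives the limit, and \<open>Lim\<close> equals it by uniqueness.\<close>

lemma frac_laplacian_1d_eq:
  fixes \<phi> :: "real^2 \<Rightarrow> real"
  assumes cont: "continuous_on UNIV \<phi>" and K: "\<And>x. \<bar>\<phi> x\<bar> \<le> K"
    and C: "\<And>t. 0 < t \<Longrightarrow> \<bar>second_diff (\<lambda>t. \<phi> (x + t *\<^sub>R axis i 1)) 0 t\<bar> \<le> C * t\<^sup>2"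
  shows "frac_laplacian_1d s i \<phi> x = frac_const s * (\<integral>t. kern t * second_diff (\<lambda>t. \<phi> (x + t *\<^sub>R axis i 1)) 0 t \<partial>lborel)"
    and "integrable lborel (\<lambda>t. kern t * second_diff (\<lambda>t. \<phi> (x + t *\<^sub>R axis i 1)) 0 t)"
proof -
  define f where "f t = \<phi> (x + t *\<^sub>R axis i 1)" for t
  have "continuous_on UNIV f" unfolding f_def
    by (intro continuous_on_compose2[OF cont] continuous_intros) auto
  then have f_meas[measurable]: "f \<in> borel_measurable borel" by (rule borel_measurable_continuous_onI)
  have fK: "\<bar>f t\<bar> \<le> K" for t unfolding f_def by (rule K)
  have K0: "0 \<le> K" using fK[of 0] by linarith
  have fC: "\<bar>second_diff f 0 t\<bar> \<le> \<bar>C\<bar> * t\<^sup>2" if "0 < t" for t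
  proof -
    have "\<bar>second_diff f 0 t\<bar> \<le> C * t\<^sup>2" using C[OF that] unfolding f_def[abs_def] .
    also have "\<dots> \<le> \<bar>C\<bar> * t\<^sup>2" by (intro mult_right_mono) auto
    finally show ?thesis .
  qed
  define B where "B = \<bar>C\<bar> + 4 * K / (min 1 1)\<^sup>2"
  have sd_bound: "\<bar>second_diff f 0 t\<bar> \<le> B * min 1 (t\<^sup>2)" if "0 < t" for t
    unfolding B_def
  proof (rule min_1_square_le[OF that zero_less_one])
    show "\<bar>second_diff f 0 t\<bar> \<le> 4 * K"
      using fK[of 0] fK[of "0 + t"] fK[of "0 - t"] unfolding second_diff_def by linarith
  qed (use fC that K0 in auto)
  have sd_meas[measurable]: "(\<lambda>t. second_diff f 0 t) \<in> borel_measurable borel" by measurable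
  have int: "integrable lborel (\<lambda>t. kern t * second_diff f 0 t)"
    using sd_bound by (intro integrable_kern_times[where C=B]) auto
  then show "integrable lborel (\<lambda>t. kern t * second_diff (\<lambda>t. \<phi> (x + t *\<^sub>R axis i 1)) 0 t)"
    by (simp add: f_def[abs_def])
  have trunc: "(LINT t:{t. \<delta> < \<bar>t\<bar>}|lborel. (\<phi> x - \<phi> (x + t *\<^sub>R axis i 1)) / \<bar>t\<bar> powr (1 + 2 * s))
      = (\<integral>t. indicator {\<delta><..} t * (kern t * second_diff f 0 t) \<partial>lborel)" if \<delta>: "0 < \<delta>" for \<delta>
  proof -
    define h where "h t = indicator {\<delta><..} t * (kern t * (f 0 - f t))" for t
    define h' where "h' t = indicator {\<delta><..} t * (kern t * (f 0 - f (-t)))" for t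
    have tail: "integrable lborel (\<lambda>t. 2 * K * (indicator {\<delta>..} t * kern t))"
      using kern_tail[OF \<delta>] by (auto simp: has_bochner_integral_iff)
    have d: "\<bar>f 0 - f t\<bar> \<le> 2 * K" for t using fK[of 0] fK[of t] by linarith
    have le: "\<bar>indicator {\<delta><..} t * (kern t * (f 0 - f u))\<bar> \<le> 2 * K * (indicator {\<delta>..} t * kern t)" for t u
      using kern_nonneg[of t] K0 mult_left_mono[OF d[of u] kern_nonneg[of t]]
      by (simp add: indicator_def abs_mult mult.commute)
    have h: "integrable lborel h" unfolding h_def by (rule integrable_lborel_bound[OF tail _ le]) measurable
    have h': "integrable lborel h'" unfolding h'_def by (rule integrable_lborel_bound[OF tail _ le]) measurable
    have inv: "1 / \<bar>t\<bar> powr (1 + 2 * s) = \<bar>t\<bar> powr (-1 - 2 * s)" for t :: real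
      using powr_minus_divide[of "\<bar>t\<bar>" "1 + 2 * s"] by (simp add: algebra_simps)
    have "(LINT t:{t. \<delta> < \<bar>t\<bar>}|lborel. (\<phi> x - \<phi> (x + t *\<^sub>R axis i 1)) / \<bar>t\<bar> powr (1 + 2 * s))
      = (\<integral>t. h t + h' (0 - t) \<partial>lborel)"
      unfolding set_lebesgue_integral_def
    proof (rule Bochner_Integration.integral_cong[OF refl])
      fix t
      have "(\<phi> x - \<phi> (x + t *\<^sub>R axis i 1)) / \<bar>t\<bar> powr (1 + 2 * s) = (f 0 - f t) * \<bar>t\<bar> powr (-1 - 2 * s)"
        unfolding inv[symmetric] by (simp add: f_def)
      then show "indicator {t. \<delta> < \<bar>t\<bar>} t *\<^sub>R ((\<phi> x - \<phi> (x + t *\<^sub>R axis i 1)) / \<bar>t\<bar> powr (1 + 2 * s)) = h t + h' (0 - t)"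
        using \<delta> by (auto simp: h_def h'_def indicator_def kern_def abs_if)
    qed
    also have "\<dots> = (\<integral>t. h t \<partial>lborel) + (\<integral>t. h' t \<partial>lborel)"
      using h h' integrable_lborel_reflect[of h' 0] by simp
    also have "\<dots> = (\<integral>t. h t + h' t \<partial>lborel)" using h h' by simp
    also have "\<dots> = (\<integral>t. indicator {\<delta><..} t * (kern t * second_diff f 0 t) \<partial>lborel)"
      by (intro Bochner_Integration.integral_cong) (simp_all add: h_def h'_def second_diff_def algebra_simps)
    finally show ?thesis .
  qed
  have lim: "((\<lambda>\<delta>. \<integral>t. indicator {\<delta><..} t * (kern t * second_diff f 0 t) \<partial>lborel)
      \<longlongrightarrow> (\<integral>t. kern t * second_diff f 0 t \<partial>lborel)) (at_right 0)"
    unfolding tendsto_at_iff_sequentially comp_def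
  proof (intro allI impI)
    fix X :: "nat \<Rightarrow> real" assume X: "\<forall>n. X n \<in> {0<..} - {0}" "X \<longlonglongrightarrow> 0"
    show "(\<lambda>n. \<integral>t. indicator {X n<..} t * (kern t * second_diff f 0 t) \<partial>lborel) \<longlonglongrightarrow> (\<integral>t. kern t * second_diff f 0 t \<partial>lborel)"
    proof (rule integral_dominated_convergence[where w="\<lambda>t. \<bar>kern t * second_diff f 0 t\<bar>"])
      show "integrable lborel (\<lambda>t. \<bar>kern t * second_diff f 0 t\<bar>)" using int by simp
      show "AE t in lborel. (\<lambda>n. indicator {X n<..} t * (kern t * second_diff f 0 t)) \<longlonglongrightarrow> kern t * second_diff f 0 t"
      proof (rule AE_I2)
        fix t :: real
        show "(\<lambda>n. indicator {X n<..} t * (kern t * second_diff f 0 t)) \<longlonglongrightarrow> kern t * second_diff f 0 t"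
        proof (cases "0 < t")
          case True
          have "eventually (\<lambda>n. X n < t) sequentially" using order_tendstoD(2)[OF X(2) True] .
          then have "eventually (\<lambda>n. indicator {X n<..} t * (kern t * second_diff f 0 t) = kern t * second_diff f 0 t) sequentially"
            by eventually_elim simp
          then show ?thesis by (rule tendsto_eventually)
        qed (simp add: kern_zero)
      qed
    qed (auto simp: indicator_def)
  qed
  have "((\<lambda>\<delta>. LINT t:{t. \<delta> < \<bar>t\<bar>}|lborel. (\<phi> x - \<phi> (x + t *\<^sub>R axis i 1)) / \<bar>t\<bar> powr (1 + 2 * s))
      \<longlongrightarrow> (\<integral>t. kern t * second_diff f 0 t \<partial>lborel)) (at_right 0)"
    by (rule Lim_transform_eventually[OF lim])
      (use trunc in \<open>auto simp: eventually_at_right_field intro!: exI[of _ 1]\<close>)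
  from tendsto_Lim[OF trivial_limit_at_right_real this]
  show "frac_laplacian_1d s i \<phi> x = frac_const s * (\<integral>t. kern t * second_diff (\<lambda>t. \<phi> (x + t *\<^sub>R axis i 1)) 0 t \<partial>lborel)"
    by (simp add: frac_laplacian_1d_def f_def[abs_def])
qed

lemma L_op_test_function:
  assumes "\<phi> \<in> test_functions (ball 0 1)"
  shows "L_op s \<phi> x = - frac_const s * frac_lap \<phi> x"
proof -
  obtain r where r: "C11_bump r \<phi>"
    and dir: "\<And>i. \<exists>C. \<forall>x t. 0 < t \<longrightarrow> \<bar>second_diff (\<lambda>t. \<phi> (x + t *\<^sub>R axis i 1)) 0 t\<bar> \<le> C * t\<^sup>2"
    using test_function_C11_bump[OF assms] by metis
  have cont: "continuous_on UNIV \<phi>" and supp: "\<And>x. r < norm x \<Longrightarrow> \<phi> x = 0" using r by (auto simp: C11_bump_def)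
  obtain K where K: "\<And>x. \<bar>\<phi> x\<bar> \<le> K" using bounded_compact_support[OF cont supp] by blast
  obtain C1 where C1: "\<And>x t. 0 < t \<Longrightarrow> \<bar>second_diff (\<lambda>t. \<phi> (x + t *\<^sub>R axis 1 1)) 0 t\<bar> \<le> C1 * t\<^sup>2" using dir[of 1] by blast
  obtain C2 where C2: "\<And>x t. 0 < t \<Longrightarrow> \<bar>second_diff (\<lambda>t. \<phi> (x + t *\<^sub>R axis 2 1)) 0 t\<bar> \<le> C2 * t\<^sup>2" using dir[of 2] by blast
  note f1 = frac_laplacian_1d_eq[OF cont K C1] and f2 = frac_laplacian_1d_eq[OF cont K C2]
  have "frac_lap \<phi> x = (\<integral>t. kern t * second_diff (\<lambda>t. \<phi> (x + t *\<^sub>R axis 1 1)) 0 t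
      + kern t * second_diff (\<lambda>t. \<phi> (x + t *\<^sub>R axis 2 1)) 0 t \<partial>lborel)"
    unfolding frac_lap_def
    by (intro Bochner_Integration.integral_cong) (simp_all add: second_diff2_def second_diff_def algebra_simps)
  also have "\<dots> = (\<integral>t. kern t * second_diff (\<lambda>t. \<phi> (x + t *\<^sub>R axis 1 1)) 0 t \<partial>lborel)
      + (\<integral>t. kern t * second_diff (\<lambda>t. \<phi> (x + t *\<^sub>R axis 2 1)) 0 t \<partial>lborel)"
    using f1(2) f2(2) by (rule Bochner_Integration.integral_add)
  finally show ?thesis unfolding L_op_def using f1(1)[of x] f2(1)[of x] by (simp add: algebra_simps)
qed

end

section \<open>The Dirichlet problem and increments of its solution\<close>

lemma real_polynomial_function_poly_deg:
  fixes f :: "real^2 \<Rightarrow> real"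
  assumes "real_polynomial_function f"
  shows "\<exists>n p. poly_deg n p \<and> f = (\<lambda>x. p (x $ 1) (x $ 2))"
  using assms
proof (induction rule: real_polynomial_function.induct)
  case (linear f)
  then interpret bounded_linear f .
  have "f x = f (axis 1 1) * (x $ 1) ^ 1 * (x $ 2) ^ 0 + f (axis 2 1) * (x $ 1) ^ 0 * (x $ 2) ^ 1" for x
  proof -
    have "x = (x $ 1) *\<^sub>R axis 1 1 + (x $ 2) *\<^sub>R axis 2 1"
      by (simp add: vec_eq_iff forall_2)
    then have "f x = f ((x $ 1) *\<^sub>R axis 1 1 + (x $ 2) *\<^sub>R axis 2 1)" by (rule arg_cong)
    then show ?thesis by (simp add: add scaleR)
  qed
  moreover have "poly_deg 1 (\<lambda>a b. f (axis 1 1) * a ^ 1 * b ^ 0 + f (axis 2 1) * a ^ 0 * b ^ 1)"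
    by (intro poly_deg.intros) auto
  ultimately show ?case by (intro exI[of _ 1] exI conjI ext) assumption
next
  case (const c)
  show ?case using poly_deg_const[of 0 c] by blast
next
  case (add f g)
  then obtain n p m q where "poly_deg n p" "f = (\<lambda>x. p (x $ 1) (x $ 2))" "poly_deg m q" "g = (\<lambda>x. q (x $ 1) (x $ 2))"
    by blast
  moreover from this have "poly_deg (max n m) (\<lambda>a b. p a b + q a b)"
    by (intro poly_deg.add) (auto elim: poly_deg_mono)
  ultimately show ?case by (intro exI[of _ "max n m"] exI[of _ "\<lambda>a b. p a b + q a b"]) simp
next
  case (mult f g)
  then obtain n p m q where "poly_deg n p" "f = (\<lambda>x. p (x $ 1) (x $ 2))" "poly_deg m q" "g = (\<lambda>x. q (x $ 1) (x $ 2))"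
    by blast
  then show ?case
    by (intro exI[of _ "n + m"] exI[of _ "\<lambda>a b. p a b * q a b"]) (simp add: poly_deg_mult)
qed

lemma le_by_linear_epsilon:
  fixes x y C :: real
  assumes "\<And>e. 0 < e \<Longrightarrow> x \<le> y + C * e"
  shows "x \<le> y"
proof (rule field_le_epsilon)
  fix e :: real assume e: "0 < e"
  have "x \<le> y + C * (e / (\<bar>C\<bar> + 1))" using e by (intro assms) simp
  also have "C * (e / (\<bar>C\<bar> + 1)) \<le> (\<bar>C\<bar> + 1) * (e / (\<bar>C\<bar> + 1))"
    using e by (intro mult_right_mono) auto
  also have "\<dots> = e" using abs_ge_zero[of C] by (simp add: add_nonneg_eq_0_iff)
  finally show "x \<le> y + e" by simp
qed

lemma disc_weight_diff: "disc_weight q (\<lambda>a b. f a b - g a b) x = disc_weight q f x - disc_weight q g x"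
  by (simp add: disc_weight_def right_diff_distrib)

context fractional_order
begin

text \<open>The right-hand side is only Hoelder continuous, so the solution is not known to be
  regular enough for \<open>solves_at\<close>. It is encoded as a uniform limit of exact solutions
  with polynomial weights; estimates are made for those and survive the limit.\<close>

definition dirichlet_solution :: "(real^2 \<Rightarrow> real) \<Rightarrow> (real^2 \<Rightarrow> real) \<Rightarrow> bool" where
  "dirichlet_solution F w \<longleftrightarrow> (\<forall>e>0. \<exists>n p G. poly_deg n p \<and>
     (\<forall>x\<in>ball 0 1. solves_at (disc_weight s p) (G x) x \<and> \<bar>G x - F x\<bar> \<le> e) \<and>
     (\<forall>x. \<bar>disc_weight s p x - w x\<bar> \<le> e))"

lemma dirichlet_solutionE:
  assumes "dirichlet_solution F w" "0 < e"
  obtains n p G where "poly_deg n p" "\<And>x. x \<in> ball 0 1 \<Longrightarrow> solves_at (disc_weight s p) (G x) x"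
    "\<And>x. x \<in> ball 0 1 \<Longrightarrow> \<bar>G x - F x\<bar> \<le> e" "\<And>x. \<bar>disc_weight s p x - w x\<bar> \<le> e"
  using assms unfolding dirichlet_solution_def by blast

text \<open>The sup bound applied to differences of approximants turns uniform convergence of the
  right-hand sides into a uniform Cauchy property of the solutions.\<close>

lemma dirichlet_solution_exists:
  assumes F: "continuous_on (cball 0 1) F"
  shows "\<exists>w. dirichlet_solution F w"
proof -
  have "\<exists>n p G. poly_deg n p \<and> (\<forall>x\<in>ball 0 1. solves_at (disc_weight s p) (G x) x \<and> \<bar>G x - F x\<bar> \<le> 1 / real (Suc k))" for k
  proof -
    have pos: "0 < 1 / real (Suc k)" by simp
    obtain g where g: "real_polynomial_function g" "\<And>x. x \<in> cball 0 1 \<Longrightarrow> \<bar>F x - g x\<bar> < 1 / real (Suc k)"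
      using Stone_Weierstrass_real_polynomial_function[OF compact_cball F pos] by blast
    obtain n q where q: "poly_deg n q" "g = (\<lambda>x. q (x $ 1) (x $ 2))"
      using real_polynomial_function_poly_deg[OF g(1)] by blast
    obtain p where p: "poly_deg n p" "\<forall>x\<in>ball 0 1. solves_at (disc_weight s p) (q (x $ 1) (x $ 2)) x"
      using disc_weight_solve_polynomial[OF q(1)] by blast
    have "\<bar>g x - F x\<bar> \<le> 1 / real (Suc k)" if "x \<in> ball 0 1" for x
      using g(2)[of x] that by (simp add: abs_minus_commute less_imp_le)
    then show ?thesis using p q(2) by (intro exI[of _ n] exI[of _ p] exI[of _ g]) simp
  qed
  then obtain N p G where *: "\<And>k. poly_deg (N k) (p k) \<and> (\<forall>x\<in>ball 0 1. solves_at (disc_weight s (p k)) (G k x) x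
      \<and> \<bar>G k x - F x\<bar> \<le> 1 / real (Suc k))"
    by metis
  have pG: "poly_deg (N k) (p k)" "x \<in> ball 0 1 \<Longrightarrow> solves_at (disc_weight s (p k)) (G k x) x"
    "x \<in> ball 0 1 \<Longrightarrow> \<bar>G k x - F x\<bar> \<le> 1 / real (Suc k)" for k x
    using * by blast+
  let ?w = "\<lambda>k. disc_weight s (p k)"
  have diff: "\<bar>?w k x - ?w l x\<bar> \<le> (1 / real (Suc k) + 1 / real (Suc l)) / torsion_const" for k l x
  proof -
    have eq: "disc_weight s (\<lambda>a b. p k a b - p l a b) = (\<lambda>x. ?w k x - ?w l x)"
      by (simp add: disc_weight_diff fun_eq_iff)
    have deg: "poly_deg (max (N k) (N l)) (\<lambda>a b. p k a b - p l a b)"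
      using pG(1)[of k] pG(1)[of l] by (intro poly_deg_diff) (auto elim: poly_deg_mono)
    have "\<bar>?w k x - ?w l x\<bar> \<le> (1 / real (Suc k) + 1 / real (Suc l)) / torsion_const * torsion x"
      unfolding disc_weight_diff[symmetric]
    proof (rule disc_weight_sup_bound[OF deg, where F="\<lambda>x. G k x - G l x"])
      fix x :: "real^2" assume x: "x \<in> ball 0 1"
      show "solves_at (disc_weight s (\<lambda>a b. p k a b - p l a b)) (G k x - G l x) x"
        unfolding eq by (intro solves_at_diff pG x)
      show "\<bar>G k x - G l x\<bar> \<le> 1 / real (Suc k) + 1 / real (Suc l)"
        using pG(3)[OF x, of k] pG(3)[OF x, of l] by linarith
    qed
    also have "\<dots> \<le> (1 / real (Suc k) + 1 / real (Suc l)) / torsion_const"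
      using torsion_const(1) torsion_nonneg[of x] torsion_le_1[of x] by (intro mult_left_le) auto
    finally show ?thesis .
  qed
  have lim0: "(\<lambda>k. (1 / real (Suc k) + 1 / real (Suc k)) / torsion_const) \<longlonglongrightarrow> (0 + 0) / torsion_const"
    using torsion_const(1) LIMSEQ_inverse_real_of_nat by (intro tendsto_intros) (auto simp: inverse_eq_divide)
  have "Cauchy (\<lambda>k. ?w k x)" for x
  proof (rule metric_CauchyI)
    fix e :: real assume "0 < e"
    then obtain M where M: "(1 / real (Suc M) + 1 / real (Suc M)) / torsion_const < e"
      using order_tendstoD(2)[OF lim0, of e] by (auto simp: eventually_sequentially)
    have "dist (?w m x) (?w n x) < e" if "M \<le> m" "M \<le> n" for m n
    proof -
      have "1 / real (Suc m) \<le> 1 / real (Suc M)" "1 / real (Suc n) \<le> 1 / real (Suc M)"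
        using that by (auto simp: frac_le)
      then have "(1 / real (Suc m) + 1 / real (Suc n)) / torsion_const \<le> (1 / real (Suc M) + 1 / real (Suc M)) / torsion_const"
        using torsion_const(1) by (intro divide_right_mono add_mono) auto
      then show ?thesis using diff[of m x n] M by (simp add: dist_real_def)
    qed
    then show "\<exists>M. \<forall>m\<ge>M. \<forall>n\<ge>M. dist (?w m x) (?w n x) < e" by blast
  qed
  then have "\<exists>l. (\<lambda>k. ?w k x) \<longlonglongrightarrow> l" for x by (simp add: Cauchy_convergent_iff convergent_def)
  then obtain w where w: "\<And>x. (\<lambda>k. ?w k x) \<longlonglongrightarrow> w x" by metis
  have wbound: "\<bar>?w k x - w x\<bar> \<le> (1 / real (Suc k) + 0) / torsion_const" for k x
  proof (rule tendsto_le[OF sequentially_bot])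
    show "(\<lambda>l. (1 / real (Suc k) + 1 / real (Suc l)) / torsion_const) \<longlonglongrightarrow> (1 / real (Suc k) + 0) / torsion_const"
      using torsion_const(1) LIMSEQ_inverse_real_of_nat by (intro tendsto_intros) (auto simp: inverse_eq_divide)
    show "(\<lambda>l. \<bar>?w k x - ?w l x\<bar>) \<longlonglongrightarrow> \<bar>?w k x - w x\<bar>" by (intro tendsto_intros w)
  qed (use diff in auto)
  have "dirichlet_solution F w"
    unfolding dirichlet_solution_def
  proof (intro allI impI)
    fix e :: real assume e: "0 < e"
    have "0 < min e (e * torsion_const)" using e torsion_const(1) by simp
    then obtain k where k: "1 / real (Suc k) < min e (e * torsion_const)"
      using nat_approx_posE by blast
    then have "1 / real (Suc k) / torsion_const \<le> e" unfolding pos_divide_le_eq[OF torsion_const(1)] by linarith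
    then have "\<bar>?w k x - w x\<bar> \<le> e" for x
      by (rule order_trans[OF wbound[of k x, unfolded add_0_right]])
    moreover have "\<bar>G k x - F x\<bar> \<le> e" if "x \<in> ball 0 1" for x using pG(3)[OF that, of k] k by linarith
    ultimately show "\<exists>n p G. poly_deg n p \<and> (\<forall>x\<in>ball 0 1. solves_at (disc_weight s p) (G x) x \<and> \<bar>G x - F x\<bar> \<le> e) \<and>
      (\<forall>x. \<bar>disc_weight s p x - w x\<bar> \<le> e)"
      using pG(1,2) by blast
  qed
  then show ?thesis by blast
qed

lemma dirichlet_solution_continuous:
  assumes w: "dirichlet_solution F w"
  shows "continuous_on UNIV w"
proof -
  have "\<exists>p n. poly_deg n p \<and> (\<forall>x. \<bar>disc_weight s p x - w x\<bar> \<le> 1 / real (Suc k))" for k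
    using dirichlet_solutionE[OF w, of "1 / real (Suc k)"] by (metis of_nat_0_less_iff zero_less_Suc zero_less_divide_1_iff)
  then obtain p N where p: "\<And>k. poly_deg (N k) (p k)" "\<And>k x. \<bar>disc_weight s (p k) x - w x\<bar> \<le> 1 / real (Suc k)"
    by metis
  show ?thesis
  proof (rule uniform_limit_theorem[where F=sequentially])
    show "\<forall>\<^sub>F k in sequentially. continuous_on UNIV (disc_weight s (p k))"
      using p(1) s_pos by (intro always_eventually allI continuous_on_disc_weight)
    show "uniform_limit UNIV (\<lambda>k. disc_weight s (p k)) w sequentially"
    proof (rule uniform_limitI)
      fix e :: real assume "0 < e"
      then obtain M where M: "1 / real (Suc M) < e" using nat_approx_posE by blast
      have "dist (disc_weight s (p k) x) (w x) < e" if "M \<le> k" for k x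
      proof -
        have "1 / real (Suc k) \<le> 1 / real (Suc M)" using that by (simp add: frac_le)
        then show ?thesis using p(2)[of k x] M by (simp add: dist_real_def)
      qed
      then show "\<forall>\<^sub>F k in sequentially. \<forall>x\<in>UNIV. dist (disc_weight s (p k) x) (w x) < e"
        unfolding eventually_sequentially by blast
    qed
  qed simp
qed

lemma dirichlet_solution_outside:
  assumes w: "dirichlet_solution F w" and x: "x \<notin> ball 0 1"
  shows "w x = 0"
proof -
  have "\<bar>w x\<bar> \<le> 0 + 1 * e" if "0 < e" for e
  proof -
    obtain p where "\<bar>disc_weight s p x - w x\<bar> \<le> e"
      using dirichlet_solutionE[OF w \<open>0 < e\<close>] by metis
    then show ?thesis using disc_weight_outside[OF x, of s p] by simp
  qed
  then have "\<bar>w x\<bar> \<le> 0" by (rule le_by_linear_epsilon)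
  then show ?thesis by simp
qed

text \<open>Both sides are continuous under uniform convergence of w and F, because \<phi> and
  \<open>frac_lap \<phi>\<close> are integrable; the defect D is therefore O(e) for every e.\<close>

lemma dirichlet_solution_weak:
  assumes w: "dirichlet_solution F w" and F: "continuous_on (cball 0 1) F"
    and \<phi>: "C11_bump r \<phi>" and r: "0 \<le> r" "r < 1"
  shows "(\<integral>x. w x * frac_lap \<phi> x \<partial>lborel) = (\<integral>x. \<phi> x * F x \<partial>lborel)"
    and "integrable lborel (\<lambda>x. w x * frac_lap \<phi> x)" and "integrable lborel (\<lambda>x. \<phi> x * F x)"
proof -
  have contw: "continuous_on UNIV w" using w by (rule dirichlet_solution_continuous)
  have wm[measurable]: "w \<in> borel_measurable borel" using contw by (rule borel_measurable_continuous_onI)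
  obtain U where U: "\<And>x. \<bar>w x\<bar> \<le> U"
    using bounded_compact_support[OF contw, of 1] dirichlet_solution_outside[OF w] by (metis in_unit_ball_2 mem_ball_0 not_less_iff_gr_or_eq)
  have cont: "continuous_on UNIV \<phi>" and supp: "\<And>x. r < norm x \<Longrightarrow> \<phi> x = 0" using \<phi> by (auto simp: C11_bump_def)
  have \<phi>_int: "integrable lborel \<phi>" using cont supp by (rule integrable_compact_support)
  show int: "integrable lborel (\<lambda>x. w x * frac_lap \<phi> x)" using wm U \<phi> by (rule weak_form_Fubini(1))
  \<comment> \<open>Pairing with the constant function 1 yields integrability of
    \<open>frac_lap \<phi>\<close> itself.\<close>
  have L_int: "integrable lborel (frac_lap \<phi>)"
    using weak_form_Fubini(1)[of "\<lambda>x. 1" 1, OF _ _ \<phi>] by simp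
  obtain M where "\<forall>y\<in>F ` cball 0 1. \<bar>y\<bar> \<le> M"
    using compact_imp_bounded[OF compact_continuous_image[OF F compact_cball]] unfolding bounded_real by blast
  then have M: "\<bar>F x\<bar> \<le> M" if "x \<in> cball 0 1" for x using that by blast
  have M0: "0 \<le> M" using M[of 0] by simp
  have eqF: "\<phi> x * F x = (indicator (cball 0 1) x *\<^sub>R F x) * \<phi> x" for x
    using supp[of x] r by (cases "norm x \<le> 1") (auto simp: indicator_def)
  show F_int: "integrable lborel (\<lambda>x. \<phi> x * F x)"
    unfolding eqF
  proof (rule integrable_bounded_mult[OF \<phi>_int])
    show "(\<lambda>x. indicator (cball 0 1) x *\<^sub>R F x) \<in> borel_measurable borel"
      using F by (intro borel_measurable_continuous_on_indicator) auto
    show "\<bar>indicator (cball 0 1) x *\<^sub>R F x\<bar> \<le> M" for x using M[of x] M0 by (simp add: indicator_def)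
  qed
  define D where "D = (\<integral>x. w x * frac_lap \<phi> x \<partial>lborel) - (\<integral>x. \<phi> x * F x \<partial>lborel)"
  have "\<bar>D\<bar> \<le> 0 + ((\<integral>x. \<bar>frac_lap \<phi> x\<bar> \<partial>lborel) + (\<integral>x. \<bar>\<phi> x\<bar> \<partial>lborel)) * e" if e: "0 < e" for e
  proof -
    obtain n p G where p: "poly_deg n p" "\<And>x. x \<in> ball 0 1 \<Longrightarrow> solves_at (disc_weight s p) (G x) x"
      "\<And>x. x \<in> ball 0 1 \<Longrightarrow> \<bar>G x - F x\<bar> \<le> e" "\<And>x. \<bar>disc_weight s p x - w x\<bar> \<le> e"
      using dirichlet_solutionE[OF w e] by metis
    let ?v = "disc_weight s p"
    have vm: "?v \<in> borel_measurable borel"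
      using p(1) s_pos by (intro borel_measurable_continuous_onI continuous_on_disc_weight)
    obtain V where V: "\<And>x. \<bar>?v x\<bar> \<le> V" using disc_weight_bounded[OF p(1)] by blast
    obtain K where K: "\<And>x t. norm x \<le> r \<Longrightarrow> 0 < t \<Longrightarrow> \<bar>second_diff2 ?v x t\<bar> \<le> K * min 1 (t\<^sup>2)"
      using disc_weight_interior_C11[OF p(1) r] by blast
    have ball: "x \<in> ball 0 1" if "norm x \<le> r" for x :: "real^2" using that r by simp
    note cl = weak_form_classical[OF vm V \<phi> K p(2)[OF ball]]
    have v_int: "integrable lborel (\<lambda>x. ?v x * frac_lap \<phi> x)" using vm V \<phi> by (rule weak_form_Fubini(1))
    have "D = (\<integral>x. (w x - ?v x) * frac_lap \<phi> x \<partial>lborel) - (\<integral>x. \<phi> x * (F x - G x) \<partial>lborel)"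
      unfolding D_def left_diff_distrib right_diff_distrib using int v_int F_int cl by simp
    moreover have "\<bar>\<integral>x. (w x - ?v x) * frac_lap \<phi> x \<partial>lborel\<bar> \<le> (\<integral>x. e * \<bar>frac_lap \<phi> x\<bar> \<partial>lborel)"
    proof (rule abs_integral_le)
      show "\<bar>(w x - ?v x) * frac_lap \<phi> x\<bar> \<le> e * \<bar>frac_lap \<phi> x\<bar>" for x
        using p(4)[of x] by (simp add: abs_mult abs_minus_commute mult_right_mono)
    qed (use L_int in simp)
    moreover have "\<bar>\<integral>x. \<phi> x * (F x - G x) \<partial>lborel\<bar> \<le> (\<integral>x. e * \<bar>\<phi> x\<bar> \<partial>lborel)"
    proof (rule abs_integral_le)
      fix x :: "real^2"
      show "\<bar>\<phi> x * (F x - G x)\<bar> \<le> e * \<bar>\<phi> x\<bar>"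
      proof (cases "norm x \<le> r")
        case True
        then have "\<bar>F x - G x\<bar> \<le> e" using p(3)[OF ball[OF True]] by (simp add: abs_minus_commute)
        then show ?thesis using mult_left_mono[of "\<bar>F x - G x\<bar>" e "\<bar>\<phi> x\<bar>"] by (simp add: abs_mult mult.commute)
      qed (simp add: supp)
    qed (use \<phi>_int in simp)
    ultimately show ?thesis by (simp add: algebra_simps abs_if split: if_splits)
  qed
  then have "\<bar>D\<bar> \<le> 0" by (rule le_by_linear_epsilon)
  then show "(\<integral>x. w x * frac_lap \<phi> x \<partial>lborel) = (\<integral>x. \<phi> x * F x \<partial>lborel)" by (simp add: D_def)
qed

text \<open>1 - |y|^2 = (1 - |y|)(1 + |y|) is at most twice the distance from a point y of the disc
  to any point outside it. This is the source of the boundary exponent s.\<close>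

lemma torsion_near_boundary:
  assumes "x \<notin> ball 0 1"
  shows "torsion y \<le> (2 * norm (y - x)) powr s"
proof -
  have "max 0 (1 - (y $ 1)\<^sup>2 - (y $ 2)\<^sup>2) \<le> 2 * norm (y - x)"
  proof (cases "norm y < 1")
    case False
    then have "1 \<le> (norm y)\<^sup>2" by (simp add: one_le_power)
    then show ?thesis by (simp add: norm_sq_2)
  next
    case True
    have "1 - (norm y)\<^sup>2 = (1 - norm y) * (1 + norm y)" by (simp add: power2_eq_square algebra_simps)
    also have "\<dots> \<le> norm (y - x) * 2"
    proof (rule mult_mono)
      show "1 - norm y \<le> norm (y - x)" using norm_triangle_ineq2[of x y] assms by (simp add: norm_minus_commute)
    qed (use True in auto)
    finally show ?thesis by (simp add: norm_sq_2)
  qed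
  then show ?thesis using s_pos by (simp add: disc_weight_def powr_mono2)
qed

text \<open>The increment \<open>v(x) = w(x + h) - w(x)\<close> solves the equation where both points lie in the
  disc and is \<open>O(|h|^s)\<close> elsewhere. The second alternative in \<open>b_super\<close> admits barriers with a
  concave corner, where no smooth perturbation of the barrier can have a minimum.\<close>

lemma dirichlet_solution_increment:
  assumes w: "dirichlet_solution F w" and F: "\<And>x. x \<in> ball 0 1 \<Longrightarrow> \<bar>F x\<bar> \<le> M"
    and b: "continuous_on UNIV b" "\<And>x. 0 \<le> b x"
    and b_super: "\<And>x. x \<in> ball 0 1 \<Longrightarrow> x + h \<in> ball 0 1 \<Longrightarrow>
      (\<exists>g. solves_at b g x \<and> \<bar>F (x + h) - F x\<bar> \<le> g) \<or> (\<forall>K. \<exists>t>0. K * t\<^sup>2 < second_diff2 b x t)"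
  shows "\<bar>w (x + h) - w x\<bar> \<le> M / torsion_const * (2 * norm h) powr s + b x"
proof (rule le_by_linear_epsilon[where C="1 / torsion_const * (2 * norm h) powr s + 3 / torsion_const + 2"])
  fix e :: real assume e: "0 < e"
  obtain n p G where p: "poly_deg n p" "\<And>x. x \<in> ball 0 1 \<Longrightarrow> solves_at (disc_weight s p) (G x) x"
    "\<And>x. x \<in> ball 0 1 \<Longrightarrow> \<bar>G x - F x\<bar> \<le> e" "\<And>x. \<bar>disc_weight s p x - w x\<bar> \<le> e"
    using dirichlet_solutionE[OF w e] by metis
  let ?W = "disc_weight s p"
  have M0: "0 \<le> M" using F[of 0] by simp
  have Wb: "\<bar>?W y\<bar> \<le> (M + e) / torsion_const * torsion y" for y
  proof (rule disc_weight_sup_bound[OF p(1,2)])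
    fix y :: "real^2" assume y: "y \<in> ball 0 1"
    show "\<bar>G y\<bar> \<le> M + e" using F[OF y] p(3)[OF y] by linarith
  qed
  define A where "A = (M + e) / torsion_const * (2 * norm h) powr s"
  have A: "0 \<le> A" unfolding A_def using M0 e torsion_const(1) by simp
  have off: "\<bar>?W (x + h) - ?W x\<bar> \<le> A" if "\<not> (x \<in> ball 0 1 \<and> x + h \<in> ball 0 1)" for x
  proof -
    have c: "0 \<le> (M + e) / torsion_const" using M0 e torsion_const(1) by simp
    show ?thesis
    proof (cases "x \<in> ball 0 1")
      case False
      have "\<bar>?W (x + h)\<bar> \<le> A"
        using Wb[of "x + h"] mult_left_mono[OF torsion_near_boundary[OF False, of "x + h"] c] by (simp add: A_def)
      then show ?thesis using disc_weight_outside[OF False] by simp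
    next
      case True
      then have out: "x + h \<notin> ball 0 1" using that by blast
      have "\<bar>?W x\<bar> \<le> A"
        using Wb[of x] mult_left_mono[OF torsion_near_boundary[OF out, of x] c] by (simp add: A_def)
      then show ?thesis using disc_weight_outside[OF out] by simp
    qed
  qed
  have contW: "continuous_on UNIV ?W" using p(1) s_pos by (rule continuous_on_disc_weight)
  have contWh: "continuous_on UNIV (\<lambda>x. ?W (x + h))"
    by (rule continuous_on_compose2[OF contW]) (auto intro: continuous_intros)
  have contT: "continuous_on UNIV torsion" using poly_deg_const[of 0 1] s_pos by (rule continuous_on_disc_weight)
  have main: "\<sigma> * (?W (x + h) - ?W x) \<le> A + 3 * e / torsion_const * torsion x + b x" if \<sigma>: "\<bar>\<sigma>\<bar> = 1" for \<sigma>
  proof -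
    \<comment> \<open>Of the 3e, two pay for replacing F by G at the two points x and x + h, and the
      third makes the inequality strict. The constant A dominates the increment wherever x or x + h
      leaves the disc.\<close>
    define z where "z x = A + 3 * e / torsion_const * torsion x + b x - \<sigma> * (?W (x + h) - ?W x)" for x
    have "0 \<le> z x"
    proof (rule comparison_principle[of z "ball 0 1 \<inter> {x. x + h \<in> ball 0 1}"])
      show "continuous_on UNIV z" unfolding z_def by (intro continuous_intros contW contWh contT b)
      show "bounded (ball 0 1 \<inter> {x::real^2. x + h \<in> ball 0 1})" by (intro bounded_Int) simp
      show "0 \<le> z x" if "x \<notin> ball 0 1 \<inter> {x. x + h \<in> ball 0 1}" for x
      proof -
        have "\<sigma> * (?W (x + h) - ?W x) \<le> A"
          using off[of x] that \<sigma> by (auto simp: abs_if split: if_splits)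
        moreover have "0 \<le> 3 * e / torsion_const * torsion x" using e torsion_const(1) torsion_nonneg by simp
        ultimately show ?thesis using b(2)[of x] by (simp add: z_def)
      qed
      fix x assume "x \<in> ball 0 1 \<inter> {x. x + h \<in> ball 0 1}"
      then have x: "x \<in> ball 0 1" "x + h \<in> ball 0 1" by auto
      from b_super[OF x] show "\<exists>t>0. 0 < second_diff2 z x t"
      proof
        assume "\<exists>g. solves_at b g x \<and> \<bar>F (x + h) - F x\<bar> \<le> g"
        then obtain g where g: "solves_at b g x" "\<bar>F (x + h) - F x\<bar> \<le> g" by blast
        have "solves_at z (0 + 3 * e / torsion_const * torsion_const + g - \<sigma> * (G (x + h) - G x)) x"
          unfolding z_def
          by (intro solves_at_diff solves_at_add solves_at_cmult solves_at_const solves_at_translate torsion_const p(2) x g)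
        moreover have "\<sigma> * (G (x + h) - G x) \<le> g + 2 * e"
          using p(3)[OF x(1)] p(3)[OF x(2)] g(2) \<sigma> by (auto simp: abs_if split: if_splits)
        then have "0 < 0 + 3 * e / torsion_const * torsion_const + g - \<sigma> * (G (x + h) - G x)"
          using torsion_const(1) e by simp
        ultimately show ?thesis by (rule solves_at_pos)
      next
        \<comment> \<open>Here x and x + h lie inside the disc, so the approximant, its translate
          and the torsion function have second differences O(t^2) there; those of b exceed any such
          bound for some t.\<close>
        assume peak: "\<forall>K. \<exists>t>0. K * t\<^sup>2 < second_diff2 b x t"
        have n: "0 \<le> norm x" "norm x < 1" "0 \<le> norm (x + h)" "norm (x + h) < 1" using x by auto
        obtain K1 where K1: "\<And>t. 0 < t \<Longrightarrow> \<bar>second_diff2 torsion x t\<bar> \<le> K1 * min 1 (t\<^sup>2)"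
          using disc_weight_interior_C11[OF poly_deg_const[of 0 1] n(1,2)] by auto
        obtain K2 where K2: "\<And>t. 0 < t \<Longrightarrow> \<bar>second_diff2 ?W x t\<bar> \<le> K2 * min 1 (t\<^sup>2)"
          using disc_weight_interior_C11[OF p(1) n(1,2)] by auto
        obtain K3 where K3: "\<And>t. 0 < t \<Longrightarrow> \<bar>second_diff2 ?W (x + h) t\<bar> \<le> K3 * min 1 (t\<^sup>2)"
          using disc_weight_interior_C11[OF p(1) n(3,4)] by auto
        define a where "a = 3 * e / torsion_const"
        have a: "0 \<le> a" using e torsion_const(1) by (simp add: a_def)
        define K where "K = a * \<bar>K1\<bar> + \<bar>K2\<bar> + \<bar>K3\<bar>"
        obtain t where t: "0 < t" "K * t\<^sup>2 < second_diff2 b x t" using peak by blast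
        have mt: "c * min 1 (t\<^sup>2) \<le> \<bar>c\<bar> * t\<^sup>2" for c by (intro mult_mono) auto
        have "\<bar>a * second_diff2 torsion x t\<bar> \<le> a * (\<bar>K1\<bar> * t\<^sup>2)"
          using K1[OF t(1)] mt[of K1] a by (simp add: abs_mult mult_left_mono)
        moreover have "\<bar>\<sigma> * (second_diff2 ?W (x + h) t - second_diff2 ?W x t)\<bar> \<le> \<bar>K3\<bar> * t\<^sup>2 + \<bar>K2\<bar> * t\<^sup>2"
          unfolding abs_mult \<sigma> mult_1
          by (intro abs_diff_le_add order_trans[OF K2[OF t(1)] mt] order_trans[OF K3[OF t(1)] mt])
        moreover have "second_diff2 z x t = a * second_diff2 torsion x t + second_diff2 b x t
            - \<sigma> * (second_diff2 ?W (x + h) t - second_diff2 ?W x t)"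
          unfolding z_def[abs_def] second_diff2_diff second_diff2_add second_diff2_cmult second_diff2_const
            second_diff2_translate a_def by simp
        ultimately have "0 < second_diff2 z x t" using t(2) unfolding K_def distrib_right by linarith
        with t(1) show ?thesis by blast
      qed
    qed
    then show ?thesis by (simp add: z_def)
  qed
  have "\<bar>?W (x + h) - ?W x\<bar> \<le> A + 3 * e / torsion_const * torsion x + b x"
    using main[of 1] main[of "-1"] by simp
  also have "3 * e / torsion_const * torsion x \<le> 3 * e / torsion_const"
    using e torsion_const(1) torsion_nonneg[of x] torsion_le_1[of x] by (intro mult_left_le) auto
  finally have "\<bar>w (x + h) - w x\<bar> \<le> 2 * e + (A + 3 * e / torsion_const + b x)"
    using p(4)[of x] p(4)[of "x + h"] by linarith
  \<comment> \<open>The terms linear in e are collected: the enlargement of M inside A, the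
    strictness margin, and twice the distance between w and its approximant.\<close>
  also have "\<dots> = M / torsion_const * (2 * norm h) powr s + b x
      + (1 / torsion_const * (2 * norm h) powr s + 3 / torsion_const + 2) * e"
    using torsion_const(1) by (simp add: A_def field_simps)
  finally show "\<bar>w (x + h) - w x\<bar> \<le> M / torsion_const * (2 * norm h) powr s + b x
      + (1 / torsion_const * (2 * norm h) powr s + 3 / torsion_const + 2) * e" .
qed

lemma dirichlet_solution_increment_le:
  assumes w: "dirichlet_solution F w" and F: "\<And>x. x \<in> ball 0 1 \<Longrightarrow> \<bar>F x\<bar> \<le> M"
    and inc: "\<And>x. x \<in> ball 0 1 \<Longrightarrow> x + h \<in> ball 0 1 \<Longrightarrow> \<bar>F (x + h) - F x\<bar> \<le> N" and N: "0 \<le> N"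
  shows "\<bar>w (x + h) - w x\<bar> \<le> M / torsion_const * (2 * norm h) powr s + N / torsion_const"
proof -
  have "\<bar>w (x + h) - w x\<bar> \<le> M / torsion_const * (2 * norm h) powr s + N / torsion_const * torsion x"
  proof (rule dirichlet_solution_increment[OF w F])
    show "continuous_on UNIV (\<lambda>x. N / torsion_const * torsion x)"
      using poly_deg_const[of 0 1] s_pos by (intro continuous_intros continuous_on_disc_weight)
    show "0 \<le> N / torsion_const * torsion x" for x using N torsion_const(1) torsion_nonneg by simp
    fix x :: "real^2" assume x: "x \<in> ball 0 1" "x + h \<in> ball 0 1"
    have "solves_at (\<lambda>x. N / torsion_const * torsion x) (N / torsion_const * torsion_const) x"
      by (intro solves_at_cmult torsion_const x)
    then show "(\<exists>g. solves_at (\<lambda>x. N / torsion_const * torsion x) g x \<and> \<bar>F (x + h) - F x\<bar> \<le> g) \<or>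
        (\<forall>K. \<exists>t>0. K * t\<^sup>2 < second_diff2 (\<lambda>x. N / torsion_const * torsion x) x t)"
      using inc[OF x] torsion_const(1) by auto
  qed
  also have "N / torsion_const * torsion x \<le> N / torsion_const"
    using N torsion_const(1) torsion_nonneg[of x] torsion_le_1[of x] by (intro mult_left_le) auto
  finally show ?thesis by simp
qed

section \<open>A barrier singular on the line x_2 = 0\<close>

lemma kern_scaled_min:
  assumes "0 < l"
  shows "has_bochner_integral lborel (\<lambda>t. kern t * min 1 ((t / l)\<^sup>2)) (l powr (-2 * s) * (\<integral>t. kern t * min 1 (t\<^sup>2) \<partial>lborel))"
proof -
  let ?C = "\<integral>t. kern t * min 1 (t\<^sup>2) \<partial>lborel"
  have k: "kern (0 + l * t) = l powr (-1 - 2 * s) * kern t" for t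
    using assms by (simp add: kern_def powr_mult indicator_def zero_less_mult_iff)
  have "has_bochner_integral lborel (\<lambda>t. l powr (-1 - 2 * s) * (kern t * min 1 (t\<^sup>2))) (l powr (-1 - 2 * s) * ?C)"
    using integrable_kern_min by (intro has_bochner_integral_mult_right) (simp add: has_bochner_integral_iff)
  also have "(\<lambda>t. l powr (-1 - 2 * s) * (kern t * min 1 (t\<^sup>2))) = (\<lambda>t. kern (0 + l * t) * min 1 (((0 + l * t) / l)\<^sup>2))"
    unfolding k using assms by (simp add: fun_eq_iff)
  also have "l powr (-1 - 2 * s) * ?C = (l powr (-2 * s) * ?C) /\<^sub>R \<bar>l\<bar>"
    using assms powr_add[of l "-1 - 2 * s" 1] by (simp add: field_simps)
  finally show ?thesis
    using assms by (subst lborel_has_bochner_integral_real_affine_iff[where c=l and t=0]) auto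
qed

text \<open>The power t^(-1-\<tau>) is the kernel of order \<tau>/2, so the tail formula is borrowed
  from a second instance of the locale.\<close>

lemma has_bochner_integral_powr_between:
  fixes \<tau> u v :: real
  assumes "0 < \<tau>" "\<tau> < 2" "0 < u" "u \<le> v"
  shows "has_bochner_integral lborel (\<lambda>t. indicator {u..<v} t * t powr (-1 - \<tau>)) ((u powr (-\<tau>) - v powr (-\<tau>)) / \<tau>)"
proof -
  interpret tau: fractional_order "\<tau> / 2" by unfold_locales (use assms in auto)
  have "has_bochner_integral lborel (\<lambda>t. indicator {u..} t * tau.kern t - indicator {v..} t * tau.kern t)
     (u powr (-\<tau>) / \<tau> - v powr (-\<tau>) / \<tau>)"
    using tau.kern_tail[of u] tau.kern_tail[of v] assms by (intro has_bochner_integral_diff) auto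
  moreover have "(\<lambda>t. indicator {u..} t * tau.kern t - indicator {v..} t * tau.kern t)
      = (\<lambda>t. indicator {u..<v} t * t powr (-1 - \<tau>))"
    using assms by (auto simp: tau.kern_def indicator_def fun_eq_iff)
  ultimately show ?thesis by (simp add: diff_divide_distrib)
qed

text \<open>The barrier will be a multiple of R^p minus this function; truncation at R makes it
  bounded and nonnegative. With p = 2s - \<tau>, the operator lowers the homogeneity to -\<tau>, the
  order of the right-hand side.\<close>

definition trunc_pow :: "real \<Rightarrow> real \<Rightarrow> real \<Rightarrow> real" where
  "trunc_pow p R y = (min \<bar>y\<bar> R) powr p"

lemma trunc_pow_small:
  assumes p: "0 < p" "p < 2" and y: "0 < y" "y < 1" and R: "2 \<le> R" and t: "0 < t" "t \<le> y / 2"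
  shows "\<bar>second_diff (trunc_pow p R) y t\<bar> \<le> 16 * y powr (p - 2) * t\<^sup>2"
proof -
  let ?J = "{y - t..y + t}"
  have J: "y / 2 \<le> z" "z < R" if "z \<in> ?J" for z using that y t R by auto
  have "\<bar>second_diff (\<lambda>z. z powr p) y t\<bar> \<le> 2 * (8 * y powr (p - 2)) * t\<^sup>2"
  proof (rule second_diff_le_deriv2[OF t(1)])
    fix z assume z: "z \<in> ?J"
    have z0: "0 < z" using J(1)[OF z] y by linarith
    show "((\<lambda>z. z powr p) has_real_derivative p * z powr (p - 1)) (at z)"
      using z0 by (rule has_real_derivative_powr)
    show "((\<lambda>z. p * z powr (p - 1)) has_real_derivative p * ((p - 1) * z powr (p - 1 - 1))) (at z)"
      using z0 by (intro DERIV_cmult has_real_derivative_powr)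
    \<comment> \<open>The constant 8: |p (p - 1)| \<le> 2, and halving the base costs a factor
      2^(2-p) \<le> 4.\<close>
    have "z powr (p - 2) \<le> (y / 2) powr (p - 2)"
      using p y J(1)[OF z] by (intro powr_mono2') auto
    also have "\<dots> = y powr (p - 2) * 2 powr (2 - p)"
      using y by (simp add: powr_divide powr_diff field_simps)
    also have "2 powr (2 - p) \<le> 2 powr (2::real)" using p by (intro powr_mono) auto
    finally have "z powr (p - 2) \<le> y powr (p - 2) * 4" by (simp add: mult_left_mono)
    moreover have "\<bar>p * (p - 1)\<bar> \<le> 2 * 1" unfolding abs_mult using p by (intro mult_mono) auto
    ultimately have "\<bar>p * (p - 1)\<bar> * z powr (p - 2) \<le> (2 * 1) * (y powr (p - 2) * 4)"
      by (intro mult_mono) auto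
    then show "\<bar>p * ((p - 1) * z powr (p - 1 - 1))\<bar> \<le> 8 * y powr (p - 2)"
      by (simp add: abs_mult)
  qed
  moreover have "trunc_pow p R z = z powr p" if "z \<in> ?J" for z
    using J[OF that] y by (simp add: trunc_pow_def)
  then have "second_diff (trunc_pow p R) y t = second_diff (\<lambda>z. z powr p) y t"
    using t(1) by (simp add: second_diff_def)
  ultimately show ?thesis by simp
qed

text \<open>For t \<le> y/2 the function is smooth and contributes at most a quadratic term. For
  larger t the centre costs 2 y^p, while y + t gains at least t^p on [2y, R); the value at y - t is
  discarded as nonnegative.\<close>

lemma trunc_pow_lower:
  assumes p: "0 < p" "p < 2" and y: "0 < y" "y < 1" and R: "2 \<le> R" and t: "0 < t"
  shows "indicator {2 * y..<R} t * t powr p - 16 * y powr p * min 1 ((t / (y / 2))\<^sup>2) \<le> - second_diff (trunc_pow p R) y t"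
proof (cases "t \<le> y / 2")
  case True
  have "(t / (y / 2))\<^sup>2 \<le> 1" using True t y by (simp add: power_le_one)
  moreover have "16 * y powr p * (t / (y / 2))\<^sup>2 = 64 * y powr (p - 2) * t\<^sup>2"
    using y by (simp add: powr_diff power2_eq_square powr_numeral field_simps)
  moreover have "16 * y powr (p - 2) * t\<^sup>2 \<le> 64 * y powr (p - 2) * t\<^sup>2" by (intro mult_right_mono) auto
  moreover have "indicator {2 * y..<R} t = (0::real)" using True y t by simp
  moreover have "second_diff (trunc_pow p R) y t \<le> 16 * y powr (p - 2) * t\<^sup>2"
    using trunc_pow_small[OF p y R t True] by linarith
  ultimately show ?thesis by (simp only: min.absorb2)
next
  case False
  then have "1 \<le> (t / (y / 2))\<^sup>2" using y by (simp add: one_le_power)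
  then have m: "min 1 ((t / (y / 2))\<^sup>2) = 1" by (rule min.absorb1)
  have "trunc_pow p R y = y powr p" using y R by (simp add: trunc_pow_def)
  moreover have "indicator {2 * y..<R} t * t powr p \<le> trunc_pow p R (y + t)"
    using y t p by (auto simp: indicator_def trunc_pow_def intro!: powr_mono2)
  moreover have "0 \<le> trunc_pow p R (y - t)" by (simp add: trunc_pow_def)
  moreover have "0 \<le> y powr p" by simp
  ultimately show ?thesis unfolding second_diff_def m by linarith
qed

text \<open>The gain is the integral of t^(-1-\<tau>) over [2y, R), of size y^(-\<tau>) / \<tau>;
  the factor 1/\<tau> arises because t^(2s) just fails to be integrable against the kernel at
  infinity. The loss near y is at most 64 C y^(-\<tau>) with C independent of \<tau>, so the gain
  prevails for small \<tau>.\<close>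

lemma trunc_pow_concave_barrier:
  assumes \<tau>: "0 < \<tau>" "\<tau> < 1" "\<tau> \<le> s" and R: "R = 4 * 2 powr (1 / \<tau>)"
    and small: "64 * (\<integral>t. kern t * min 1 (t\<^sup>2) \<partial>lborel) + 1 \<le> 1 / (4 * \<tau>)"
    and y: "0 < y" "y < 1"
  shows "integrable lborel (\<lambda>t. kern t * second_diff (trunc_pow (2 * s - \<tau>) R) y t)"
    and "(\<integral>t. kern t * second_diff (trunc_pow (2 * s - \<tau>) R) y t \<partial>lborel) \<le> - (y powr (-\<tau>))"
proof -
  define p where "p = 2 * s - \<tau>"
  define C where "C = (\<integral>t. kern t * min 1 (t\<^sup>2) \<partial>lborel)"
  have C: "0 \<le> C" unfolding C_def by (intro Bochner_Integration.integral_nonneg) (simp add: kern_nonneg)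
  have p: "0 < p" "p < 2" using \<tau> s_pos s_less_1 by (auto simp: p_def)
  have R4: "4 \<le> R" using \<tau> by (simp add: R ge_one_powr_ge_zero)
  then have R2: "2 \<le> R" by simp
  have [measurable]: "trunc_pow p R \<in> borel_measurable borel" unfolding trunc_pow_def by measurable
  have sup: "\<bar>trunc_pow p R z\<bar> \<le> R powr p" for z
    using p R4 by (auto simp: trunc_pow_def intro!: powr_mono2)
  have bound: "\<bar>second_diff (trunc_pow p R) y t\<bar> \<le> (16 * y powr (p - 2) + 4 * R powr p / (min 1 (y / 2))\<^sup>2) * min 1 (t\<^sup>2)"
    if "0 < t" for t
  proof (rule min_1_square_le[OF that])
    show "\<bar>second_diff (trunc_pow p R) y t\<bar> \<le> 16 * y powr (p - 2) * t\<^sup>2" if "t < y / 2"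
      using trunc_pow_small[OF p y R2 \<open>0 < t\<close>] that by simp
    show "\<bar>second_diff (trunc_pow p R) y t\<bar> \<le> 4 * R powr p"
      using sup[of y] sup[of "y + t"] sup[of "y - t"] unfolding second_diff_def by linarith
  qed (use y in auto)
  show int: "integrable lborel (\<lambda>t. kern t * second_diff (trunc_pow (2 * s - \<tau>) R) y t)"
    using bound unfolding p_def[symmetric] by (intro integrable_kern_times) auto
  have kp: "kern t * t powr p = indicator {0<..} t * t powr (-1 - \<tau>)" for t
    by (simp add: kern_def powr_add[symmetric] p_def)
  have "has_bochner_integral lborel (\<lambda>t. indicator {2 * y..<R} t * t powr (-1 - \<tau>) - 16 * y powr p * (kern t * min 1 ((t / (y / 2))\<^sup>2)))
      (((2 * y) powr (-\<tau>) - R powr (-\<tau>)) / \<tau> - 16 * y powr p * ((y / 2) powr (-2 * s) * C))"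
    unfolding C_def using \<tau> y R4
    by (intro has_bochner_integral_diff has_bochner_integral_mult_right has_bochner_integral_powr_between kern_scaled_min) auto
  moreover have "indicator {2 * y..<R} t * t powr (-1 - \<tau>) - 16 * y powr p * (kern t * min 1 ((t / (y / 2))\<^sup>2))
      = kern t * (indicator {2 * y..<R} t * t powr p - 16 * y powr p * min 1 ((t / (y / 2))\<^sup>2))" for t
  proof -
    have "indicator {2 * y..<R} t * t powr (-1 - \<tau>) = indicator {2 * y..<R} t * (kern t * t powr p)"
      unfolding kp using y by (simp add: indicator_def)
    then show ?thesis by (simp add: algebra_simps)
  qed
  ultimately have low: "has_bochner_integral lborel (\<lambda>t. kern t * (indicator {2 * y..<R} t * t powr p - 16 * y powr p * min 1 ((t / (y / 2))\<^sup>2)))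
      (((2 * y) powr (-\<tau>) - R powr (-\<tau>)) / \<tau> - 16 * y powr p * ((y / 2) powr (-2 * s) * C))"
    by simp
  have "(\<integral>t. kern t * (indicator {2 * y..<R} t * t powr p - 16 * y powr p * min 1 ((t / (y / 2))\<^sup>2)) \<partial>lborel)
      \<le> (\<integral>t. - (kern t * second_diff (trunc_pow p R) y t) \<partial>lborel)"
  proof (rule integral_mono)
    fix t
    show "kern t * (indicator {2 * y..<R} t * t powr p - 16 * y powr p * min 1 ((t / (y / 2))\<^sup>2)) \<le> - (kern t * second_diff (trunc_pow p R) y t)"
    proof (cases "0 < t")
      case True
      show ?thesis using mult_left_mono[OF trunc_pow_lower[OF p y R2 True] kern_nonneg[of t]] by simp
    qed (simp add: kern_zero)
  qed (use low int in \<open>auto simp: has_bochner_integral_iff p_def\<close>)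
  then have le: "((2 * y) powr (-\<tau>) - R powr (-\<tau>)) / \<tau> - 16 * y powr p * ((y / 2) powr (-2 * s) * C)
      \<le> - (\<integral>t. kern t * second_diff (trunc_pow p R) y t \<partial>lborel)"
    using low by (simp add: has_bochner_integral_iff)
  define Y where "Y = y powr (-\<tau>)"
  have Y1: "1 \<le> Y" using y \<tau> powr_mono2'[of "-\<tau>" y 1] by (simp add: Y_def)
  have e1: "(2 * y) powr (-\<tau>) = 2 powr (-\<tau>) * Y" using y by (simp add: powr_mult Y_def)
  have h: "1 / 2 \<le> 2 powr (-\<tau>)"
  proof -
    have "2 powr (-1) \<le> (2::real) powr (-\<tau>)" using \<tau> by (intro powr_mono) auto
    then show ?thesis by (simp add: powr_minus_divide)
  qed
  \<comment> \<open>The choice of R: raised to the power -\<tau>, the factor 2^(1/\<tau>) becomes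
    1/2, so the upper limit removes at most half of the main term.\<close>
  have e2: "R powr (-\<tau>) \<le> 2 powr (-\<tau>) / 2"
  proof -
    have "R powr (-\<tau>) = 4 powr (-\<tau>) * (2 powr (1 / \<tau>)) powr (-\<tau>)" by (simp add: R powr_mult)
    also have "(2 powr (1 / \<tau>)) powr (-\<tau>) = (1 / 2 :: real)" using \<tau> by (simp add: powr_powr powr_minus_divide)
    also have "4 powr (-\<tau>) \<le> (2::real) powr (-\<tau>)" using \<tau> by (intro powr_mono2') auto
    finally show ?thesis by simp
  qed
  have e3: "y powr p * (y / 2) powr (-2 * s) \<le> 4 * Y"
  proof -
    have "y powr p * (y / 2) powr (-2 * s) = Y * 2 powr (2 * s)"
    proof -
      have "(y / 2) powr (-2 * s) = y powr (-2 * s) * 2 powr (2 * s)"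
        using y by (simp add: powr_divide powr_minus field_simps)
      moreover have "y powr p * y powr (-2 * s) = Y" by (simp add: powr_add[symmetric] p_def Y_def)
      ultimately show ?thesis by (simp add: mult.assoc[symmetric])
    qed
    also have "2 powr (2 * s) \<le> 2 powr (2::real)" using s_less_1 by (intro powr_mono) auto
    finally show ?thesis using Y1 by (simp add: mult_left_mono mult.commute)
  qed
  have "R powr (-\<tau>) \<le> 2 powr (-\<tau>) / 2 * Y"
    by (rule order_trans[OF e2]) (use mult_left_mono[OF Y1, of "2 powr (-\<tau>) / 2"] in \<open>simp add: mult.commute\<close>)
  then have "2 powr (-\<tau>) / 2 * Y \<le> (2 * y) powr (-\<tau>) - R powr (-\<tau>)" unfolding e1 by linarith
  moreover have "Y / 4 \<le> 2 powr (-\<tau>) / 2 * Y"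
    using h Y1 mult_right_mono[of "1 / 4" "2 powr (-\<tau>) / 2" Y] by simp
  ultimately have "Y / 4 / \<tau> \<le> ((2 * y) powr (-\<tau>) - R powr (-\<tau>)) / \<tau>"
    using \<tau> by (intro divide_right_mono) auto
  moreover have "16 * y powr p * ((y / 2) powr (-2 * s) * C) \<le> 64 * C * Y"
    using mult_right_mono[OF e3, of "16 * C"] C by (simp add: mult_ac)
  moreover have "(64 * C + 1) * Y \<le> 1 / (4 * \<tau>) * Y"
    using small Y1 by (intro mult_right_mono) (auto simp: C_def)
  then have "64 * C * Y + Y \<le> Y / 4 / \<tau>" by (simp add: algebra_simps)
  ultimately show "(\<integral>t. kern t * second_diff (trunc_pow (2 * s - \<tau>) R) y t \<partial>lborel) \<le> - (y powr (-\<tau>))"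
    using le unfolding Y_def[symmetric] p_def[symmetric] by linarith
qed

end

section \<open>Gain of regularity along the singular line\<close>

lemma powr_diff_le:
  fixes u v \<beta> :: real
  assumes \<beta>: "0 < \<beta>" "\<beta> < 1" and uv: "0 \<le> v" "v < u"
  shows "u powr \<beta> - v powr \<beta> \<le> (u - v) * u powr (\<beta> - 1)"
proof -
  have u: "0 < u" using uv by linarith
  have "v / u \<le> (v / u) powr \<beta>"
    using powr_mono'[of \<beta> 1 "v / u"] \<beta> uv u by simp
  also have "\<dots> = v powr \<beta> / u powr \<beta>" using uv u by (simp add: powr_divide)
  finally have "v / u * u powr \<beta> \<le> v powr \<beta>" using u by (simp add: field_simps)
  moreover have "u powr \<beta> = u * u powr (\<beta> - 1)" using u powr_add[of u 1 "\<beta> - 1"] by simp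
  ultimately show ?thesis using u by (simp add: field_simps)
qed

lemma powr_Holder:
  fixes a b \<beta> :: real
  assumes \<beta>: "0 < \<beta>" "\<beta> < 1" and "0 \<le> a" "0 \<le> b"
  shows "\<bar>a powr \<beta> - b powr \<beta>\<bar> \<le> \<bar>a - b\<bar> powr \<beta>"
proof -
  have *: "u powr \<beta> - v powr \<beta> \<le> (u - v) powr \<beta>" if "0 \<le> v" "v < u" for u v
  proof -
    have "u powr \<beta> - v powr \<beta> \<le> (u - v) * u powr (\<beta> - 1)" using \<beta> that by (rule powr_diff_le)
    also have "\<dots> \<le> (u - v) * (u - v) powr (\<beta> - 1)"
      using \<beta> that by (intro mult_left_mono powr_mono2') auto
    also have "\<dots> = (u - v) powr \<beta>" using that powr_add[of "u - v" 1 "\<beta> - 1"] by simp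
    finally show ?thesis .
  qed
  consider "a = b" | "b < a" | "a < b" by linarith
  then show ?thesis
  proof cases
    case 2
    then have "b powr \<beta> \<le> a powr \<beta>" using assms by (intro powr_mono2) auto
    then show ?thesis using *[of b a] 2 assms by simp
  next
    case 3
    then have "a powr \<beta> \<le> b powr \<beta>" using assms by (intro powr_mono2) auto
    then show ?thesis using *[of a b] 3 assms by simp
  qed simp
qed

text \<open>Interpolation between two regimes. If |h| \<le> |y|, the Lipschitz bound |h|
  |y|^(\<beta>-1) is weakened by a power of |h|/|y| \<le> 1; otherwise the Hoelder bound |h|^\<beta>
  is weakened by (|h|/|y|)^\<tau> \<ge> 1.\<close>

lemma abs_powr_increment:
  fixes y h \<beta> \<tau> :: real
  assumes \<beta>: "0 < \<beta>" "\<beta> < 1" and \<tau>: "0 < \<tau>" "\<tau> \<le> 1 - \<beta>" and y: "y \<noteq> 0"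
  shows "\<bar>\<bar>y + h\<bar> powr \<beta> - \<bar>y\<bar> powr \<beta>\<bar> \<le> \<bar>h\<bar> powr (\<beta> + \<tau>) * \<bar>y\<bar> powr (-\<tau>)"
proof (cases "h = 0")
  case True
  then show ?thesis by simp
next
  case False
  define H where "H = \<bar>h\<bar>"
  define v where "v = \<bar>y\<bar>"
  define u where "u = \<bar>y + h\<bar>"
  have pos: "0 < H" "0 < v" "0 \<le> u" "\<bar>u - v\<bar> \<le> H" using False y by (auto simp: H_def v_def u_def)
  have "\<bar>u powr \<beta> - v powr \<beta>\<bar> \<le> H powr (\<beta> + \<tau>) * v powr (-\<tau>)"
  proof (cases "H \<le> v")
    case True
    have "\<bar>u powr \<beta> - v powr \<beta>\<bar> \<le> H * v powr (\<beta> - 1)"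
    proof -
      consider "u = v" | "v < u" | "u < v" by linarith
      then show ?thesis
      proof cases
        case 2
        have "v powr \<beta> \<le> u powr \<beta>" using 2 pos \<beta> by (intro powr_mono2) auto
        moreover have "u powr \<beta> - v powr \<beta> \<le> (u - v) * u powr (\<beta> - 1)" using 2 pos \<beta> by (intro powr_diff_le) auto
        moreover have "(u - v) * u powr (\<beta> - 1) \<le> H * v powr (\<beta> - 1)"
          using 2 pos \<beta> by (intro mult_mono powr_mono2') auto
        ultimately show ?thesis by simp
      next
        case 3
        have "u powr \<beta> \<le> v powr \<beta>" using 3 pos \<beta> by (intro powr_mono2) auto
        moreover have "v powr \<beta> - u powr \<beta> \<le> (v - u) * v powr (\<beta> - 1)" using 3 pos \<beta> by (intro powr_diff_le) auto
        moreover have "(v - u) * v powr (\<beta> - 1) \<le> H * v powr (\<beta> - 1)"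
          using 3 pos by (intro mult_right_mono) auto
        ultimately show ?thesis by simp
      qed (use pos in simp)
    qed
    also have "H * v powr (\<beta> - 1) = H powr (\<beta> + \<tau>) * v powr (-\<tau>) * (H / v) powr (1 - \<beta> - \<tau>)"
    proof -
      have "H = H powr (\<beta> + \<tau>) * H powr (1 - \<beta> - \<tau>)" using pos by (simp add: powr_add[symmetric])
      moreover have "v powr (\<beta> - 1) = v powr (-\<tau>) / v powr (1 - \<beta> - \<tau>)" using pos by (simp add: powr_diff[symmetric])
      ultimately show ?thesis using pos by (simp add: powr_divide)
    qed
    also have "\<dots> \<le> H powr (\<beta> + \<tau>) * v powr (-\<tau>) * 1"
      using True pos \<tau> by (intro mult_left_mono powr_le1) auto
    finally show ?thesis by simp
  next
    case False
    have "\<bar>u powr \<beta> - v powr \<beta>\<bar> \<le> \<bar>u - v\<bar> powr \<beta>" using pos \<beta> by (intro powr_Holder) auto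
    also have "\<dots> \<le> H powr \<beta>" using pos \<beta> by (intro powr_mono2) auto
    also have "\<dots> \<le> H powr \<beta> * (H / v) powr \<tau>"
    proof -
      have "1 \<le> (H / v) powr \<tau>" using False pos \<tau> by (intro ge_one_powr_ge_zero) auto
      then show ?thesis using mult_left_mono[of 1 "(H / v) powr \<tau>" "H powr \<beta>"] by simp
    qed
    also have "\<dots> = H powr (\<beta> + \<tau>) * v powr (-\<tau>)"
      using pos by (simp add: powr_divide powr_add powr_minus field_simps)
    finally show ?thesis .
  qed
  then show ?thesis by (simp add: u_def v_def H_def)
qed

text \<open>Exhibits the corner of the barrier. The bound t \<le> 1 keeps the step below the
  truncation level R.\<close>

lemma small_power_dominates:
  fixes p K N :: real
  assumes "p < 2" "0 < N"
  shows "\<exists>t>0. t \<le> 1 \<and> K * t\<^sup>2 < N * t powr p"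
proof -
  define c where "c = N / (\<bar>K\<bar> + N)"
  have c: "0 < c" "c \<le> 1" using assms by (auto simp: c_def)
  define t where "t = c powr (1 / (2 - p))"
  have t: "0 < t" using c by (simp add: t_def)
  have "t \<le> 1" unfolding t_def using c assms by (intro powr_le1) auto
  have "t powr (2 - p) = c" using c assms by (simp add: t_def powr_powr)
  then have sq: "t\<^sup>2 = c * t powr p" using t by (simp add: powr_diff powr_numeral field_simps)
  have "\<bar>K\<bar> * c < N" unfolding c_def using assms by (simp add: field_simps)
  then have "K * c < N" using c mult_right_mono[of K "\<bar>K\<bar>" c] by linarith
  then have "K * t\<^sup>2 < N * t powr p" using t by (simp add: sq mult.assoc[symmetric])
  with t \<open>t \<le> 1\<close> show ?thesis by blast
qed

context fractional_order
begin

text \<open>Increments of the right-hand side across the singular line are \<open>O(|h|^(\<beta>+\<tau>) |x_2|^(-\<tau>))\<close>,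
  which the barrier absorbs; hence increments of the solution gain an exponent over \<open>\<beta>\<close>.\<close>

lemma dirichlet_solution_axial_increment:
  assumes w: "dirichlet_solution F w" and \<beta>: "0 < \<beta>" "\<beta> < s"
    and F: "\<And>x. x \<in> ball 0 1 \<Longrightarrow> F x = a (x $ 1) * \<bar>x $ 2\<bar> powr \<beta>"
    and a: "\<And>x :: real^2. x \<in> ball 0 1 \<Longrightarrow> \<bar>a (x $ 1)\<bar> \<le> A"
  shows "\<exists>\<sigma>>\<beta>. \<exists>C. \<forall>x h. \<bar>h\<bar> \<le> 1 \<longrightarrow> \<bar>w (x + h *\<^sub>R axis 2 1) - w x\<bar> \<le> C * \<bar>h\<bar> powr \<sigma>"
proof -
  define C0 where "C0 = (\<integral>t. kern t * min 1 (t\<^sup>2) \<partial>lborel)"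
  have C0: "0 \<le> C0" unfolding C0_def by (intro Bochner_Integration.integral_nonneg) (simp add: kern_nonneg)
  \<comment> \<open>The first bound gives \<tau> \<le> s and \<tau> < 1, the second is the smallness
    under which the barrier's gain beats its loss.\<close>
  define \<tau> where "\<tau> = min (s / 2) (1 / (4 * (64 * C0 + 1)))"
  have \<tau>: "0 < \<tau>" "\<tau> < 1" "\<tau> \<le> s" using s_pos s_less_1 C0 by (auto simp: \<tau>_def)
  have "\<tau> \<le> 1 / (4 * (64 * C0 + 1))" by (simp add: \<tau>_def)
  then have small: "64 * C0 + 1 \<le> 1 / (4 * \<tau>)" using \<tau> C0 by (simp add: field_simps)
  define R where "R = 4 * 2 powr (1 / \<tau>)"
  define p where "p = 2 * s - \<tau>"
  have p: "0 < p" "p < 2" using \<tau> s_pos s_less_1 by (auto simp: p_def)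
  have R4: "4 \<le> R" using \<tau> by (simp add: R_def ge_one_powr_ge_zero)
  note bar = trunc_pow_concave_barrier[OF \<tau> R_def small[unfolded C0_def], folded p_def]
  \<comment> \<open>The increment estimate for |x_2|^\<beta> requires \<tau>' \<le> 1 - \<beta>. In
    the disc |x_2| < 1, so the barrier with the larger \<tau> dominates |x_2|^(-\<tau>').\<close>
  define \<tau>' where "\<tau>' = min \<tau> (1 - \<beta>)"
  have \<tau>': "0 < \<tau>'" "\<tau>' \<le> \<tau>" "\<tau>' \<le> 1 - \<beta>" using \<tau> \<beta> s_less_1 by (auto simp: \<tau>'_def)
  \<comment> \<open>The boundary limits the exponent to s, the interior estimate to \<beta> +
    \<tau>'; both exceed \<beta>.\<close>
  define \<sigma> where "\<sigma> = min s (\<beta> + \<tau>')"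
  define B where "B = \<bar>A\<bar> + 1"
  have B: "0 < B" "\<And>x :: real^2. x \<in> ball 0 1 \<Longrightarrow> \<bar>a (x $ 1)\<bar> \<le> B"
  proof -
    show "0 < B" by (simp add: B_def add_nonneg_pos)
    show "\<bar>a (x $ 1)\<bar> \<le> B" if "x \<in> ball 0 1" for x :: "real^2" using a[OF that] unfolding B_def by linarith
  qed
  have even: "second_diff (trunc_pow p R) \<bar>y\<bar> t = second_diff (trunc_pow p R) y t" for y t
    by (simp add: second_diff_def trunc_pow_def abs_if) (smt (verit))
  have abs_lt_1: "\<bar>x $ 2\<bar> < 1" if "x \<in> ball 0 1" for x :: "real^2"
    using that component_le_norm_cart[of x 2] by auto
  have FB: "\<bar>F x\<bar> \<le> B" if x: "x \<in> ball 0 1" for x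
  proof -
    have "\<bar>x $ 2\<bar> powr \<beta> \<le> 1" using \<beta> abs_lt_1[OF x] by (intro powr_le1) auto
    then have "\<bar>a (x $ 1)\<bar> * \<bar>x $ 2\<bar> powr \<beta> \<le> B * 1" using B(1) B(2)[OF x] by (intro mult_mono) auto
    then show ?thesis using F[OF x] by (simp add: abs_mult)
  qed
  have main: "\<bar>w (x + h *\<^sub>R axis 2 1) - w x\<bar>
      \<le> B / torsion_const * (2 * \<bar>h\<bar>) powr s + B * \<bar>h\<bar> powr (\<beta> + \<tau>') * R powr p" if h: "h \<noteq> 0" for x h
  proof -
    define N where "N = B * \<bar>h\<bar> powr (\<beta> + \<tau>')"
    have N: "0 < N" using B(1) h by (simp add: N_def)
    define b where "b y = N * (R powr p - trunc_pow p R (y $ 2))" for y :: "real^2"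
    have b_sd: "second_diff2 b y t = - N * second_diff (trunc_pow p R) (y $ 2) t" for y t
      by (simp add: second_diff2_def second_diff_def b_def algebra_simps)
    have tp: "0 \<le> trunc_pow p R y" "trunc_pow p R y \<le> R powr p" for y
      using p R4 by (auto simp: trunc_pow_def intro!: powr_mono2)
    have "\<bar>w (x + h *\<^sub>R axis 2 1) - w x\<bar> \<le> B / torsion_const * (2 * norm (h *\<^sub>R axis 2 1 :: real^2)) powr s + b x"
    proof (rule dirichlet_solution_increment[OF w FB])
      show "continuous_on UNIV b" unfolding b_def trunc_pow_def using p R4
        by (intro continuous_intros continuous_on_powr') auto
      show "0 \<le> b x" for x unfolding b_def using tp[of "x $ 2"] N by simp
      fix y :: "real^2" assume y: "y \<in> ball 0 1" "y + h *\<^sub>R axis 2 1 \<in> ball 0 1"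
      show "(\<exists>g. solves_at b g y \<and> \<bar>F (y + h *\<^sub>R axis 2 1) - F y\<bar> \<le> g) \<or> (\<forall>K. \<exists>t>0. K * t\<^sup>2 < second_diff2 b y t)"
      proof (cases "y $ 2 = 0")
        \<comment> \<open>On the line itself the second difference of b is 2 N t^p with p < 2. This
          is the concave corner, handled by the second alternative.\<close>
        case True
        have "\<exists>t>0. K * t\<^sup>2 < second_diff2 b y t" for K
        proof -
          obtain t where t: "0 < t" "t \<le> 1" "K * t\<^sup>2 < (2 * N) * t powr p"
            using small_power_dominates[OF p(2), of "2 * N" K] N by auto
          have "second_diff2 b y t = (2 * N) * t powr p"
            unfolding b_sd True using t R4 p by (simp add: second_diff_def trunc_pow_def)
          with t show ?thesis by auto
        qed
        then show ?thesis by blast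
      next
        case False
        define v where "v = \<bar>y $ 2\<bar>"
        have v: "0 < v" "v < 1" using False abs_lt_1[OF y(1)] by (auto simp: v_def)
        define I where "I = (\<integral>t. kern t * second_diff (trunc_pow p R) v t \<partial>lborel)"
        have "has_bochner_integral lborel (\<lambda>t. - N * (kern t * second_diff (trunc_pow p R) v t)) (- N * I)"
          using bar(1)[OF v] by (intro has_bochner_integral_mult_right) (simp add: has_bochner_integral_iff I_def)
        then have sol: "solves_at b (- N * I) y"
          unfolding solves_at_def b_sd by (simp add: v_def even mult.left_commute)
        have "\<bar>F (y + h *\<^sub>R axis 2 1) - F y\<bar> = \<bar>a (y $ 1)\<bar> * \<bar>\<bar>y $ 2 + h\<bar> powr \<beta> - \<bar>y $ 2\<bar> powr \<beta>\<bar>"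
          using F[OF y(1)] F[OF y(2)] by (simp add: abs_mult right_diff_distrib[symmetric])
        also have "\<dots> \<le> B * (\<bar>h\<bar> powr (\<beta> + \<tau>') * v powr (-\<tau>'))"
          unfolding v_def using B \<beta> s_less_1 \<tau>' False y(1) by (intro mult_mono abs_powr_increment) auto
        also have "\<dots> = N * v powr (-\<tau>')" by (simp add: N_def)
        also have "\<dots> \<le> N * v powr (-\<tau>)"
          using N v \<tau>' by (intro mult_left_mono powr_mono') auto
        also have "\<dots> \<le> N * (- I)"
          using bar(2)[OF v] N by (intro mult_left_mono) (auto simp: I_def)
        finally show ?thesis using sol by auto
      qed
    qed
    also have "b x \<le> N * R powr p" unfolding b_def using tp[of "x $ 2"] N by (intro mult_left_mono) auto
    finally show ?thesis by (simp add: N_def norm_axis_1)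
  qed
  show ?thesis
  proof (intro exI conjI allI impI)
    show "\<beta> < \<sigma>" using \<beta> \<tau>' by (simp add: \<sigma>_def)
    fix x :: "real^2" and h :: real assume h: "\<bar>h\<bar> \<le> 1"
    show "\<bar>w (x + h *\<^sub>R axis 2 1) - w x\<bar> \<le> (B / torsion_const * 2 powr s + B * R powr p) * \<bar>h\<bar> powr \<sigma>"
    proof (cases "h = 0")
      case True
      then show ?thesis by simp
    next
      case False
      have "\<bar>h\<bar> powr s \<le> \<bar>h\<bar> powr \<sigma>" "\<bar>h\<bar> powr (\<beta> + \<tau>') \<le> \<bar>h\<bar> powr \<sigma>"
        using h by (auto simp: \<sigma>_def intro!: powr_mono')
      then have "B / torsion_const * 2 powr s * \<bar>h\<bar> powr s + B * R powr p * \<bar>h\<bar> powr (\<beta> + \<tau>')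
          \<le> B / torsion_const * 2 powr s * \<bar>h\<bar> powr \<sigma> + B * R powr p * \<bar>h\<bar> powr \<sigma>"
        using B(1) torsion_const(1) by (intro add_mono mult_left_mono) auto
      then show ?thesis using main[OF False, of x] by (simp add: powr_mult algebra_simps)
    qed
  qed
qed

end

section \<open>Third differences of Hoelder functions\<close>

definition third_diff :: "(real \<Rightarrow> real) \<Rightarrow> real \<Rightarrow> real" where
  "third_diff g l = g (2 * l) - 3 * g l + 3 * g 0 - g (- l)"

lemma third_diff_Holder_0:
  assumes l: "0 < l" and H: "\<And>t t'. t \<in> {-l..2 * l} \<Longrightarrow> t' \<in> {-l..2 * l} \<Longrightarrow> \<bar>g t - g t'\<bar> \<le> C * \<bar>t - t'\<bar> powr \<gamma>"
  shows "\<bar>third_diff g l\<bar> \<le> 4 * C * l powr \<gamma>"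
proof -
  have "\<bar>g (2 * l) - g l\<bar> \<le> C * l powr \<gamma>" "\<bar>g l - g 0\<bar> \<le> C * l powr \<gamma>" "\<bar>g 0 - g (-l)\<bar> \<le> C * l powr \<gamma>"
    using H[of "2 * l" l] H[of l 0] H[of 0 "-l"] l by auto
  then show ?thesis unfolding third_diff_def by linarith
qed

text \<open>The third difference is the increment over [0, l] of the centred second difference P, so
  one derivative is traded for a factor l.\<close>

lemma third_diff_MVT:
  assumes l: "0 < l" and d: "\<And>t. t \<in> {-l..2 * l} \<Longrightarrow> (g has_real_derivative g' t) (at t)"
  obtains \<xi> where "0 < \<xi>" "\<xi> < l" "third_diff g l = l * (g' (\<xi> + l) - 2 * g' \<xi> + g' (\<xi> - l))"
proof -
  define P where "P t = g (t + l) - 2 * g t + g (t - l)" for t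
  have "(P has_real_derivative g' (t + l) - 2 * g' t + g' (t - l)) (at t)" if "0 \<le> t" "t \<le> l" for t
  proof -
    have "((\<lambda>t. g (t + l)) has_real_derivative g' (t + l) * 1) (at t)"
      by (rule DERIV_chain2[OF d]) (use that l in \<open>auto intro!: derivative_eq_intros\<close>)
    moreover have "((\<lambda>t. g (t - l)) has_real_derivative g' (t - l) * 1) (at t)"
      by (rule DERIV_chain2[OF d]) (use that l in \<open>auto intro!: derivative_eq_intros\<close>)
    moreover have "(g has_real_derivative g' t) (at t)" using d that l by auto
    ultimately show ?thesis unfolding P_def[abs_def] by (auto intro!: derivative_eq_intros)
  qed
  from MVT2[OF l, of P, OF this] obtain \<xi> where "0 < \<xi>" "\<xi> < l"
    "P l - P 0 = (l - 0) * (g' (\<xi> + l) - 2 * g' \<xi> + g' (\<xi> - l))" by blast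
  moreover have "third_diff g l = P l - P 0" by (simp add: third_diff_def P_def)
  ultimately show thesis using that by simp
qed

lemma third_diff_Holder_1:
  assumes l: "0 < l" and d: "\<And>t. t \<in> {-l..2 * l} \<Longrightarrow> (g has_real_derivative g' t) (at t)"
    and H: "\<And>t t'. t \<in> {-l..2 * l} \<Longrightarrow> t' \<in> {-l..2 * l} \<Longrightarrow> \<bar>g' t - g' t'\<bar> \<le> C * \<bar>t - t'\<bar> powr \<gamma>"
  shows "\<bar>third_diff g l\<bar> \<le> 2 * C * l powr (1 + \<gamma>)"
proof -
  obtain \<xi> where \<xi>: "0 < \<xi>" "\<xi> < l" "third_diff g l = l * (g' (\<xi> + l) - 2 * g' \<xi> + g' (\<xi> - l))"
    using third_diff_MVT[OF l d] by blast
  have "\<bar>g' (\<xi> + l) - g' \<xi>\<bar> \<le> C * l powr \<gamma>" "\<bar>g' \<xi> - g' (\<xi> - l)\<bar> \<le> C * l powr \<gamma>"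
    using H[of "\<xi> + l" \<xi>] H[of \<xi> "\<xi> - l"] l \<xi> by auto
  then have "\<bar>g' (\<xi> + l) - 2 * g' \<xi> + g' (\<xi> - l)\<bar> \<le> 2 * (C * l powr \<gamma>)" by linarith
  then have "l * \<bar>g' (\<xi> + l) - 2 * g' \<xi> + g' (\<xi> - l)\<bar> \<le> l * (2 * (C * l powr \<gamma>))"
    using l by (intro mult_left_mono) auto
  then show ?thesis using l \<xi>(3) by (simp add: abs_mult powr_add mult_ac)
qed

lemma third_diff_Holder_2:
  assumes l: "0 < l" and d: "\<And>t. t \<in> {-l..2 * l} \<Longrightarrow> (g has_real_derivative g' t) (at t)"
    and d': "\<And>t. t \<in> {-l..2 * l} \<Longrightarrow> (g' has_real_derivative g'' t) (at t)"
    and H: "\<And>t t'. t \<in> {-l..2 * l} \<Longrightarrow> t' \<in> {-l..2 * l} \<Longrightarrow> \<bar>g'' t - g'' t'\<bar> \<le> C * \<bar>t - t'\<bar> powr \<gamma>"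
  shows "\<bar>third_diff g l\<bar> \<le> C * l powr (2 + \<gamma>)"
proof -
  obtain \<xi> where \<xi>: "0 < \<xi>" "\<xi> < l" "third_diff g l = l * (g' (\<xi> + l) - 2 * g' \<xi> + g' (\<xi> - l))"
    using third_diff_MVT[OF l d] by blast
  define S where "S t = g' t - g' (t - l)" for t
  have "(S has_real_derivative g'' t - g'' (t - l)) (at t)" if "\<xi> \<le> t" "t \<le> \<xi> + l" for t
  proof -
    have "((\<lambda>t. g' (t - l)) has_real_derivative g'' (t - l) * 1) (at t)"
      by (rule DERIV_chain2[OF d']) (use that l \<xi> in \<open>auto intro!: derivative_eq_intros\<close>)
    moreover have "(g' has_real_derivative g'' t) (at t)" using d' that l \<xi> by auto
    ultimately show ?thesis unfolding S_def[abs_def] by (auto intro!: derivative_eq_intros)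
  qed
  from MVT2[of \<xi> "\<xi> + l" S, OF _ this] obtain \<zeta> where \<zeta>: "\<xi> < \<zeta>" "\<zeta> < \<xi> + l"
    "S (\<xi> + l) - S \<xi> = (\<xi> + l - \<xi>) * (g'' \<zeta> - g'' (\<zeta> - l))" using l by auto
  have "\<bar>g'' \<zeta> - g'' (\<zeta> - l)\<bar> \<le> C * l powr \<gamma>"
    using H[of \<zeta> "\<zeta> - l"] l \<xi> \<zeta> by auto
  then have "(l * l) * \<bar>g'' \<zeta> - g'' (\<zeta> - l)\<bar> \<le> (l * l) * (C * l powr \<gamma>)"
    using l by (intro mult_left_mono) auto
  moreover have "third_diff g l = (l * l) * (g'' \<zeta> - g'' (\<zeta> - l))"
  proof -
    have "g' (\<xi> + l) - 2 * g' \<xi> + g' (\<xi> - l) = l * (g'' \<zeta> - g'' (\<zeta> - l))"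
      using \<zeta>(3) by (simp add: S_def)
    then show ?thesis using \<xi>(3) by simp
  qed
  moreover have "l powr (2 + \<gamma>) = (l * l) * l powr \<gamma>"
    using l by (simp add: powr_add powr_numeral power2_eq_square)
  ultimately show ?thesis using l by (simp add: abs_mult mult_ac)
qed

text \<open>Third differences annihilate quadratic polynomials, so they detect every exponent below
  3 by one power of l, whether k is 0, 1 or 2. The exponent to be refuted is \<alpha> + 2s \<le> 3s
  < 3, which is why order three is the right one.\<close>

lemma holder_space_third_diff:
  fixes u :: "real^2 \<Rightarrow> real"
  assumes u: "u \<in> holder_space \<gamma> S" and \<gamma>: "\<gamma> < 3"
  shows "\<exists>C. \<forall>x l. 0 < l \<longrightarrow> (\<forall>t\<in>{-l..2 * l}. x + t *\<^sub>R axis 2 1 \<in> S) \<longrightarrow>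
    \<bar>third_diff (\<lambda>t. u (x + t *\<^sub>R axis 2 1)) l\<bar> \<le> C * l powr \<gamma>"
proof -
  obtain k \<gamma>' where k: "\<gamma> = real k + \<gamma>'" "0 < \<gamma>'" and Ck: "Ck_on k S u"
    and Hl: "\<forall>is. length is = k \<longrightarrow> (\<exists>C. \<forall>x\<in>S. \<forall>y\<in>S. \<bar>iter_partial is u x - iter_partial is u y\<bar> \<le> C * dist x y powr \<gamma>')"
    using u unfolding holder_space_def by blast
  define D where "D j = iter_partial (replicate j 2) u" for j
  have "length (replicate k (2::2)) = k" by simp
  then obtain C where C: "\<And>x y. x \<in> S \<Longrightarrow> y \<in> S \<Longrightarrow> \<bar>D k x - D k y\<bar> \<le> C * dist x y powr \<gamma>'"
    using Hl unfolding D_def by blast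
  have d: "((\<lambda>t. D j (x + t *\<^sub>R axis 2 1)) has_real_derivative D (Suc j) (x + t *\<^sub>R axis 2 1)) (at t)"
    if "j < k" "x + t *\<^sub>R axis 2 1 \<in> S" for j x t
  proof -
    have "length (replicate j (2::2)) < k" using that by simp
    then have "D j differentiable (at (x + t *\<^sub>R axis 2 1))"
      using Ck that(2) unfolding Ck_on_def D_def by blast
    from differentiable_partial_deriv[OF this] show ?thesis by (simp add: D_def)
  qed
  have dist: "dist (x + t *\<^sub>R axis 2 1) (x + t' *\<^sub>R axis 2 1 :: real^2) = \<bar>t - t'\<bar>" for x t t'
    by (simp add: dist_norm norm_axis_1 flip: scaleR_left_diff_distrib)
  have D0: "D 0 = u" by (simp add: D_def)
  have "k \<le> 2" using k \<gamma> by simp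
  then consider "k = 0" | "k = 1" | "k = 2" by linarith
  then have "\<exists>c. \<forall>x l. 0 < l \<longrightarrow> (\<forall>t\<in>{-l..2 * l}. x + t *\<^sub>R axis 2 1 \<in> S) \<longrightarrow>
    \<bar>third_diff (\<lambda>t. u (x + t *\<^sub>R axis 2 1)) l\<bar> \<le> c * C * l powr (real k + \<gamma>')"
  proof cases
    case 1
    have "\<bar>third_diff (\<lambda>t. u (x + t *\<^sub>R axis 2 1)) l\<bar> \<le> 4 * C * l powr \<gamma>'"
      if "0 < l" "\<forall>t\<in>{-l..2 * l}. x + t *\<^sub>R axis 2 1 \<in> S" for x l
    proof (rule third_diff_Holder_0[OF that(1)])
      fix t t' assume "t \<in> {-l..2 * l}" "t' \<in> {-l..2 * l}"
      then show "\<bar>u (x + t *\<^sub>R axis 2 1) - u (x + t' *\<^sub>R axis 2 1)\<bar> \<le> C * \<bar>t - t'\<bar> powr \<gamma>'"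
        using C[of "x + t *\<^sub>R axis 2 1" "x + t' *\<^sub>R axis 2 1"] that(2) by (simp add: 1 D0 dist)
    qed
    then show ?thesis using 1 by (intro exI[of _ 4]) simp
  next
    case 2
    have "\<bar>third_diff (\<lambda>t. u (x + t *\<^sub>R axis 2 1)) l\<bar> \<le> 2 * C * l powr (1 + \<gamma>')"
      if "0 < l" "\<forall>t\<in>{-l..2 * l}. x + t *\<^sub>R axis 2 1 \<in> S" for x l
    proof (rule third_diff_Holder_1[OF that(1)])
      fix t assume t: "t \<in> {-l..2 * l}"
      show "((\<lambda>t. u (x + t *\<^sub>R axis 2 1)) has_real_derivative D 1 (x + t *\<^sub>R axis 2 1)) (at t)"
        using d[of 0 x t] t that(2) 2 by (simp add: D0)
      fix t' assume "t' \<in> {-l..2 * l}"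
      then show "\<bar>D 1 (x + t *\<^sub>R axis 2 1) - D 1 (x + t' *\<^sub>R axis 2 1)\<bar> \<le> C * \<bar>t - t'\<bar> powr \<gamma>'"
        using C[of "x + t *\<^sub>R axis 2 1" "x + t' *\<^sub>R axis 2 1"] t that(2) by (simp add: 2 dist)
    qed
    then show ?thesis using 2 by (intro exI[of _ 2]) simp
  next
    case 3
    have "\<bar>third_diff (\<lambda>t. u (x + t *\<^sub>R axis 2 1)) l\<bar> \<le> C * l powr (2 + \<gamma>')"
      if "0 < l" "\<forall>t\<in>{-l..2 * l}. x + t *\<^sub>R axis 2 1 \<in> S" for x l
    proof (rule third_diff_Holder_2[OF that(1)])
      fix t assume t: "t \<in> {-l..2 * l}"
      show "((\<lambda>t. u (x + t *\<^sub>R axis 2 1)) has_real_derivative D 1 (x + t *\<^sub>R axis 2 1)) (at t)"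
        using d[of 0 x t] t that(2) 3 by (simp add: D0)
      show "((\<lambda>t. D 1 (x + t *\<^sub>R axis 2 1)) has_real_derivative D 2 (x + t *\<^sub>R axis 2 1)) (at t)"
        using d[of 1 x t] t that(2) 3 by (simp add: numeral_2_eq_2)
      fix t' assume "t' \<in> {-l..2 * l}"
      then show "\<bar>D 2 (x + t *\<^sub>R axis 2 1) - D 2 (x + t' *\<^sub>R axis 2 1)\<bar> \<le> C * \<bar>t - t'\<bar> powr \<gamma>'"
        using C[of "x + t *\<^sub>R axis 2 1" "x + t' *\<^sub>R axis 2 1"] t that(2) by (simp add: 3 dist)
    qed
    then show ?thesis using 3 by (intro exI[of _ 1]) simp
  qed
  then show ?thesis using k(1) by blast
qed

section \<open>Failure of higher regularity\<close>

definition bump :: "real \<Rightarrow> real" where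
  "bump y = (max 0 (1 - y\<^sup>2))\<^sup>2"

lemma bump_nonneg: "0 \<le> bump y" and bump_le_1: "bump y \<le> 1"
  by (auto simp: bump_def power_le_one)

lemma bump_zero: "1 \<le> \<bar>y\<bar> \<Longrightarrow> bump y = 0"
  using abs_le_square_iff[of 1 y] by (simp add: bump_def max_def)

lemma bump_ge: "\<bar>y\<bar> \<le> 1 / 2 \<Longrightarrow> 9 / 16 \<le> bump y"
proof -
  assume "\<bar>y\<bar> \<le> 1 / 2"
  then have "y\<^sup>2 \<le> (1 / 2)\<^sup>2" using abs_le_square_iff[of y "1 / 2"] by simp
  then have "y\<^sup>2 \<le> 1 / 4" by (simp add: power_divide)
  then have "3 / 4 \<le> max 0 (1 - y\<^sup>2)" unfolding le_max_iff_disj by linarith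
  then have "(3 / 4)\<^sup>2 \<le> (max 0 (1 - y\<^sup>2))\<^sup>2" by (rule power_mono) simp
  then show ?thesis by (simp add: bump_def power_divide)
qed

lemma continuous_on_bump: "continuous_on S f \<Longrightarrow> continuous_on S (\<lambda>x. bump (f x))"
  unfolding bump_def by (intro continuous_intros)

lemma positive_part_square_deriv: "((\<lambda>u::real. (max 0 u)\<^sup>2) has_real_derivative 2 * max 0 u) (at u)"
proof -
  consider "u < 0" | "u = 0" | "0 < u" by linarith
  then show ?thesis
  proof cases
    case 1
    have "((\<lambda>u::real. 0) has_real_derivative 2 * max 0 u) (at u)" using 1 by (simp add: max_def)
    then show ?thesis
      by (rule has_field_derivative_transform_within_open[of _ _ _ "{..<0}"]) (use 1 in auto)
  next
    case 2
    have "((\<lambda>h. ((max 0 (u + h))\<^sup>2 - (max 0 u)\<^sup>2) / h) \<longlongrightarrow> 0) (at 0)"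
    proof (rule Lim_null_comparison)
      show "\<forall>\<^sub>F h in at 0. norm (((max 0 (u + h))\<^sup>2 - (max 0 u)\<^sup>2) / h) \<le> \<bar>h\<bar>"
        by (intro always_eventually) (auto simp: 2 max_def power2_eq_square abs_mult)
      show "((\<lambda>h::real. \<bar>h\<bar>) \<longlongrightarrow> 0) (at 0)" by (intro tendsto_eq_intros) auto
    qed
    then show ?thesis by (simp add: 2 DERIV_def)
  next
    case 3
    have "((\<lambda>u::real. u\<^sup>2) has_real_derivative 2 * max 0 u) (at u)"
      using 3 by (auto intro!: derivative_eq_intros)
    then show ?thesis
      by (rule has_field_derivative_transform_within_open[of _ _ _ "{0<..}"]) (use 3 in auto)
  qed
qed

lemma bump_deriv: "(bump has_real_derivative - 4 * (y * max 0 (1 - y\<^sup>2))) (at y)"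
proof -
  have "((\<lambda>y. 1 - y\<^sup>2) has_real_derivative - 2 * y) (at y)" by (auto intro!: derivative_eq_intros)
  from DERIV_chain2[OF positive_part_square_deriv this] show ?thesis
    unfolding bump_def[abs_def] by (simp add: mult_ac)
qed

lemma bump_deriv_Lipschitz:
  fixes x y :: real
  shows
  "\<bar>- 4 * (x * max 0 (1 - x\<^sup>2)) - (- 4 * (y * max 0 (1 - y\<^sup>2)))\<bar> \<le> 8 * \<bar>x - y\<bar>"
proof -
  \<comment> \<open>Clamping to [-1, 1] replaces the positive part by the cubic c - c^3, since the
    clamped value has square 1 outside. On [-1, 1] this cubic has Lipschitz constant 2.\<close>
  define c where "c z = max (-1) (min 1 z)" for z :: real
  have eq: "z * max 0 (1 - z\<^sup>2) = c z * (1 - (c z)\<^sup>2)" for z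
  proof (cases "\<bar>z\<bar> \<le> 1")
    case True
    then have "z\<^sup>2 \<le> 1" "c z = z" by (auto simp: abs_square_le_1 c_def)
    then show ?thesis by simp
  next
    case False
    then have "1 \<le> z\<^sup>2" using abs_le_square_iff[of 1 z] by simp
    moreover have "(c z)\<^sup>2 = 1" using False by (auto simp: c_def max_def min_def)
    ultimately show ?thesis by (simp add: max_def)
  qed
  have c1: "\<bar>c x\<bar> \<le> 1" "\<bar>c y\<bar> \<le> 1" by (auto simp: c_def)
  have sq: "(c x)\<^sup>2 \<le> 1" "(c y)\<^sup>2 \<le> 1" using c1 by (auto simp: abs_square_le_1)
  have "\<bar>c x * c y\<bar> \<le> 1" using mult_mono[OF c1] by (simp add: abs_mult)
  moreover have "0 \<le> (c x)\<^sup>2 + c x * c y + (c y)\<^sup>2"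
  proof -
    have "0 \<le> ((c x)\<^sup>2 + (c y)\<^sup>2 + (c x + c y)\<^sup>2) / 2" by simp
    also have "\<dots> = (c x)\<^sup>2 + c x * c y + (c y)\<^sup>2"
      by (simp add: power2_eq_square field_simps)
    finally show ?thesis .
  qed
  ultimately have "\<bar>1 - ((c x)\<^sup>2 + c x * c y + (c y)\<^sup>2)\<bar> \<le> 2" using sq by (simp add: abs_le_iff)
  then have "\<bar>c x - c y\<bar> * \<bar>1 - ((c x)\<^sup>2 + c x * c y + (c y)\<^sup>2)\<bar> \<le> \<bar>x - y\<bar> * 2"
    by (intro mult_mono) (auto simp: c_def max_def min_def)
  moreover have "c x * (1 - (c x)\<^sup>2) - c y * (1 - (c y)\<^sup>2) = (c x - c y) * (1 - ((c x)\<^sup>2 + c x * c y + (c y)\<^sup>2))"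
    by (simp add: power2_eq_square algebra_simps)
  ultimately have "\<bar>c x * (1 - (c x)\<^sup>2) - c y * (1 - (c y)\<^sup>2)\<bar> \<le> 2 * \<bar>x - y\<bar>"
    by (simp add: abs_mult mult.commute)
  then show ?thesis unfolding eq by linarith
qed

lemma bump_second_diff: "\<bar>second_diff bump y t\<bar> \<le> 16 * min 1 (t\<^sup>2)" if "0 < t"
proof -
  have "\<bar>second_diff bump y t\<bar> \<le> 2 * 8 * t\<^sup>2"
    by (rule second_diff_le_Lipschitz[OF that bump_deriv bump_deriv_Lipschitz])
  moreover have "\<bar>second_diff bump y t\<bar> \<le> 16"
    using bump_nonneg[of y] bump_nonneg[of "y + t"] bump_nonneg[of "y - t"]
      bump_le_1[of y] bump_le_1[of "y + t"] bump_le_1[of "y - t"]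
    unfolding second_diff_def by linarith
  ultimately show ?thesis by (simp add: min_def)
qed

definition slab :: "real \<Rightarrow> real \<Rightarrow> real \<Rightarrow> (real^2) set" where
  "slab A B c = {x. \<bar>x $ 1\<bar> \<le> A \<and> \<bar>x $ 2 - c\<bar> \<le> B}"

lemma slab_eq_cbox: "slab A B c = cbox (vector [-A, c - B]) (vector [A, c + B])"
  by (auto simp: slab_def mem_box_cart forall_2 vector_2 abs_le_iff)

lemma slab_measurable [measurable]: "slab A B c \<in> sets borel"
  unfolding slab_eq_cbox by simp

lemma slab_integral:
  assumes "0 < A" "0 < B"
  shows "has_bochner_integral lborel (\<lambda>x. K * indicator (slab A B c) x) (K * (4 * A * B))"
proof -
  have "slab A B c \<noteq> {}" using assms by (auto simp: slab_def intro!: exI[of _ "vector [0, c]"] simp: vector_2)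
  then have "measure lborel (slab A B c) = 4 * A * B"
    unfolding slab_eq_cbox by (simp add: content_cbox_cart UNIV_2 vector_2)
  moreover have "emeasure lborel (slab A B c) < \<infinity>" unfolding slab_eq_cbox by (rule emeasure_lborel_cbox_finite)
  ultimately have "has_bochner_integral lborel (indicator (slab A B c) :: real^2 \<Rightarrow> real) (4 * A * B)"
    using has_bochner_integral_real_indicator[of "slab A B c" lborel] by simp
  then show ?thesis by (rule has_bochner_integral_mult_right)
qed

text \<open>The width shrinks only across the line. Along it the bump is fixed, so the x_1 part of
  the operator stays bounded while the x_2 part scales like l^(-2s).\<close>

definition plane_bump :: "real \<Rightarrow> real^2 \<Rightarrow> real" where
  "plane_bump l x = bump (8 * x $ 1) * bump (x $ 2 / l)"

lemma plane_bump_nonneg: "0 \<le> plane_bump l x"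
  by (simp add: plane_bump_def bump_nonneg)

lemma plane_bump_supp:
  assumes "plane_bump l x \<noteq> 0" "0 < l"
  shows "\<bar>x $ 1\<bar> < 1 / 8" "\<bar>x $ 2\<bar> < l"
proof -
  have "\<bar>8 * x $ 1\<bar> < 1" "\<bar>x $ 2 / l\<bar> < 1"
    using assms bump_zero[of "8 * x $ 1"] bump_zero[of "x $ 2 / l"] unfolding plane_bump_def by force+
  then show "\<bar>x $ 1\<bar> < 1 / 8" "\<bar>x $ 2\<bar> < l" using assms by (auto simp: abs_less_iff field_simps)
qed

lemma plane_bump_second_diff2:
  "second_diff2 (plane_bump l) x t = bump (x $ 2 / l) * second_diff bump (8 * x $ 1) (8 * t)
    + bump (8 * x $ 1) * second_diff bump (x $ 2 / l) (t / l)"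
  by (simp add: second_diff2_def second_diff_def plane_bump_def add_divide_distrib diff_divide_distrib algebra_simps)

text \<open>The x_1 differences remain in the strip |x_2| \<le> l but may spread along all of it;
  the x_2 differences remain over |x_1| \<le> 1/8, in a slab and its two translates. The factor 1024
  is 16 times the square of the scale 8.\<close>

lemma plane_bump_second_diff2_parts:
  assumes "0 < t" "0 < l"
  shows "\<bar>bump (x $ 2 / l) * second_diff bump (8 * x $ 1) (8 * t)\<bar> \<le> 1024 * min 1 (t\<^sup>2) * indicator {-l..l} (x $ 2)"
    and "\<bar>bump (8 * x $ 1) * second_diff bump (x $ 2 / l) (t / l)\<bar> \<le> 16 * min 1 ((t / l)\<^sup>2) *
      (indicator (slab (1 / 8) l 0) x + indicator (slab (1 / 8) l t) x + indicator (slab (1 / 8) l (- t)) x)"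
proof -
  have b: "\<bar>second_diff bump (8 * x $ 1) (8 * t)\<bar> \<le> 1024 * min 1 (t\<^sup>2)"
  proof -
    have "min 1 ((8 * t)\<^sup>2) \<le> 64 * min 1 (t\<^sup>2)" by (simp add: min_def power_mult_distrib)
    then show ?thesis using bump_second_diff[of "8 * t" "8 * x $ 1"] assms by linarith
  qed
  show "\<bar>bump (x $ 2 / l) * second_diff bump (8 * x $ 1) (8 * t)\<bar> \<le> 1024 * min 1 (t\<^sup>2) * indicator {-l..l} (x $ 2)"
  proof (cases "x $ 2 \<in> {-l..l}")
    case True
    have "\<bar>bump (x $ 2 / l)\<bar> * \<bar>second_diff bump (8 * x $ 1) (8 * t)\<bar> \<le> 1 * (1024 * min 1 (t\<^sup>2))"
      using b bump_nonneg bump_le_1 by (intro mult_mono) auto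
    then show ?thesis using True by (simp add: abs_mult)
  next
    case False
    then have "1 \<le> \<bar>x $ 2 / l\<bar>" using assms by (auto simp: abs_divide le_divide_eq abs_le_iff)
    then show ?thesis using bump_zero by (simp add: False)
  qed
  define J where "J = (indicator (slab (1 / 8) l 0) x + indicator (slab (1 / 8) l t) x + indicator (slab (1 / 8) l (- t)) x :: real)"
  have J0: "0 \<le> J" by (simp add: J_def)
  show "\<bar>bump (8 * x $ 1) * second_diff bump (x $ 2 / l) (t / l)\<bar> \<le> 16 * min 1 ((t / l)\<^sup>2) *
      (indicator (slab (1 / 8) l 0) x + indicator (slab (1 / 8) l t) x + indicator (slab (1 / 8) l (- t)) x)"
    unfolding J_def[symmetric]
  proof (cases "bump (8 * x $ 1) * second_diff bump (x $ 2 / l) (t / l) = 0")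
    case True
    then show "\<bar>bump (8 * x $ 1) * second_diff bump (x $ 2 / l) (t / l)\<bar> \<le> 16 * min 1 ((t / l)\<^sup>2) * J"
      unfolding True using J0 by (simp add: mult_nonneg_nonneg)
  next
    case False
    have "\<bar>8 * x $ 1\<bar> < 1" using False bump_zero[of "8 * x $ 1"] by force
    then have x1: "\<bar>x $ 1\<bar> \<le> 1 / 8" by simp
    have "\<bar>x $ 2 / l\<bar> < 1 \<or> \<bar>x $ 2 / l + t / l\<bar> < 1 \<or> \<bar>x $ 2 / l - t / l\<bar> < 1"
    proof (rule ccontr)
      assume "\<not> ?thesis"
      then have "second_diff bump (x $ 2 / l) (t / l) = 0"
        unfolding second_diff_def by (simp add: bump_zero not_less)
      then show False using False by simp
    qed
    then have "\<bar>x $ 2\<bar> < l \<or> \<bar>x $ 2 + t\<bar> < l \<or> \<bar>x $ 2 - t\<bar> < l"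
      using assms by (simp add: abs_divide flip: add_divide_distrib diff_divide_distrib)
    then have "1 \<le> J" using x1 by (auto simp: J_def slab_def indicator_def)
    moreover have "\<bar>bump (8 * x $ 1)\<bar> * \<bar>second_diff bump (x $ 2 / l) (t / l)\<bar> \<le> 1 * (16 * min 1 ((t / l)\<^sup>2))"
      using assms bump_nonneg bump_le_1 by (intro mult_mono bump_second_diff) auto
    ultimately show "\<bar>bump (8 * x $ 1) * second_diff bump (x $ 2 / l) (t / l)\<bar> \<le> 16 * min 1 ((t / l)\<^sup>2) * J"
      using mult_left_mono[of 1 J "16 * min 1 ((t / l)\<^sup>2)"] by (simp add: abs_mult)
  qed
qed

lemma norm_le_components_2: "norm (x :: real^2) \<le> \<bar>x $ 1\<bar> + \<bar>x $ 2\<bar>"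
  using norm_le_l1_cart[of x] by (simp add: sum_2)

lemma plane_bump_continuous: "continuous_on UNIV (plane_bump l)" if "0 < l"
  unfolding plane_bump_def using that by (intro continuous_intros continuous_on_bump) auto

lemma plane_bump_C11:
  assumes l: "0 < l" "l \<le> 1 / 8"
  shows "C11_bump (1 / 4) (plane_bump l)"
  unfolding C11_bump_def
proof (intro conjI exI allI impI)
  show "continuous_on UNIV (plane_bump l)" using l by (intro plane_bump_continuous)
  show "plane_bump l x = 0" if "1 / 4 < norm x" for x
    using plane_bump_supp[of l x] norm_le_components_2[of x] l that by force
  show "\<bar>second_diff2 (plane_bump l) x t\<bar> \<le> (1024 + 48 / l\<^sup>2) * t\<^sup>2" if t: "0 < t" for x t
  proof -
    have "1024 * min 1 (t\<^sup>2) * indicator {-l..l} (x $ 2) \<le> 1024 * t\<^sup>2" by (simp add: indicator_def)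
    moreover have "16 * min 1 ((t / l)\<^sup>2) * (indicator (slab (1 / 8) l 0) x + indicator (slab (1 / 8) l t) x + indicator (slab (1 / 8) l (- t)) x)
        \<le> 16 * (t / l)\<^sup>2 * 3"
      by (intro mult_mono) (auto simp: indicator_def)
    ultimately have "\<bar>second_diff2 (plane_bump l) x t\<bar> \<le> 1024 * t\<^sup>2 + 16 * (t / l)\<^sup>2 * 3"
      unfolding plane_bump_second_diff2 using plane_bump_second_diff2_parts[OF t l(1), of x] by linarith
    then show ?thesis by (simp add: power_divide distrib_right)
  qed
qed

lemma plane_bump_integral_ge:
  assumes l: "0 < l" "l \<le> 1 / 8"
  shows "81 / 2048 * l \<le> (\<integral>x. plane_bump l x \<partial>lborel)"
proof -
  have int: "integrable lborel (plane_bump l)"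
    using plane_bump_C11[OF l] by (intro integrable_compact_support[of _ "1 / 4"]) (auto simp: C11_bump_def)
  \<comment> \<open>On this inner rectangle of area l/8 both factors of the bump are at least
    9/16.\<close>
  have b: "has_bochner_integral lborel (\<lambda>x. 81 / 256 * indicator (slab (1 / 16) (l / 2) 0) x) (81 / 256 * (4 * (1 / 16) * (l / 2)))"
    using l by (intro slab_integral) auto
  have "(\<integral>x. 81 / 256 * indicator (slab (1 / 16) (l / 2) 0) x \<partial>lborel) \<le> (\<integral>x. plane_bump l x \<partial>lborel)"
  proof (rule integral_mono[OF _ int])
    fix x :: "real^2"
    show "81 / 256 * indicator (slab (1 / 16) (l / 2) 0) x \<le> plane_bump l x"
    proof (cases "x \<in> slab (1 / 16) (l / 2) 0")
      case True
      then have "\<bar>8 * x $ 1\<bar> \<le> 1 / 2" "\<bar>x $ 2 / l\<bar> \<le> 1 / 2"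
        using l by (auto simp: slab_def abs_le_iff field_simps)
      then have "9 / 16 * (9 / 16) \<le> plane_bump l x"
        unfolding plane_bump_def by (intro mult_mono bump_ge bump_nonneg) auto
      then show ?thesis using True by simp
    qed (simp add: plane_bump_nonneg)
  qed (use b in \<open>simp add: has_bochner_integral_iff\<close>)
  then show ?thesis using b by (simp add: has_bochner_integral_iff)
qed

text \<open>For l = 1 and y = 0 the value is 2^\<beta> - 4 < -2. Moving y by at most \<omega> costs
  1/2 through \<omega>^\<beta> \<le> 1/6 and 1/2 through \<omega> \<le> 1/10, which leaves -1;
  homogeneity gives every l.\<close>

lemma third_diff_abs_powr:
  fixes \<beta> :: real
  assumes \<beta>: "0 < \<beta>" "\<beta> < 1"
  obtains \<omega> where "0 < \<omega>" "\<omega> \<le> 1" "\<And>y l. 0 < l \<Longrightarrow> \<bar>y\<bar> \<le> \<omega> * l \<Longrightarrow> third_diff (\<lambda>t. \<bar>y + t\<bar> powr \<beta>) l \<le> - (l powr \<beta>)"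
proof -
  define \<omega> where "\<omega> = min (1 / 10) ((1 / 6) powr (1 / \<beta>))"
  have \<omega>: "0 < \<omega>" "\<omega> \<le> 1 / 10" by (auto simp: \<omega>_def)
  have "\<omega> powr \<beta> \<le> ((1 / 6) powr (1 / \<beta>)) powr \<beta>"
    using \<omega> \<beta> by (intro powr_mono2) (auto simp: \<omega>_def)
  then have \<omega>\<beta>: "\<omega> powr \<beta> \<le> 1 / 6" using \<beta> by (simp add: powr_powr)
  have "third_diff (\<lambda>t. \<bar>y + t\<bar> powr \<beta>) l \<le> - (l powr \<beta>)" if l: "0 < l" and y: "\<bar>y\<bar> \<le> \<omega> * l" for y l
  proof -
    define v where "v = y / l"
    have v: "\<bar>v\<bar> \<le> \<omega>" using l y by (simp add: v_def abs_divide divide_le_eq)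
    have scale: "\<bar>y + c * l\<bar> powr \<beta> = l powr \<beta> * \<bar>v + c\<bar> powr \<beta>" for c
    proof -
      have "\<bar>y + c * l\<bar> = l * \<bar>v + c\<bar>" using l abs_mult[of l "v + c"] by (simp add: v_def distrib_left mult.commute[of c])
      then show ?thesis using l by (simp add: powr_mult)
    qed
    have "third_diff (\<lambda>t. \<bar>y + t\<bar> powr \<beta>) l = l powr \<beta> * (\<bar>v + 2\<bar> powr \<beta> - 3 * \<bar>v + 1\<bar> powr \<beta> + 3 * \<bar>v + 0\<bar> powr \<beta> - \<bar>v + -1\<bar> powr \<beta>)"
      unfolding third_diff_def using scale[of 2] scale[of 1] scale[of 0] scale[of "-1"] by (simp add: algebra_simps)
    moreover have "\<bar>v + 2\<bar> powr \<beta> - 3 * \<bar>v + 1\<bar> powr \<beta> + 3 * \<bar>v + 0\<bar> powr \<beta> - \<bar>v + -1\<bar> powr \<beta> \<le> -1"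
    proof -
      have "\<bar>v + 2\<bar> powr \<beta> \<le> \<bar>v + 2\<bar> powr 1" using v \<omega> \<beta> by (intro powr_mono) auto
      moreover have "\<bar>v + 0\<bar> powr \<beta> \<le> \<omega> powr \<beta>" using v \<beta> by (intro powr_mono2) auto
      moreover have "1 - \<omega> \<le> z powr \<beta>" if "1 - \<omega> \<le> z" for z
      proof -
        have "(1 - \<omega>) powr 1 \<le> (1 - \<omega>) powr \<beta>" using \<omega> \<beta> by (intro powr_mono') auto
        also have "\<dots> \<le> z powr \<beta>" using that \<omega> \<beta> by (intro powr_mono2) auto
        finally show ?thesis using \<omega> by simp
      qed
      then have "1 - \<omega> \<le> \<bar>v + 1\<bar> powr \<beta>" "1 - \<omega> \<le> \<bar>v + -1\<bar> powr \<beta>" using v \<omega> by auto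
      moreover have "\<bar>v + 2\<bar> powr 1 \<le> 2 + \<omega>" using v \<omega> by simp
      ultimately show ?thesis using \<omega>\<beta> \<omega> by linarith
    qed
    ultimately show ?thesis using mult_left_mono[of _ "-1" "l powr \<beta>"] by force
  qed
  with \<omega> show thesis by (intro that[of \<omega>]) auto
qed

section \<open>Testing the equation for third differences\<close>

context fractional_order
begin

lemma weak_solution_translate:
  assumes w: "w \<in> borel_measurable borel" "\<And>x. \<bar>w x\<bar> \<le> U"
    and weak: "\<And>r \<phi>. 0 \<le> r \<Longrightarrow> r < 1 \<Longrightarrow> C11_bump r \<phi> \<Longrightarrow>
      (\<integral>x. w x * frac_lap \<phi> x \<partial>lborel) = (\<integral>x. \<phi> x * F x \<partial>lborel) \<and> integrable lborel (\<lambda>x. \<phi> x * F x)"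
    and \<phi>: "C11_bump r \<phi>" and r: "0 \<le> r" "r + norm h < 1"
  shows "(\<integral>x. w (x + h) * frac_lap \<phi> x \<partial>lborel) = (\<integral>x. \<phi> x * F (x + h) \<partial>lborel)"
    and "integrable lborel (\<lambda>x. w (x + h) * frac_lap \<phi> x)" "integrable lborel (\<lambda>x. \<phi> x * F (x + h))"
proof -
  note w(1)[measurable]
  obtain C where cont: "continuous_on UNIV \<phi>" and supp: "\<And>x. r < norm x \<Longrightarrow> \<phi> x = 0"
    and C: "\<And>x t. 0 < t \<Longrightarrow> \<bar>second_diff2 \<phi> x t\<bar> \<le> C * t\<^sup>2"
    using \<phi> unfolding C11_bump_def by blast
  have sh: "C11_bump (r + norm h) (\<lambda>x. \<phi> (x + - h))"
    unfolding C11_bump_def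
  proof (intro conjI exI allI impI)
    show "continuous_on UNIV (\<lambda>x. \<phi> (x + - h))"
      by (rule continuous_on_compose2[OF cont]) (auto intro: continuous_intros)
    show "\<phi> (x + - h) = 0" if "r + norm h < norm x" for x
      using that norm_triangle_ineq2[of x h] by (intro supp) simp
    show "\<bar>second_diff2 (\<lambda>x. \<phi> (x + - h)) x t\<bar> \<le> C * t\<^sup>2" if "0 < t" for x t
      unfolding second_diff2_translate by (rule C[OF that])
  qed
  have lap: "frac_lap (\<lambda>x. \<phi> (x + - h)) x = frac_lap \<phi> (x + - h)" for x
    unfolding frac_lap_def second_diff2_translate ..
  have wk: "(\<integral>x. w x * frac_lap (\<lambda>x. \<phi> (x + - h)) x \<partial>lborel) = (\<integral>x. \<phi> (x + - h) * F x \<partial>lborel)"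
    "integrable lborel (\<lambda>x. \<phi> (x + - h) * F x)"
    using weak[OF _ r(2) sh] r(1) by auto
  show "integrable lborel (\<lambda>x. w (x + h) * frac_lap \<phi> x)"
    by (rule weak_form_Fubini(1)[OF _ w(2) \<phi>]) measurable
  show "integrable lborel (\<lambda>x. \<phi> x * F (x + h))"
    using integrable_lborel_translate(1)[OF wk(2), of h] by simp
  have "(\<integral>x. w (x + h) * frac_lap \<phi> x \<partial>lborel) = (\<integral>x. w x * frac_lap \<phi> (x + - h) \<partial>lborel)"
    using integrable_lborel_translate(2)[of "\<lambda>x. w (x + h) * frac_lap \<phi> x" "- h"] by simp
  also have "\<dots> = (\<integral>x. \<phi> (x + - h) * F x \<partial>lborel)" using wk(1) by (simp only: lap)
  also have "\<dots> = (\<integral>x. \<phi> x * F (x + h) \<partial>lborel)"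
    using integrable_lborel_translate(2)[of "\<lambda>x. \<phi> (x + - h) * F x" h] by simp
  finally show "(\<integral>x. w (x + h) * frac_lap \<phi> x \<partial>lborel) = (\<integral>x. \<phi> x * F (x + h) \<partial>lborel)" .
qed

lemma weak_solution_third_diff:
  assumes w: "w \<in> borel_measurable borel" "\<And>x. \<bar>w x\<bar> \<le> U"
    and weak: "\<And>r \<phi>. 0 \<le> r \<Longrightarrow> r < 1 \<Longrightarrow> C11_bump r \<phi> \<Longrightarrow>
      (\<integral>x. w x * frac_lap \<phi> x \<partial>lborel) = (\<integral>x. \<phi> x * F x \<partial>lborel) \<and> integrable lborel (\<lambda>x. \<phi> x * F x)"
    and \<phi>: "C11_bump r \<phi>" and r: "0 \<le> r" "r + 2 * l < 1" and l: "0 < l"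
  shows "(\<integral>x. third_diff (\<lambda>t. w (x + t *\<^sub>R axis 2 1)) l * frac_lap \<phi> x \<partial>lborel)
      = (\<integral>x. \<phi> x * third_diff (\<lambda>t. F (x + t *\<^sub>R axis 2 1)) l \<partial>lborel)"
    and "integrable lborel (\<lambda>x. \<phi> x * third_diff (\<lambda>t. F (x + t *\<^sub>R axis 2 1)) l)"
proof -
  have T: "(\<integral>x. w (x + c *\<^sub>R axis 2 1) * frac_lap \<phi> x \<partial>lborel) = (\<integral>x. \<phi> x * F (x + c *\<^sub>R axis 2 1) \<partial>lborel)"
    "integrable lborel (\<lambda>x. w (x + c *\<^sub>R axis 2 1) * frac_lap \<phi> x)"
    "integrable lborel (\<lambda>x. \<phi> x * F (x + c *\<^sub>R axis 2 1))" if "\<bar>c\<bar> \<le> 2 * l" for c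
    using weak_solution_translate[OF w weak \<phi> r(1), where h="c *\<^sub>R axis 2 1"] that r by (auto simp: norm_axis_1)
  note T2 = T[of "2 * l"] and T1 = T[of l] and T0 = T[of 0] and Tm = T[of "- l"]
  have L: "third_diff (\<lambda>t. w (x + t *\<^sub>R axis 2 1)) l * frac_lap \<phi> x
     = w (x + (2 * l) *\<^sub>R axis 2 1) * frac_lap \<phi> x - 3 * (w (x + l *\<^sub>R axis 2 1) * frac_lap \<phi> x)
      + 3 * (w (x + 0 *\<^sub>R axis 2 1) * frac_lap \<phi> x) - w (x + (- l) *\<^sub>R axis 2 1) * frac_lap \<phi> x" for x
    unfolding third_diff_def by (simp only: left_diff_distrib distrib_right mult.assoc)
  have R: "\<phi> x * third_diff (\<lambda>t. F (x + t *\<^sub>R axis 2 1)) l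
     = \<phi> x * F (x + (2 * l) *\<^sub>R axis 2 1) - 3 * (\<phi> x * F (x + l *\<^sub>R axis 2 1))
      + 3 * (\<phi> x * F (x + 0 *\<^sub>R axis 2 1)) - \<phi> x * F (x + (- l) *\<^sub>R axis 2 1)" for x
    unfolding third_diff_def by (simp only: right_diff_distrib distrib_left mult.left_commute)
  show "integrable lborel (\<lambda>x. \<phi> x * third_diff (\<lambda>t. F (x + t *\<^sub>R axis 2 1)) l)"
    unfolding R using T2 T1 T0 Tm l
    by (intro Bochner_Integration.integrable_diff Bochner_Integration.integrable_add integrable_mult_right) auto
  show "(\<integral>x. third_diff (\<lambda>t. w (x + t *\<^sub>R axis 2 1)) l * frac_lap \<phi> x \<partial>lborel)
      = (\<integral>x. \<phi> x * third_diff (\<lambda>t. F (x + t *\<^sub>R axis 2 1)) l \<partial>lborel)"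
    unfolding L R using T2 T1 T0 Tm l by (simp del: scaleR_minus_left scaleR_zero_left)
qed

text \<open>The x_1 differences cost O(l M), where \<open>Q_off\<close> cuts off their spread along
  the strip. Among the x_2 differences, those with t < 1/8 meet Q only where |Q| \<le> N and scale
  to l N l^(-2s); those with t \<ge> 1/8 leave that region, but the kernel has finite mass there and
  they again cost O(l M).\<close>

lemma plane_bump_pairing_bound:
  assumes Q: "Q \<in> borel_measurable borel" "\<And>x. \<bar>Q x\<bar> \<le> M"
    and Q_off: "\<And>x. 2 < \<bar>x $ 1\<bar> \<Longrightarrow> Q x = 0"
    and Q_near: "\<And>x. \<bar>x $ 1\<bar> \<le> 1 / 8 \<Longrightarrow> \<bar>x $ 2\<bar> \<le> 1 / 4 \<Longrightarrow> \<bar>Q x\<bar> \<le> N" and N: "0 \<le> N"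
    and l: "0 < l" "l \<le> 1 / 8"
  shows "\<bar>\<integral>x. Q x * frac_lap (plane_bump l) x \<partial>lborel\<bar>
    \<le> 9728 * (\<integral>t. kern t * min 1 (t\<^sup>2) \<partial>lborel) * l * (M + N * l powr (-2 * s))"
proof -
  define C0 where "C0 = (\<integral>t. kern t * min 1 (t\<^sup>2) \<partial>lborel)"
  have C0: "0 \<le> C0" unfolding C0_def by (intro Bochner_Integration.integral_nonneg) (simp add: kern_nonneg)
  have M: "0 \<le> M" using Q(2)[of 0] by linarith
  let ?\<Phi> = "plane_bump l"
  have inner: "\<bar>\<integral>x. Q x * second_diff2 ?\<Phi> x t \<partial>lborel\<bar> \<le> 9728 * l * M * min 1 (t\<^sup>2) + 24 * l * N * min 1 ((t / l)\<^sup>2)"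
    if t: "0 < t" for t
  proof -
    define m1 where "m1 = min 1 (t\<^sup>2)"
    define m2 where "m2 = min 1 ((t / l)\<^sup>2)"
    have m: "0 \<le> m1" "0 \<le> m2" "m2 \<le> 1" by (auto simp: m1_def m2_def)
    define P where "P = N * m2 + 64 * M * m1"
    have P: "0 \<le> P" using N M m by (simp add: P_def)
    let ?J = "\<lambda>c x. indicator (slab (1 / 8) l c) x :: real"
    \<comment> \<open>The slabs have areas 8l and l/2, so the final constants are 1024 * 8 + 16 * 64
      * 3/2 = 9728 and 16 * 3/2 = 24.\<close>
    define G where "G x = 1024 * M * m1 * indicator (slab 2 l 0) x + (16 * P * ?J 0 x + 16 * P * ?J t x + 16 * P * ?J (- t) x)" for x
    have G: "has_bochner_integral lborel G (1024 * M * m1 * (4 * 2 * l)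
       + (16 * P * (4 * (1 / 8) * l) + 16 * P * (4 * (1 / 8) * l) + 16 * P * (4 * (1 / 8) * l)))"
      unfolding G_def using l by (intro has_bochner_integral_add slab_integral) auto
    have "\<bar>\<integral>x. Q x * second_diff2 ?\<Phi> x t \<partial>lborel\<bar> \<le> (\<integral>x. G x \<partial>lborel)"
    proof (rule abs_integral_le)
      show "integrable lborel G" using G by (simp add: has_bochner_integral_iff)
      fix x :: "real^2"
      define A where "A = bump (x $ 2 / l) * second_diff bump (8 * x $ 1) (8 * t)"
      define B where "B = bump (8 * x $ 1) * second_diff bump (x $ 2 / l) (t / l)"
      have "\<bar>Q x * A\<bar> \<le> 1024 * M * m1 * indicator (slab 2 l 0) x"
      proof (cases "\<bar>x $ 1\<bar> \<le> 2")
        case True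
        then have ind: "indicator {-l..l} (x $ 2) = (indicator (slab 2 l 0) x :: real)"
          by (auto simp: slab_def indicator_def abs_le_iff)
        have "\<bar>Q x\<bar> * \<bar>A\<bar> \<le> M * (1024 * m1 * indicator (slab 2 l 0) x)"
          using plane_bump_second_diff2_parts(1)[OF t l(1), of x] Q(2)[of x] M
          unfolding A_def m1_def ind by (intro mult_mono) auto
        then show ?thesis by (simp add: abs_mult mult_ac)
      next
        case False
        then show ?thesis using Q_off[of x] M m by simp
      qed
      moreover have "\<bar>Q x * B\<bar> \<le> 16 * P * (?J 0 x + ?J t x + ?J (- t) x)"
      proof (cases "?J 0 x + ?J t x + ?J (- t) x = 0")
        case True
        have "\<bar>B\<bar> \<le> 16 * min 1 ((t / l)\<^sup>2) * (?J 0 x + ?J t x + ?J (- t) x)"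
          unfolding B_def by (rule plane_bump_second_diff2_parts(2)[OF t l(1)])
        then have "B = 0" unfolding True by simp
        then show ?thesis unfolding True by simp
      next
        case False
        then have "x \<in> slab (1 / 8) l 0 \<or> x \<in> slab (1 / 8) l t \<or> x \<in> slab (1 / 8) l (- t)"
          by (cases "x \<in> slab (1 / 8) l 0"; cases "x \<in> slab (1 / 8) l t"; cases "x \<in> slab (1 / 8) l (- t)") simp_all
        then have "\<bar>x $ 1\<bar> \<le> 1 / 8 \<and> (\<bar>x $ 2 - 0\<bar> \<le> l \<or> \<bar>x $ 2 - t\<bar> \<le> l \<or> \<bar>x $ 2 - - t\<bar> \<le> l)"
          unfolding slab_def by blast
        then have x: "\<bar>x $ 1\<bar> \<le> 1 / 8" "\<bar>x $ 2\<bar> \<le> l + t" using t by linarith+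
        \<comment> \<open>For t \<ge> 1/8 the local bound N may fail, but then 64 min(1, t^2) \<ge>
          1 and the global bound M fits into the second term of P.\<close>
        have Qm: "\<bar>Q x\<bar> * m2 \<le> P"
        proof (cases "t < 1 / 8")
          case True
          then have "\<bar>Q x\<bar> * m2 \<le> N * m2" using Q_near[of x] x l m by (intro mult_right_mono) auto
          moreover have "0 \<le> 64 * M * m1" using M m by simp
          ultimately show ?thesis unfolding P_def by linarith
        next
          case False
          then have "(1 / 8)\<^sup>2 \<le> t\<^sup>2" by (intro power_mono) auto
          then have "1 / 64 \<le> t\<^sup>2" by (simp add: power_divide)
          then have "1 \<le> 64 * m1" unfolding m1_def by (simp add: min_def)
          then have "M * 1 \<le> M * (64 * m1)" using M by (intro mult_left_mono) auto
          moreover have "\<bar>Q x\<bar> * m2 \<le> M * 1" using Q(2)[of x] m M by (intro mult_mono) auto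
          moreover have "0 \<le> N * m2" using N m by simp
          ultimately show ?thesis unfolding P_def by linarith
        qed
        have J: "0 \<le> ?J 0 x + ?J t x + ?J (- t) x" by simp
        have "\<bar>B\<bar> \<le> 16 * m2 * (?J 0 x + ?J t x + ?J (- t) x)"
          unfolding B_def m2_def by (intro plane_bump_second_diff2_parts(2) t l)
        then have "\<bar>Q x * B\<bar> \<le> \<bar>Q x\<bar> * (16 * m2 * (?J 0 x + ?J t x + ?J (- t) x))"
          unfolding abs_mult by (rule mult_left_mono) simp
        also have "\<dots> = (16 * (\<bar>Q x\<bar> * m2)) * (?J 0 x + ?J t x + ?J (- t) x)" by (simp only: mult_ac)
        also have "\<dots> \<le> 16 * P * (?J 0 x + ?J t x + ?J (- t) x)"
          by (rule mult_right_mono[OF _ J]) (use Qm in linarith)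
        finally show ?thesis .
      qed
      moreover have "Q x * second_diff2 ?\<Phi> x t = Q x * A + Q x * B"
        unfolding plane_bump_second_diff2 A_def B_def by (simp add: distrib_left)
      moreover have "G x = 1024 * M * m1 * indicator (slab 2 l 0) x + 16 * P * (?J 0 x + ?J t x + ?J (- t) x)"
        by (simp add: G_def distrib_left)
      ultimately show "\<bar>Q x * second_diff2 ?\<Phi> x t\<bar> \<le> G x" by linarith
    qed
    also have "\<dots> = 1024 * M * m1 * (4 * 2 * l)
       + (16 * P * (4 * (1 / 8) * l) + 16 * P * (4 * (1 / 8) * l) + 16 * P * (4 * (1 / 8) * l))"
      using G by (simp only: has_bochner_integral_iff)
    also have "\<dots> = 9728 * l * M * m1 + 24 * l * N * m2"
      by (simp add: P_def algebra_simps)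
    finally show ?thesis by (simp add: m1_def m2_def)
  qed
  have ks: "has_bochner_integral lborel (\<lambda>t. 9728 * l * M * (kern t * min 1 (t\<^sup>2)) + 24 * l * N * (kern t * min 1 ((t / l)\<^sup>2)))
      (9728 * l * M * C0 + 24 * l * N * (l powr (-2 * s) * C0))"
    unfolding C0_def using integrable_kern_min l
    by (intro has_bochner_integral_add has_bochner_integral_mult_right kern_scaled_min) (auto simp: has_bochner_integral_iff)
  have eq: "(\<integral>x. Q x * frac_lap ?\<Phi> x \<partial>lborel) = (\<integral>t. kern t * (\<integral>x. Q x * second_diff2 ?\<Phi> x t \<partial>lborel) \<partial>lborel)"
    by (rule weak_form_Fubini(2)[OF Q plane_bump_C11[OF l]])
  have "\<bar>\<integral>x. Q x * frac_lap ?\<Phi> x \<partial>lborel\<bar> \<le> (\<integral>t. 9728 * l * M * (kern t * min 1 (t\<^sup>2)) + 24 * l * N * (kern t * min 1 ((t / l)\<^sup>2)) \<partial>lborel)"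
    unfolding eq
  proof (rule abs_integral_le)
    fix t
    show "\<bar>kern t * (\<integral>x. Q x * second_diff2 ?\<Phi> x t \<partial>lborel)\<bar>
      \<le> 9728 * l * M * (kern t * min 1 (t\<^sup>2)) + 24 * l * N * (kern t * min 1 ((t / l)\<^sup>2))"
    proof (cases "0 < t")
      case True
      define I where "I = (\<integral>x. Q x * second_diff2 ?\<Phi> x t \<partial>lborel)"
      have "\<bar>kern t * I\<bar> = kern t * \<bar>I\<bar>" by (simp add: abs_mult kern_nonneg)
      also have "\<dots> \<le> kern t * (9728 * l * M * min 1 (t\<^sup>2) + 24 * l * N * min 1 ((t / l)\<^sup>2))"
        using inner[OF True] unfolding I_def by (rule mult_left_mono) (rule kern_nonneg)
      also have "\<dots> = 9728 * l * M * (kern t * min 1 (t\<^sup>2)) + 24 * l * N * (kern t * min 1 ((t / l)\<^sup>2))"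
        by (simp only: distrib_left mult_ac)
      finally show ?thesis unfolding I_def .
    qed (simp add: kern_zero)
  qed (use ks in \<open>simp add: has_bochner_integral_iff\<close>)
  also have "\<dots> = 9728 * l * M * C0 + 24 * l * N * (l powr (-2 * s) * C0)"
    using ks by (simp add: has_bochner_integral_iff)
  also have "\<dots> \<le> 9728 * C0 * l * (M + N * l powr (-2 * s))"
  proof -
    have "24 * (l * N * (l powr (-2 * s) * C0)) \<le> 9728 * (l * N * (l powr (-2 * s) * C0))"
      using l N C0 by (intro mult_right_mono) auto
    then show ?thesis by (simp add: algebra_simps)
  qed
  finally show ?thesis by (simp add: C0_def)
qed

text \<open>Pairing third differences across the singular line with a bump of width \<open>l\<close> shows that a
  solution cannot be more regular than its right-hand side by \<open>2s\<close> derivatives. The nonlocal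
  contribution is controlled by the global increments of exponent \<open>\<sigma>\<close>.\<close>

lemma weak_solution_not_regular:
  assumes w: "continuous_on UNIV w" "\<And>x. \<bar>w x\<bar> \<le> U" and w_off: "\<And>x. x \<notin> ball 0 1 \<Longrightarrow> w x = 0"
    and weak: "\<And>r \<phi>. 0 \<le> r \<Longrightarrow> r < 1 \<Longrightarrow> C11_bump r \<phi> \<Longrightarrow>
      (\<integral>x. w x * frac_lap \<phi> x \<partial>lborel) = (\<integral>x. \<phi> x * F x \<partial>lborel) \<and> integrable lborel (\<lambda>x. \<phi> x * F x)"
    and \<beta>: "0 < \<beta>" "\<beta> < 1" "\<beta> < \<sigma>" "\<beta> < \<gamma> - 2 * s"
    and F: "\<And>x. x \<in> ball 0 1 \<Longrightarrow> F x = a (x $ 1) * \<bar>x $ 2\<bar> powr \<beta>"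
    and a: "0 < a0" "\<And>x :: real^2. x \<in> ball 0 1 \<Longrightarrow> a0 \<le> a (x $ 1)"
    and inc: "\<And>x h. \<bar>h\<bar> \<le> 1 \<Longrightarrow> \<bar>w (x + h *\<^sub>R axis 2 1) - w x\<bar> \<le> C * \<bar>h\<bar> powr \<sigma>"
    and reg: "\<And>x l. 0 < l \<Longrightarrow> l \<le> 1 / 32 \<Longrightarrow> \<bar>x $ 1\<bar> \<le> 1 / 8 \<Longrightarrow> \<bar>x $ 2\<bar> \<le> 1 / 4 \<Longrightarrow>
      \<bar>third_diff (\<lambda>t. w (x + t *\<^sub>R axis 2 1)) l\<bar> \<le> C' * l powr \<gamma>"
  shows False
proof -
  have wm[measurable]: "w \<in> borel_measurable borel" using w(1) by (rule borel_measurable_continuous_onI)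
  obtain \<omega> where \<omega>: "0 < \<omega>" "\<omega> \<le> 1"
    "\<And>y l. 0 < l \<Longrightarrow> \<bar>y\<bar> \<le> \<omega> * l \<Longrightarrow> third_diff (\<lambda>t. \<bar>y + t\<bar> powr \<beta>) l \<le> - (l powr \<beta>)"
    using third_diff_abs_powr[OF \<beta>(1,2)] by blast
  define C0 where "C0 = (\<integral>t. kern t * min 1 (t\<^sup>2) \<partial>lborel)"
  have C0: "0 \<le> C0" unfolding C0_def by (intro Bochner_Integration.integral_nonneg) (simp add: kern_nonneg)
  \<comment> \<open>The surplus over \<beta> of the two exponents that bound the pairing: \<sigma>
    from the far part, \<gamma> - 2s from the part near the line.\<close>
  define \<delta> where "\<delta> = min \<sigma> (\<gamma> - 2 * s) - \<beta>"
  have \<delta>: "0 < \<delta>" "\<beta> + \<delta> \<le> \<sigma>" "\<beta> + \<delta> \<le> \<gamma> - 2 * s" using \<beta> by (auto simp: \<delta>_def)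
  define K where "K = 9728 * C0 * (4 * \<bar>C\<bar> + \<bar>C'\<bar> * \<omega> powr (-2 * s))"
  have K: "0 \<le> K" using C0 by (simp add: K_def)
  define c where "c = a0 * (81 / 2048)"
  have c: "0 < c" using a by (simp add: c_def)
  have key: "c \<le> K * l powr \<delta>" if l: "0 < l" "l \<le> 1 / 32" for l
  proof -
    \<comment> \<open>The bump has width \<omega> l while the differences have step l: only within
      \<omega> l of the line is the third difference of |x_2|^\<beta> known to be at most
      -l^\<beta>.\<close>
    define m where "m = \<omega> * l"
    have "\<omega> * l \<le> 1 * l" using \<omega>(2) l by (intro mult_right_mono) auto
    moreover have "0 < \<omega> * l" using \<omega>(1) l(1) by (rule mult_pos_pos)
    ultimately have m: "0 < m" "m \<le> 1 / 8" "m \<le> l"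
      using l unfolding m_def by linarith+
    define Q where "Q x = third_diff (\<lambda>t. w (x + t *\<^sub>R axis 2 1)) l" for x
    have Qm: "Q \<in> borel_measurable borel" unfolding Q_def third_diff_def by measurable
    have QM: "\<bar>Q x\<bar> \<le> 4 * \<bar>C\<bar> * l powr \<sigma>" for x
    proof -
      have step: "\<bar>w (x + (p + l) *\<^sub>R axis 2 1) - w (x + p *\<^sub>R axis 2 1)\<bar> \<le> \<bar>C\<bar> * l powr \<sigma>" for p
      proof -
        have "\<bar>w ((x + p *\<^sub>R axis 2 1) + l *\<^sub>R axis 2 1) - w (x + p *\<^sub>R axis 2 1)\<bar> \<le> C * \<bar>l\<bar> powr \<sigma>"
          using l by (intro inc) auto
        also have "C * \<bar>l\<bar> powr \<sigma> \<le> \<bar>C\<bar> * l powr \<sigma>" using l by (simp add: mult_right_mono)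
        finally show ?thesis by (simp add: scaleR_add_left add.assoc)
      qed
      have "\<bar>w (x + (2 * l) *\<^sub>R axis 2 1) - w (x + l *\<^sub>R axis 2 1)\<bar> \<le> \<bar>C\<bar> * l powr \<sigma>"
        "\<bar>w (x + l *\<^sub>R axis 2 1) - w (x + 0 *\<^sub>R axis 2 1)\<bar> \<le> \<bar>C\<bar> * l powr \<sigma>"
        "\<bar>w (x + 0 *\<^sub>R axis 2 1) - w (x + (- l) *\<^sub>R axis 2 1)\<bar> \<le> \<bar>C\<bar> * l powr \<sigma>"
        using step[of l] step[of 0] step[of "- l"] by simp_all
      then show ?thesis unfolding Q_def third_diff_def by linarith
    qed
    have Q_off: "Q x = 0" if "2 < \<bar>x $ 1\<bar>" for x
    proof -
      have "w (x + t *\<^sub>R axis 2 1) = 0" for t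
        using that component_le_norm_cart[of "x + t *\<^sub>R axis 2 1" 1] by (intro w_off) auto
      then show ?thesis by (simp add: Q_def third_diff_def)
    qed
    have "\<bar>C'\<bar> * l powr \<gamma> \<ge> C' * l powr \<gamma>" by (simp add: mult_right_mono)
    then have Q_near: "\<bar>Q x\<bar> \<le> \<bar>C'\<bar> * l powr \<gamma>" if "\<bar>x $ 1\<bar> \<le> 1 / 8" "\<bar>x $ 2\<bar> \<le> 1 / 4" for x
      using reg[OF l that] unfolding Q_def by linarith
    have N: "0 \<le> \<bar>C'\<bar> * l powr \<gamma>" by simp
    have up: "\<bar>\<integral>x. Q x * frac_lap (plane_bump m) x \<partial>lborel\<bar>
      \<le> 9728 * C0 * m * (4 * \<bar>C\<bar> * l powr \<sigma> + \<bar>C'\<bar> * l powr \<gamma> * m powr (-2 * s))"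
      unfolding C0_def by (rule plane_bump_pairing_bound[OF Qm QM Q_off Q_near N m(1,2)])
    have "(\<integral>x. Q x * frac_lap (plane_bump m) x \<partial>lborel)
      = (\<integral>x. plane_bump m x * third_diff (\<lambda>t. F (x + t *\<^sub>R axis 2 1)) l \<partial>lborel)"
      and int: "integrable lborel (\<lambda>x. plane_bump m x * third_diff (\<lambda>t. F (x + t *\<^sub>R axis 2 1)) l)"
      unfolding Q_def using l by (intro weak_solution_third_diff[OF wm w(2) weak plane_bump_C11[OF m(1,2)]]; simp)+
    note this(1)
    \<comment> \<open>No cancellation can occur in the pairing: the bump is nonnegative and, on its
      support, the third difference of F has one sign and size at least a0 l^\<beta>.\<close>
    also have "(\<integral>x. plane_bump m x * third_diff (\<lambda>t. F (x + t *\<^sub>R axis 2 1)) l \<partial>lborel)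
      \<le> (\<integral>x. (- (a0 * l powr \<beta>)) * plane_bump m x \<partial>lborel)"
    proof (rule integral_mono[OF int])
      have "integrable lborel (plane_bump m)"
        using plane_bump_C11[OF m(1,2)] by (intro integrable_compact_support[of _ "1 / 4"]) (auto simp: C11_bump_def)
      then show "integrable lborel (\<lambda>x. (- (a0 * l powr \<beta>)) * plane_bump m x)" by simp
      fix x :: "real^2"
      show "plane_bump m x * third_diff (\<lambda>t. F (x + t *\<^sub>R axis 2 1)) l \<le> (- (a0 * l powr \<beta>)) * plane_bump m x"
      proof (cases "plane_bump m x = 0")
        case True
        then show ?thesis by simp
      next
        case False
        then have x: "\<bar>x $ 1\<bar> < 1 / 8" "\<bar>x $ 2\<bar> < m" using plane_bump_supp m by blast+
        have b: "x + t *\<^sub>R axis 2 1 \<in> ball 0 1" if "\<bar>t\<bar> \<le> 2 * l" for t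
          using norm_le_components_2[of "x + t *\<^sub>R axis 2 1"] x m l that by auto
        have Ft: "F (x + t *\<^sub>R axis 2 1) = a (x $ 1) * \<bar>x $ 2 + t\<bar> powr \<beta>" if "\<bar>t\<bar> \<le> 2 * l" for t
          using F[OF b[OF that]] by simp
        have "third_diff (\<lambda>t. F (x + t *\<^sub>R axis 2 1)) l = a (x $ 1) * third_diff (\<lambda>t. \<bar>x $ 2 + t\<bar> powr \<beta>) l"
        proof -
          have e: "F (x + (2 * l) *\<^sub>R axis 2 1) = a (x $ 1) * \<bar>x $ 2 + 2 * l\<bar> powr \<beta>"
            "F (x + l *\<^sub>R axis 2 1) = a (x $ 1) * \<bar>x $ 2 + l\<bar> powr \<beta>"
            "F (x + 0 *\<^sub>R axis 2 1) = a (x $ 1) * \<bar>x $ 2 + 0\<bar> powr \<beta>"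
            "F (x + (- l) *\<^sub>R axis 2 1) = a (x $ 1) * \<bar>x $ 2 + - l\<bar> powr \<beta>"
            using l by (intro Ft; simp)+
          show ?thesis unfolding third_diff_def e by (simp only: right_diff_distrib distrib_left mult.left_commute)
        qed
        moreover have t3: "third_diff (\<lambda>t. \<bar>x $ 2 + t\<bar> powr \<beta>) l \<le> - (l powr \<beta>)"
          using x(2) by (intro \<omega>(3) l) (simp add: m_def)
        have a0: "a0 \<le> a (x $ 1)" using a(2)[OF b[of 0]] l by simp
        have "a (x $ 1) * third_diff (\<lambda>t. \<bar>x $ 2 + t\<bar> powr \<beta>) l \<le> a (x $ 1) * (- (l powr \<beta>))"
          using t3 a0 a(1) by (intro mult_left_mono) auto
        moreover have "a0 * l powr \<beta> \<le> a (x $ 1) * l powr \<beta>" using a0 by (intro mult_right_mono) auto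
        ultimately have "third_diff (\<lambda>t. F (x + t *\<^sub>R axis 2 1)) l \<le> - (a0 * l powr \<beta>)" by linarith
        then show ?thesis
          using mult_left_mono[OF _ plane_bump_nonneg[of m x]] by (metis mult.commute)
      qed
    qed
    also have "\<dots> = (- (a0 * l powr \<beta>)) * (\<integral>x. plane_bump m x \<partial>lborel)" by (rule integral_mult_right_zero)
    also have "\<dots> \<le> (- (a0 * l powr \<beta>)) * (81 / 2048 * m)"
      using plane_bump_integral_ge[OF m(1,2)] a(1) by (intro mult_left_mono_neg) auto
    also have "\<dots> = - (m * (c * l powr \<beta>))" by (simp add: c_def)
    finally have "m * (c * l powr \<beta>) \<le> 9728 * C0 * m * (4 * \<bar>C\<bar> * l powr \<sigma> + \<bar>C'\<bar> * l powr \<gamma> * m powr (-2 * s))"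
      using up by linarith
    then have "m * (c * l powr \<beta>) \<le> m * (9728 * C0 * (4 * \<bar>C\<bar> * l powr \<sigma> + \<bar>C'\<bar> * l powr \<gamma> * m powr (-2 * s)))"
      by (simp add: mult_ac)
    then have "c * l powr \<beta> \<le> 9728 * C0 * (4 * \<bar>C\<bar> * l powr \<sigma> + \<bar>C'\<bar> * l powr \<gamma> * m powr (-2 * s))"
      using m(1) by simp
    also have "\<bar>C'\<bar> * l powr \<gamma> * m powr (-2 * s) = \<bar>C'\<bar> * \<omega> powr (-2 * s) * l powr (\<gamma> - 2 * s)"
    proof -
      have "m powr (-2 * s) = \<omega> powr (-2 * s) * l powr (-2 * s)"
        unfolding m_def using \<omega>(1) l by (intro powr_mult)
      moreover have "l powr \<gamma> * l powr (-2 * s) = l powr (\<gamma> - 2 * s)" by (simp add: powr_add[symmetric])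
      ultimately show ?thesis by (metis mult.assoc mult.left_commute)
    qed
    also have "9728 * C0 * (4 * \<bar>C\<bar> * l powr \<sigma> + \<bar>C'\<bar> * \<omega> powr (-2 * s) * l powr (\<gamma> - 2 * s))
       \<le> 9728 * C0 * (4 * \<bar>C\<bar> * l powr (\<beta> + \<delta>) + \<bar>C'\<bar> * \<omega> powr (-2 * s) * l powr (\<beta> + \<delta>))"
      using C0 l \<delta> by (intro mult_left_mono add_mono powr_mono') auto
    also have "\<dots> = l powr \<beta> * (K * l powr \<delta>)" by (simp add: K_def powr_add algebra_simps)
    finally have "l powr \<beta> * c \<le> l powr \<beta> * (K * l powr \<delta>)" by (simp add: mult.commute)
    then show ?thesis using l by simp
  qed
  \<comment> \<open>This makes K l^\<delta> at most K c / (2 (K + 1)) < c; the denominator has K + 1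
    because K may be 0.\<close>
  define l where "l = min (1 / 32) ((c / (2 * (K + 1))) powr (1 / \<delta>))"
  have l: "0 < l" "l \<le> 1 / 32" using c K by (auto simp: l_def)
  have "l powr \<delta> \<le> ((c / (2 * (K + 1))) powr (1 / \<delta>)) powr \<delta>"
    using l \<delta> by (intro powr_mono2) (auto simp: l_def)
  also have "\<dots> = c / (2 * (K + 1))" using \<delta> c K by (simp add: powr_powr)
  finally have "K * l powr \<delta> \<le> K * (c / (2 * (K + 1)))" using K by (intro mult_left_mono)
  also have "\<dots> < c" using c K mult_nonneg_nonneg[of K c] by (simp add: field_simps add_nonneg_pos)
  finally show False using key[OF l] by linarith
qed

end

section \<open>The exterior datum\<close>

text \<open>The support [3, 5] lies beyond the disc of radius 2, and from x_1 \<le> 1 it is reached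
  only by steps t \<ge> 2, so the singularity of the kernel is never met.\<close>

definition tent :: "real \<Rightarrow> real" where
  "tent t = max 0 (1 - \<bar>t - 4\<bar>)"

lemma tent_nonneg: "0 \<le> tent t" and tent_le_1: "tent t \<le> 1"
  and tent_zero: "t \<le> 3 \<Longrightarrow> tent t = 0" and tent_Lipschitz: "\<bar>tent a - tent b\<bar> \<le> \<bar>a - b\<bar>"
  and tent_ge: "\<bar>t - 4\<bar> \<le> 1 / 2 \<Longrightarrow> 1 / 2 \<le> tent t"
  unfolding tent_def by linarith+

lemma tent_measurable [measurable]: "tent \<in> borel_measurable borel"
  unfolding tent_def by measurable

lemma tent_shift_bound: "\<bar>tent (a + t)\<bar> \<le> min 1 (t\<^sup>2)" if "a \<le> 1" "0 < t"
proof (cases "t < 2")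
  case True
  then show ?thesis using that tent_zero[of "a + t"] by simp
next
  case False
  then have "1 \<le> t\<^sup>2" by (simp add: one_le_power)
  then show ?thesis using tent_nonneg[of "a + t"] tent_le_1[of "a + t"] by simp
qed

lemma le_powr_of_le_min:
  fixes z r \<beta> :: real
  assumes "0 < \<beta>" "\<beta> < 1" "0 \<le> r" "z \<le> 1" "z \<le> r"
  shows "z \<le> r powr \<beta>"
proof (cases "1 \<le> r")
  case True
  then have "1 \<le> r powr \<beta>" using assms by (intro ge_one_powr_ge_zero) auto
  then show ?thesis using assms by linarith
next
  case False
  then have "r powr 1 \<le> r powr \<beta>" using assms by (intro powr_mono') auto
  then show ?thesis using assms by simp
qed

text \<open>Truncating |x_2| at 1 keeps the datum bounded and globally Hoelder of exponent \<beta>;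
  the right-hand side in the unit disc is unaffected, as |x_2| < 1 there.\<close>

definition ext_data :: "real \<Rightarrow> real^2 \<Rightarrow> real" where
  "ext_data \<beta> x = tent (x $ 1) * (min \<bar>x $ 2\<bar> 1) powr \<beta>"

lemma ext_data_bound: "0 < \<beta> \<Longrightarrow> \<bar>ext_data \<beta> x\<bar> \<le> 1"
  using tent_nonneg[of "x $ 1"] tent_le_1[of "x $ 1"]
  by (simp add: ext_data_def abs_mult powr_le1 mult_le_one)

lemma ext_data_zero: "x $ 1 \<le> 3 \<Longrightarrow> ext_data \<beta> x = 0"
  by (simp add: ext_data_def tent_zero)

lemma ext_data_continuous: "0 < \<beta> \<Longrightarrow> continuous_on UNIV (ext_data \<beta>)"
  unfolding ext_data_def tent_def by (intro continuous_intros continuous_on_powr') auto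

lemma ext_data_Holder:
  assumes \<beta>: "0 < \<beta>" "\<beta> < 1"
  shows "\<bar>ext_data \<beta> x - ext_data \<beta> y\<bar> \<le> 2 * dist x y powr \<beta>"
proof -
  define H where "H t = (min \<bar>t\<bar> 1) powr \<beta>" for t :: real
  have H: "0 \<le> H t" "H t \<le> 1" for t using \<beta> by (auto simp: H_def intro: powr_le1)
  have d: "\<bar>x $ i - y $ i\<bar> \<le> dist x y" for i
    using component_le_norm_cart[of "x - y" i] by (simp add: dist_norm)
  have "\<bar>tent (x $ 1) - tent (y $ 1)\<bar> \<le> dist x y powr \<beta>"
    using \<beta> d[of 1] tent_Lipschitz[of "x $ 1" "y $ 1"] tent_nonneg[of "x $ 1"] tent_nonneg[of "y $ 1"]
      tent_le_1[of "x $ 1"] tent_le_1[of "y $ 1"]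
    by (intro le_powr_of_le_min) auto
  moreover have "\<bar>H (x $ 2) - H (y $ 2)\<bar> \<le> dist x y powr \<beta>"
  proof -
    have "\<bar>H (x $ 2) - H (y $ 2)\<bar> \<le> \<bar>min \<bar>x $ 2\<bar> 1 - min \<bar>y $ 2\<bar> 1\<bar> powr \<beta>"
      unfolding H_def using \<beta> by (intro powr_Holder) auto
    also have "\<dots> \<le> dist x y powr \<beta>"
      using \<beta> d[of 2] by (intro powr_mono2) auto
    finally show ?thesis .
  qed
  moreover have "ext_data \<beta> x - ext_data \<beta> y
      = (tent (x $ 1) - tent (y $ 1)) * H (x $ 2) + tent (y $ 1) * (H (x $ 2) - H (y $ 2))"
    by (simp add: ext_data_def H_def algebra_simps)
  moreover have "\<bar>(tent (x $ 1) - tent (y $ 1)) * H (x $ 2)\<bar> \<le> \<bar>tent (x $ 1) - tent (y $ 1)\<bar>"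
    using H[of "x $ 2"] by (simp add: abs_mult mult_left_le)
  moreover have "\<bar>tent (y $ 1) * (H (x $ 2) - H (y $ 2))\<bar> \<le> \<bar>H (x $ 2) - H (y $ 2)\<bar>"
    using tent_nonneg[of "y $ 1"] tent_le_1[of "y $ 1"] by (simp add: abs_mult mult_left_le_one_le)
  ultimately show ?thesis by linarith
qed

context fractional_order
begin

text \<open>The factor a(x_1) of the right-hand side: the weight with which a point of the disc sees
  the exterior bump along its horizontal line.\<close>

definition ext_coeff :: "real \<Rightarrow> real" where
  "ext_coeff a = (\<integral>t. kern t * tent (a + t) \<partial>lborel)"

definition kern_mass :: real where
  "kern_mass = (\<integral>t. kern t * min 1 (t\<^sup>2) \<partial>lborel)"

lemma kern_mass_nonneg: "0 \<le> kern_mass"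
  unfolding kern_mass_def by (intro Bochner_Integration.integral_nonneg) (simp add: kern_nonneg)

lemma ext_coeff_integrable: "a \<le> 1 \<Longrightarrow> integrable lborel (\<lambda>t. kern t * tent (a + t))"
  using tent_shift_bound[of a] by (intro integrable_kern_times[where C=1]) auto

lemma ext_coeff_Lipschitz:
  assumes "a \<le> 1" "b \<le> 1"
  shows "\<bar>ext_coeff a - ext_coeff b\<bar> \<le> kern_mass * \<bar>a - b\<bar>"
proof -
  have "ext_coeff a - ext_coeff b = (\<integral>t. kern t * tent (a + t) - kern t * tent (b + t) \<partial>lborel)"
    unfolding ext_coeff_def using ext_coeff_integrable assms by simp
  also have "\<bar>\<integral>t. kern t * tent (a + t) - kern t * tent (b + t) \<partial>lborel\<bar> \<le> (\<integral>t. \<bar>a - b\<bar> * (kern t * min 1 (t\<^sup>2)) \<partial>lborel)"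
  proof (rule abs_integral_le)
    show "integrable lborel (\<lambda>t. \<bar>a - b\<bar> * (kern t * min 1 (t\<^sup>2)))" using integrable_kern_min by simp
    fix t
    show "\<bar>kern t * tent (a + t) - kern t * tent (b + t)\<bar> \<le> \<bar>a - b\<bar> * (kern t * min 1 (t\<^sup>2))"
    proof (cases "2 \<le> t")
      case True
      then have "1 \<le> t\<^sup>2" by (simp add: one_le_power)
      have "kern t * \<bar>tent (a + t) - tent (b + t)\<bar> \<le> kern t * \<bar>a - b\<bar>"
        using tent_Lipschitz[of "a + t" "b + t"] kern_nonneg by (intro mult_left_mono) auto
      then show ?thesis using \<open>1 \<le> t\<^sup>2\<close>
        by (simp add: right_diff_distrib[symmetric] abs_mult kern_nonneg mult.commute)
    next
      case False
      then show ?thesis using assms by (simp add: tent_zero kern_nonneg)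
    qed
  qed
  finally show ?thesis by (simp add: kern_mass_def mult.commute)
qed

text \<open>The window |a + t - 4| \<le> 1/2 has length 1 and lies in 0 < t \<le> 6 when |a| \<le>
  1, and the tent is at least 1/2 on it.\<close>

lemma ext_coeff_bounds:
  assumes "\<bar>a\<bar> \<le> 1"
  shows "6 powr (-1 - 2 * s) / 2 \<le> ext_coeff a" "ext_coeff a \<le> kern_mass"
proof -
  have a: "a \<le> 1" using assms by simp
  have "6 powr (-1 - 2 * s) / 2 = (\<integral>t. indicator {7 / 2 - a..9 / 2 - a} t * (6 powr (-1 - 2 * s) / 2) \<partial>lborel)" by simp
  also have "\<dots> \<le> ext_coeff a" unfolding ext_coeff_def
  proof (rule integral_mono[OF _ ext_coeff_integrable[OF a]])
    show "integrable lborel (\<lambda>t. indicator {7 / 2 - a..9 / 2 - a} t * (6 powr (-1 - 2 * s) / 2) :: real)"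
      by (intro integrable_mult_left integrable_real_indicator) auto
    fix t :: real
    show "indicator {7 / 2 - a..9 / 2 - a} t * (6 powr (-1 - 2 * s) / 2) \<le> kern t * tent (a + t)"
    proof (cases "t \<in> {7 / 2 - a..9 / 2 - a}")
      case True
      then have "0 < t" "t \<le> 6" "\<bar>a + t - 4\<bar> \<le> 1 / 2"
        using assms unfolding atLeastAtMost_iff by linarith+
      then have "6 powr (-1 - 2 * s) * (1 / 2) \<le> kern t * tent (a + t)"
        using s_pos by (intro mult_mono tent_ge) (auto simp: kern_def intro: powr_mono2')
      then show ?thesis using True by simp
    qed (simp add: kern_nonneg tent_nonneg)
  qed
  finally show "6 powr (-1 - 2 * s) / 2 \<le> ext_coeff a" .
  show "ext_coeff a \<le> kern_mass" unfolding ext_coeff_def kern_mass_def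
  proof (rule integral_mono[OF ext_coeff_integrable[OF a] integrable_kern_min])
    fix t
    show "kern t * tent (a + t) \<le> kern t * min 1 (t\<^sup>2)"
    proof (cases "0 < t")
      case True
      have "tent (a + t) \<le> min 1 (t\<^sup>2)" by (rule order_trans[OF abs_ge_self tent_shift_bound[OF a True]])
      then show ?thesis by (rule mult_left_mono) (rule kern_nonneg)
    qed (simp add: kern_zero)
  qed
qed

text \<open>Among the five points involved only x + t e_1 can have first coordinate above 3, and it
  has the same x_2 as x. This carries the factor |x_2|^\<beta> into the disc unchanged.\<close>

lemma ext_data_second_diff2:
  assumes x: "norm x \<le> 1" and t: "0 < t"
  shows "second_diff2 (ext_data \<beta>) x t = - (tent (x $ 1 + t) * (min \<bar>x $ 2\<bar> 1) powr \<beta>)"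
proof -
  have "x $ 1 \<le> 1" using component_le_norm_cart[of x 1] x by simp
  then show ?thesis using t by (simp add: second_diff2_def ext_data_def tent_zero)
qed

lemma ext_data_solves:
  assumes x: "norm x \<le> 1"
  shows "solves_at (ext_data \<beta>) (- (ext_coeff (x $ 1) * (min \<bar>x $ 2\<bar> 1) powr \<beta>)) x"
proof -
  have "x $ 1 \<le> 1" using component_le_norm_cart[of x 1] x by simp
  then have "has_bochner_integral lborel (\<lambda>t. (- ((min \<bar>x $ 2\<bar> 1) powr \<beta>)) * (kern t * tent (x $ 1 + t)))
      ((- ((min \<bar>x $ 2\<bar> 1) powr \<beta>)) * ext_coeff (x $ 1))"
    using ext_coeff_integrable[of "x $ 1"]
    by (intro has_bochner_integral_mult_right) (simp add: has_bochner_integral_iff ext_coeff_def)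
  moreover have "(- ((min \<bar>x $ 2\<bar> 1) powr \<beta>)) * (kern t * tent (x $ 1 + t)) = kern t * second_diff2 (ext_data \<beta>) x t" for t
    using ext_data_second_diff2[OF x, of t] by (cases "0 < t") (auto simp: kern_zero)
  ultimately show ?thesis unfolding solves_at_def by (simp add: mult.commute)
qed

section \<open>Assembly of the counterexample\<close>

lemma counterexample_exists:
  assumes \<beta>: "0 < \<beta>" "\<beta> < \<alpha>" and \<alpha>: "\<alpha> \<le> s"
  shows "\<exists>u :: real^2 \<Rightarrow> real. weak_solution s (ball 0 1) u \<and> u \<in> holder_space \<beta> UNIV \<and>
    (\<forall>x \<in> ball 0 2 - ball 0 1. u x = 0) \<and> u \<notin> holder_space (\<alpha> + 2 * s) (ball 0 (1/2))"
proof -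
  have \<beta>1: "\<beta> < 1" "\<beta> < s" using \<beta> \<alpha> s_less_1 by auto
  define F where "F x = ext_coeff (x $ 1) * (min \<bar>x $ 2\<bar> 1) powr \<beta>" for x :: "real^2"
  have comp: "\<bar>x $ i\<bar> \<le> 1" if "norm x \<le> 1" for x :: "real^2" and i
    using component_le_norm_cart[of x i] that by linarith
  have H: "0 \<le> (min \<bar>t\<bar> 1) powr \<beta>" "(min \<bar>t\<bar> 1) powr \<beta> \<le> 1" for t :: real
    using \<beta> by (auto intro: powr_le1)
  have contF: "continuous_on (cball 0 1) F"
  proof -
    have "kern_mass-lipschitz_on {-1..1} ext_coeff"
      using ext_coeff_Lipschitz kern_mass_nonneg by (intro lipschitz_onI) (auto simp: dist_real_def)
    then have "continuous_on {-1..1} ext_coeff" by (rule lipschitz_on_continuous_on)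
    then have "continuous_on (cball 0 1) (\<lambda>x :: real^2. ext_coeff (x $ 1))"
      by (rule continuous_on_compose2) (use comp in \<open>auto intro!: continuous_intros simp: abs_le_iff\<close>)
    then show ?thesis unfolding F_def using \<beta> by (intro continuous_intros continuous_on_powr') auto
  qed
  obtain w where w: "dirichlet_solution F w" using dirichlet_solution_exists[OF contF] by blast
  define g where "g = ext_data \<beta>"
  define u where "u x = w x + g x" for x
  have coeff: "0 \<le> ext_coeff (x $ 1)" "\<bar>ext_coeff (x $ 1)\<bar> \<le> kern_mass"
    "6 powr (-1 - 2 * s) / 2 \<le> ext_coeff (x $ 1)" if "norm x \<le> 1" for x :: "real^2"
  proof -
    have "0 < (6::real) powr (-1 - 2 * s) / 2" by simp
    then show "0 \<le> ext_coeff (x $ 1)" "\<bar>ext_coeff (x $ 1)\<bar> \<le> kern_mass"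
      "6 powr (-1 - 2 * s) / 2 \<le> ext_coeff (x $ 1)"
      using ext_coeff_bounds[OF comp[OF that, of 1]] by linarith+
  qed
  have FM: "\<bar>F x\<bar> \<le> kern_mass" if "x \<in> ball 0 1" for x
  proof -
    have "\<bar>ext_coeff (x $ 1)\<bar> * \<bar>(min \<bar>x $ 2\<bar> 1) powr \<beta>\<bar> \<le> kern_mass * 1"
      using coeff[of x] that H[of "x $ 2"] kern_mass_nonneg by (intro mult_mono) auto
    then show ?thesis by (simp add: F_def abs_mult)
  qed
  have F_eq: "F x = ext_coeff (x $ 1) * \<bar>x $ 2\<bar> powr \<beta>" if "x \<in> ball 0 1" for x
    using comp[of x 2] that by (simp add: F_def)
  have w_cont: "continuous_on UNIV w" using w by (rule dirichlet_solution_continuous)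
  have w_off: "w x = 0" if "x \<notin> ball 0 1" for x using w that by (rule dirichlet_solution_outside)
  obtain U where U: "0 \<le> U" "\<And>x. \<bar>w x\<bar> \<le> U"
    using bounded_compact_support[OF w_cont, of 1] w_off by auto
  have wm: "w \<in> borel_measurable borel" using w_cont by (rule borel_measurable_continuous_onI)
  have g_cont: "continuous_on UNIV g" unfolding g_def using \<beta>(1) by (rule ext_data_continuous)
  have gm: "g \<in> borel_measurable borel" using g_cont by (rule borel_measurable_continuous_onI)
  have g1: "\<bar>g x\<bar> \<le> 1" for x unfolding g_def using \<beta>(1) by (rule ext_data_bound)

  have "weak_solution s (ball 0 1) u"
    unfolding weak_solution_def
  proof
    fix \<phi> :: "real^2 \<Rightarrow> real" assume \<phi>: "\<phi> \<in> test_functions (ball 0 1)"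
    obtain r where r: "0 \<le> r" "r < 1" and b: "C11_bump r \<phi>"
      using test_function_C11_bump[OF \<phi>] by metis
    note wk = dirichlet_solution_weak[OF w contF b r]
    have loc: "\<bar>second_diff2 g x t\<bar> \<le> 1 * min 1 (t\<^sup>2)" if "norm x \<le> r" "0 < t" for x t
    proof -
      have x: "norm x \<le> 1" using that r by simp
      have "\<bar>tent (x $ 1 + t)\<bar> * \<bar>(min \<bar>x $ 2\<bar> 1) powr \<beta>\<bar> \<le> min 1 (t\<^sup>2) * 1"
        using tent_shift_bound[of "x $ 1" t] comp[OF x, of 1] that H[of "x $ 2"] by (intro mult_mono) auto
      then show ?thesis unfolding g_def ext_data_second_diff2[OF x that(2)] by (simp add: abs_mult)
    qed
    have sol: "solves_at g (- F x) x" if "norm x \<le> r" for x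
      unfolding g_def F_def using that r by (intro ext_data_solves) simp
    note gk = weak_form_classical(1)[OF gm g1 b loc sol]
    have gi: "integrable lborel (\<lambda>x. g x * frac_lap \<phi> x)" using gm g1 b by (rule weak_form_Fubini(1))
    \<comment> \<open>\<open>w\<close> contributes F and \<open>g\<close> contributes -F to the weak
      form, with the normalising constant as a common factor.\<close>
    have "has_bochner_integral lborel (\<lambda>x. w x * frac_lap \<phi> x) (\<integral>x. \<phi> x * F x \<partial>lborel)"
      using wk(1,2) by (simp only: has_bochner_integral_iff)
    moreover have "has_bochner_integral lborel (\<lambda>x. g x * frac_lap \<phi> x) (\<integral>x. \<phi> x * - F x \<partial>lborel)"
      using gk gi by (simp only: has_bochner_integral_iff)
    ultimately have "has_bochner_integral lborel (\<lambda>x. - frac_const s * (w x * frac_lap \<phi> x + g x * frac_lap \<phi> x))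
      (- frac_const s * ((\<integral>x. \<phi> x * F x \<partial>lborel) + (\<integral>x. \<phi> x * - F x \<partial>lborel)))"
      by (intro has_bochner_integral_mult_right has_bochner_integral_add)
    moreover have "- frac_const s * (w x * frac_lap \<phi> x + g x * frac_lap \<phi> x) = u x * L_op s \<phi> x" for x
      unfolding L_op_test_function[OF \<phi>] u_def by (simp add: algebra_simps)
    moreover have "(\<integral>x. \<phi> x * F x \<partial>lborel) + (\<integral>x. \<phi> x * - F x \<partial>lborel) = 0" by simp
    ultimately show "has_bochner_integral lborel (\<lambda>x. u x * L_op s \<phi> x) 0" by simp
  qed
  moreover have "u \<in> holder_space \<beta> UNIV"
  proof -
    have F_inc: "\<bar>F (x + h) - F x\<bar> \<le> 2 * kern_mass * norm h powr \<beta>"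
      if x: "x \<in> ball 0 1" "x + h \<in> ball 0 1" and h: "norm h \<le> 1" for x h
    proof -
      define H' where "H' t = (min \<bar>t\<bar> 1) powr \<beta>" for t :: real
      have hi: "\<bar>h $ i\<bar> \<le> norm h" for i by (rule component_le_norm_cart)
      have n: "norm x \<le> 1" "norm (x + h) \<le> 1" using x by auto
      have "\<bar>ext_coeff (x $ 1 + h $ 1) - ext_coeff (x $ 1)\<bar> \<le> kern_mass * \<bar>h $ 1\<bar>"
        using ext_coeff_Lipschitz[of "x $ 1 + h $ 1" "x $ 1"] comp[OF n(1), of 1] comp[OF n(2), of 1] by simp
      also have "\<dots> \<le> kern_mass * norm h powr \<beta>"
        using \<beta> \<beta>1 h hi[of 1] kern_mass_nonneg by (intro mult_left_mono le_powr_of_le_min) auto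
      finally have 1: "\<bar>ext_coeff (x $ 1 + h $ 1) - ext_coeff (x $ 1)\<bar> \<le> kern_mass * norm h powr \<beta>" .
      have "\<bar>H' (x $ 2 + h $ 2) - H' (x $ 2)\<bar> \<le> \<bar>min \<bar>x $ 2 + h $ 2\<bar> 1 - min \<bar>x $ 2\<bar> 1\<bar> powr \<beta>"
        unfolding H'_def using \<beta> \<beta>1 by (intro powr_Holder) auto
      also have "\<dots> \<le> norm h powr \<beta>" using \<beta> hi[of 2] by (intro powr_mono2) auto
      finally have 2: "\<bar>H' (x $ 2 + h $ 2) - H' (x $ 2)\<bar> \<le> norm h powr \<beta>" .
      have "F (x + h) - F x = (ext_coeff (x $ 1 + h $ 1) - ext_coeff (x $ 1)) * H' (x $ 2 + h $ 2)
          + ext_coeff (x $ 1) * (H' (x $ 2 + h $ 2) - H' (x $ 2))"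
        by (simp add: F_def H'_def algebra_simps)
      moreover have "\<bar>(ext_coeff (x $ 1 + h $ 1) - ext_coeff (x $ 1)) * H' (x $ 2 + h $ 2)\<bar> \<le> kern_mass * norm h powr \<beta> * 1"
        unfolding abs_mult using 1 H[of "x $ 2 + h $ 2"] kern_mass_nonneg by (intro mult_mono) (auto simp: H'_def)
      moreover have "\<bar>ext_coeff (x $ 1) * (H' (x $ 2 + h $ 2) - H' (x $ 2))\<bar> \<le> kern_mass * norm h powr \<beta>"
        unfolding abs_mult using 2 coeff(2)[OF n(1)] kern_mass_nonneg by (intro mult_mono) auto
      ultimately show ?thesis by linarith
    qed
    define A where "A = kern_mass / torsion_const * 2 powr s + 2 * kern_mass / torsion_const"
    have A: "0 \<le> A" using kern_mass_nonneg torsion_const(1) by (simp add: A_def)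
    \<comment> \<open>For |h| \<le> 1 the boundary term |h|^s is below |h|^\<beta> because \<beta> <
      s; larger increments are covered by the sup bound on \<open>w\<close>.\<close>
    have w_inc: "\<bar>w (x + h) - w x\<bar> \<le> (A + 2 * U) * norm h powr \<beta>" for x h
    proof (cases "norm h \<le> 1")
      case True
      have "\<bar>w (x + h) - w x\<bar> \<le> kern_mass / torsion_const * (2 * norm h) powr s + 2 * kern_mass * norm h powr \<beta> / torsion_const"
        using F_inc True kern_mass_nonneg by (intro dirichlet_solution_increment_le[OF w FM]) auto
      also have "(2 * norm h) powr s = 2 powr s * norm h powr s" by (simp add: powr_mult)
      also have "kern_mass / torsion_const * (2 powr s * norm h powr s) \<le> kern_mass / torsion_const * (2 powr s * norm h powr \<beta>)"
        using True \<beta>1 kern_mass_nonneg torsion_const(1) by (intro mult_left_mono powr_mono') auto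
      finally have "\<bar>w (x + h) - w x\<bar> \<le> A * norm h powr \<beta>" by (simp add: A_def algebra_simps)
      moreover have "0 \<le> 2 * U * norm h powr \<beta>" using U(1) by simp
      ultimately show ?thesis unfolding distrib_right by linarith
    next
      case False
      have "\<bar>w (x + h) - w x\<bar> \<le> 2 * U * 1" using U(2)[of x] U(2)[of "x + h"] by linarith
      also have "\<dots> \<le> 2 * U * norm h powr \<beta>"
        using False \<beta> U(1) by (intro mult_left_mono ge_one_powr_ge_zero) auto
      finally show ?thesis using A by (simp add: distrib_right add_increasing)
    qed
    have H: "\<bar>u x - u y\<bar> \<le> (A + 2 * U + 2) * dist x y powr \<beta>" for x y
    proof -
      have "\<bar>w x - w y\<bar> \<le> (A + 2 * U) * dist x y powr \<beta>" using w_inc[of y "x - y"] by (simp add: dist_norm)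
      moreover have "\<bar>g x - g y\<bar> \<le> 2 * dist x y powr \<beta>" unfolding g_def using \<beta>(1) \<beta>1(1) by (rule ext_data_Holder)
      ultimately show ?thesis unfolding u_def distrib_right by linarith
    qed
    moreover have "continuous_on UNIV u" unfolding u_def by (intro continuous_intros w_cont g_cont)
    moreover have "bounded (range u)"
    proof (rule boundedI)
      fix y assume "y \<in> range u"
      then show "norm y \<le> U + 1" using U(2) g1 by (auto simp: u_def intro!: order_trans[OF abs_triangle_ineq] add_mono)
    qed
    \<comment> \<open>As 0 < \<beta> < 1, the decomposition of the exponent is k = 0 with fractional
      part \<beta>, and no derivatives are involved.\<close>
    ultimately have "\<beta> = real 0 + \<beta> \<and> 0 < \<beta> \<and> \<beta> \<le> 1 \<and> Ck_on 0 UNIV u \<and>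
      (\<forall>is. length is \<le> 0 \<longrightarrow> bounded (iter_partial is u ` UNIV)) \<and>
      (\<forall>is. length is = 0 \<longrightarrow> (\<exists>C. \<forall>x\<in>UNIV. \<forall>y\<in>UNIV.
        \<bar>iter_partial is u x - iter_partial is u y\<bar> \<le> C * dist x y powr \<beta>))"
      using \<beta> \<beta>1 H by (auto simp: Ck_on_def)
    then show ?thesis unfolding holder_space_def by blast
  qed
  moreover have "\<forall>x\<in>ball 0 2 - ball 0 1. u x = 0"
  proof
    fix x :: "real^2" assume x: "x \<in> ball 0 2 - ball 0 1"
    then have "x $ 1 \<le> 3" using component_le_norm_cart[of x 1] by auto
    then show "u x = 0" using w_off[of x] x by (simp add: u_def g_def ext_data_zero)
  qed
  moreover have "u \<notin> holder_space (\<alpha> + 2 * s) (ball 0 (1/2))"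
  proof
    assume "u \<in> holder_space (\<alpha> + 2 * s) (ball 0 (1/2))"
    then obtain C' where C': "\<And>x l. 0 < l \<Longrightarrow> \<forall>t\<in>{-l..2 * l}. x + t *\<^sub>R axis 2 1 \<in> ball 0 (1/2) \<Longrightarrow>
      \<bar>third_diff (\<lambda>t. u (x + t *\<^sub>R axis 2 1)) l\<bar> \<le> C' * l powr (\<alpha> + 2 * s)"
      using holder_space_third_diff[of u "\<alpha> + 2 * s" "ball 0 (1/2)"] \<alpha> s_less_1 by auto
    obtain \<sigma> C where \<sigma>: "\<beta> < \<sigma>" "\<And>x h. \<bar>h\<bar> \<le> 1 \<Longrightarrow> \<bar>w (x + h *\<^sub>R axis 2 1) - w x\<bar> \<le> C * \<bar>h\<bar> powr \<sigma>"
      using dirichlet_solution_axial_increment[OF w \<beta>(1) \<beta>1(2) F_eq, of kern_mass] coeff(2) by auto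
    show False
    proof (rule weak_solution_not_regular[OF w_cont U(2) w_off _ \<beta>(1) \<beta>1(1) \<sigma>(1) _ F_eq _ _ \<sigma>(2)])
      show "(\<integral>x. w x * frac_lap \<phi> x \<partial>lborel) = (\<integral>x. \<phi> x * F x \<partial>lborel) \<and> integrable lborel (\<lambda>x. \<phi> x * F x)"
        if "0 \<le> r" "r < 1" "C11_bump r \<phi>" for r \<phi>
        using dirichlet_solution_weak[OF w contF that(3,1,2)] by blast
      show "\<beta> < \<alpha> + 2 * s - 2 * s" using \<beta> by simp
      show "0 < (6::real) powr (-1 - 2 * s) / 2" by simp
      show "6 powr (-1 - 2 * s) / 2 \<le> ext_coeff (x $ 1)" if "x \<in> ball 0 1" for x :: "real^2"
        using coeff(3)[of x] that by simp
      fix x :: "real^2" and l :: real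
      assume l: "0 < l" "l \<le> 1 / 32" and x: "\<bar>x $ 1\<bar> \<le> 1 / 8" "\<bar>x $ 2\<bar> \<le> 1 / 4"
      have "norm (x + t *\<^sub>R axis 2 1) < 1 / 2" if "t \<in> {-l..2 * l}" for t
      proof -
        have "\<bar>t\<bar> \<le> 1 / 16" using that l by (auto simp: abs_le_iff)
        then show ?thesis using norm_le_components_2[of "x + t *\<^sub>R axis 2 1"] x by simp
      qed
      then have "\<bar>third_diff (\<lambda>t. u (x + t *\<^sub>R axis 2 1)) l\<bar> \<le> C' * l powr (\<alpha> + 2 * s)"
        using l by (intro C') auto
      \<comment> \<open>The datum vanishes near the origin, so regularity assumed for
        \<open>u\<close> there is regularity of \<open>w\<close>.\<close>
      moreover have "u (x + t *\<^sub>R axis 2 1) = w (x + t *\<^sub>R axis 2 1)" for t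
        using x by (simp add: u_def g_def ext_data_zero)
      ultimately show "\<bar>third_diff (\<lambda>t. w (x + t *\<^sub>R axis 2 1)) l\<bar> \<le> C' * l powr (\<alpha> + 2 * s)" by simp
    qed
  qed
  ultimately show ?thesis by blast
qed

end

theorem proposition6p1:
  fixes s \<alpha> :: real
  assumes "0 < s" and "s < 1" and "0 < \<alpha>" and "\<alpha> \<le> s"
  shows "\<exists>\<epsilon>\<^sub>0>0. \<epsilon>\<^sub>0 \<le> \<alpha> \<and> (\<forall>\<epsilon>. 0 < \<epsilon> \<and> \<epsilon> < \<epsilon>\<^sub>0 \<longrightarrow>
    (\<exists>u :: real^2 \<Rightarrow> real.
       weak_solution s (ball 0 1) u \<and>
       u \<in> holder_space (\<alpha> - \<epsilon>) UNIV \<and>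
       (\<forall>x \<in> ball 0 2 - ball 0 1. u x = 0) \<and>
       u \<notin> holder_space (\<alpha> + 2 * s) (ball 0 (1/2))))"
proof (intro exI[of _ \<alpha>] conjI allI impI)
  interpret fractional_order s by unfold_locales (use assms in auto)
  \<comment> \<open>Every \<epsilon> below \<alpha> is small enough: \<beta> = \<alpha> - \<epsilon>
    then lies strictly between 0 and \<alpha>.\<close>
  fix \<epsilon> :: real assume "0 < \<epsilon> \<and> \<epsilon> < \<alpha>"
  then show "\<exists>u :: real^2 \<Rightarrow> real.
       weak_solution s (ball 0 1) u \<and>
       u \<in> holder_space (\<alpha> - \<epsilon>) UNIV \<and>
       (\<forall>x \<in> ball 0 2 - ball 0 1. u x = 0) \<and>
       u \<notin> holder_space (\<alpha> + 2 * s) (ball 0 (1/2))"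
    using assms by (intro counterexample_exists) auto
qed (use assms in auto)

end
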